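(* Assume that $\mathcal{D}(A)\subset\mathcal{D}(Q^{-1/2})$, $|(-A)^{1/2}Q^{1/2}|_{\mathcal{L}_2(H)}<\infty$ and $|Q^{-1/2}(-A)^{-1}|_{\mathcal{L}(H)}<\infty$. Assume that $F\colon H\to H$ is Fréchet differentiable and that there exist $L_F,L>0$ such that $|F(u)-F(v)|\le L_F|u-v|$ for $u,v\in H$, $|F(u)|_{\dot H^1}\le L(1+|u|_{\dot H^1})$ for $u\in\dot H^1$, and $|F'(u)v|_{\dot H^2}\le L(1+|u|_{\dot H^2}^2)|v|_{\dot H^2}$ for $u,v\in\dot H^2$. Let $\tau>0$. Then the family $\{Y_y^{\varepsilon,n}\}_{\varepsilon>0}$ of continuous-time interpolations of the fully discrete accelerated exponential Euler method with stepsize $\tau$ satisfies a uniform large deviations principle on $C([0,T];H_n)$ with rate $1/\varepsilon^2$ and good rate function $I_{0,T}^{n,\tau,y}$, i.e.: (i) (compact level sets) for any $T>0$, $n\in\mathbb{N}^+$ and $y\in H_n$, the level set $K_{0,T}^{n,\tau,y}(\alpha):=\{z\in C([0,T];H_n): I_{0,T}^{n,\tau,y}(z)\le\alpha\}$ is compact for every $\alpha\ge 0$; (ii) (uniform lower bound) for any $T>0$, $n\in\mathbb{N}^+$, $\alpha\ge0$, $\delta>0$, $\gamma>0$ and $K>0$, there exists $\varepsilon_0>0$ such that for any $y\in H_n$ with $|y|\le K$ and any $z\in K_{0,T}^{n,\tau,y}(\alpha)$, $$\mathbb{P}\big(|Y_y^{\varepsilon,n}-z|_{C([0,T];H)}<\delta\big)\ge\exp\Big(-\frac{I_{0,T}^{n,\tau,y}(z)+\gamma}{\varepsilon^2}\Big),\quad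 0<\varepsilon\le\varepsilon_0;$$ (iii) (uniform upper bound) for any $T>0$, $n\in\mathbb{N}^+$, $\alpha\ge0$, $\delta>0$, $\gamma>0$ and $K>0$, there exists $\varepsilon_0>0$ such that for any $y\in H_n$ with $|y|\le K$, $$\mathbb{P}\big(\rho^{C([0,T];H)}(Y_y^{\varepsilon,n},K_{0,T}^{n,\tau,y}(\alpha))\ge\delta\big)\le\exp\Big(-\frac{\alpha-\gamma}{\varepsilon^2}\Big),\quad 0<\varepsilon\le\varepsilon_0,$$ where $\rho^{C([0,T];H)}(z,U):=\inf_{z'\in U}|z-z'|_{C([0,T];H)}$.
   Context: $H:=L^2((0,1);\mathbb{R})$ with inner product $\langle\cdot,\cdot\rangle$ and norm $|\cdot|$; $\mathcal{L}(H)$ and $\mathcal{L}_2(H)$ are the bounded and the Hilbert–Schmidt operators on $H$. $A$ is the Dirichlet Laplacian on $(0,1)$, $\mathcal{D}(A)=H_0^1\cap H^2$; $e_i(\xi)=\sqrt2\sin(i\pi\xi)$ is an orthonormal basis of $H$ with $-Ae_i=\lambda_ie_i$, $\lambda_i=\pi^2i^2$. For $\gamma\in\mathbb{R}$, $\dot H^\gamma:=\mathcal{D}((-A)^{\gamma/2})$ with norm $|u|_{\dot H^\gamma}=|(-A)^{\gamma/2}u|$. $Q$ is a self-adjoint, positive definite bounded linear operator on $H$ with $Qe_i=q_ie_i$, $q_i>0$; $Q^{-1/2}\colon Q^{1/2}(H)\to H$ is the inverse of $Q^{1/2}$ and $\mathcal{D}(Q^{-1/2})=Q^{1/2}(H)$.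 $W(t)=\sum_i\beta_i(t)e_i$ is a cylindrical Wiener process on a filtered probability space $(\Omega,\mathcal{F},\mathbb{P};\{\mathcal F_t\}_{t\ge 0})$ satisfying the usual conditions, with $\beta_i$ independent standard real Brownian motions. For $n\in\mathbb{N}^+$: $H_n:=\mathrm{span}\{e_1,\dots,e_n\}$, $P_n$ is the orthogonal projection of $H$ onto $H_n$, $A_n:=P_nA$ (on $H_n$), $E_n(t):=e^{tA_n}$, $F_n:=P_nF$, $Q_n^{1/2}:=P_nQ^{1/2}$, $W_n:=P_nW$. With $t_m=m\tau$, $m\in\mathbb{N}$, the fully discrete accelerated exponential Euler method is $Y_{y,0}^{\varepsilon,n}=y\in H_n$, $$Y_{y,m+1}^{\varepsilon,n}=E_n(\tau)Y_{y,m}^{\varepsilon,n}+\int_{t_m}^{t_{m+1}}E_n(t_{m+1}-s)F_n(Y_{y,m}^{\varepsilon,n})ds+\varepsilon\int_{t_m}^{t_{m+1}}E_n(t_{m+1}-s)Q_n^{1/2}dW_n(s),$$ and its continuous-time interpolation $Y_y^{\varepsilon,n}(t)$ is the solution of $$dY_y^{\varepsilon,n}(t)=\big(A_nY_y^{\varepsilon,n}(t)+F_n(Y_y^{\varepsilon,n}(\tau\lfloor t/\tau\rfloor))\big)dt+\varepsilon Q_n^{1/2}dW_n(t),\ t>0,\quad Y_y^{\varepsilon,n}(0)=y,$$ so that $Y_y^{\varepsilon,n}(t_m)=Y_{y,m}^{\varepsilon,n}$. For $\phi\in L^2(0,T;H_n)$, $z_{0,y}^{n,\tau,\phi}$ is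 the unique mild solution of $\frac{dz(t)}{dt}=A_nz(t)+F_n(z(\tau\lfloor t/\tau\rfloor))+Q_n^{1/2}\phi(t)$, $z(0)=y$. The rate function is $$I_{0,T}^{n,\tau,y}(z)=\tfrac12\inf\{|\phi|_{L^2(0,T;H)}^2:\phi\in L^2(0,T;H_n),\ z_{0,y}^{n,\tau,\phi}=z\},\quad z\in C([0,T];H_n),$$ with $\inf\emptyset=+\infty$. *)

theory Defs
  imports "HOL-Probability.Probability"
begin

section \<open>The Hilbert space \<open>L\<^sup>2((0,1); \<real>)\<close>\<close>

abbreviation M01 :: "real measure" where
  "M01 \<equiv> lebesgue_on {0<..<1}"

definition sq_int :: "(real \<Rightarrow> real) \<Rightarrow> bool" where
  "sq_int f \<longleftrightarrow> f \<in> borel_measurable M01 \<and> integrable M01 (\<lambda>x. (f x)\<^sup>2)"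

definition l2_rel :: "(real \<Rightarrow> real) \<Rightarrow> (real \<Rightarrow> real) \<Rightarrow> bool" where
  "l2_rel f g \<longleftrightarrow> sq_int f \<and> sq_int g \<and> (AE x in M01. f x = g x)"

lemma sq_int_zero: "sq_int (\<lambda>_. 0)"
  by (simp add: sq_int_def)

lemma sq_int_mult:
  assumes "sq_int f" "sq_int g"
  shows "integrable M01 (\<lambda>x. f x * g x)"
proof (rule Bochner_Integration.integrable_bound)
  show "integrable M01 (\<lambda>x. (f x)\<^sup>2 + (g x)\<^sup>2)"
    using assms by (simp add: sq_int_def)
  show "(\<lambda>x. f x * g x) \<in> borel_measurable M01"
    using assms unfolding sq_int_def by (intro borel_measurable_times) auto
  have "norm (f x * g x) \<le> norm ((f x)\<^sup>2 + (g x)\<^sup>2)" for x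
  proof -
    have "2 * \<bar>f x\<bar> * \<bar>g x\<bar> \<le> (f x)\<^sup>2 + (g x)\<^sup>2"
      using sum_squares_bound[of "\<bar>f x\<bar>" "\<bar>g x\<bar>"] by simp
    moreover have "0 \<le> \<bar>f x\<bar> * \<bar>g x\<bar>" by simp
    ultimately have "\<bar>f x\<bar> * \<bar>g x\<bar> \<le> (f x)\<^sup>2 + (g x)\<^sup>2" by linarith
    then show ?thesis by (simp add: abs_mult)
  qed
  then show "AE x in M01. norm (f x * g x) \<le> norm ((f x)\<^sup>2 + (g x)\<^sup>2)" by simp
qed

lemma sq_int_add:
  assumes "sq_int f" "sq_int g"
  shows "sq_int (\<lambda>x. f x + g x)"
proof -
  have "integrable M01 (\<lambda>x. (f x)\<^sup>2 + (g x)\<^sup>2 + 2 * (f x * g x))"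
    using assms sq_int_mult[OF assms] by (simp add: sq_int_def)
  moreover have "(\<lambda>x. f x + g x) \<in> borel_measurable M01"
    using assms unfolding sq_int_def by (intro borel_measurable_add) auto
  ultimately show ?thesis
    by (simp add: sq_int_def power2_sum mult.assoc)
qed

lemma sq_int_cmult: "sq_int f \<Longrightarrow> sq_int (\<lambda>x. c * f x)"
  unfolding sq_int_def by (auto simp: power_mult_distrib intro: borel_measurable_times)

lemma sq_int_uminus: "sq_int f \<Longrightarrow> sq_int (\<lambda>x. - f x)"
  unfolding sq_int_def by (auto intro: borel_measurable_uminus)

lemma sq_int_diff: "sq_int f \<Longrightarrow> sq_int g \<Longrightarrow> sq_int (\<lambda>x. f x - g x)"
  using sq_int_add[of f "\<lambda>x. - g x"] sq_int_uminus[of g] by simp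

quotient_type L2 = "real \<Rightarrow> real" / partial: l2_rel
proof (rule part_equivpI)
  show "\<exists>f. l2_rel f f" using sq_int_zero by (auto simp: l2_rel_def)
  show "symp l2_rel" by (auto intro!: sympI simp: l2_rel_def elim!: eventually_mono)
  show "transp l2_rel"
  proof (rule transpI)
    fix f g h assume "l2_rel f g" "l2_rel g h"
    then have s: "sq_int f" "sq_int h" and "AE x in M01. f x = g x" "AE x in M01. g x = h x"
      by (auto simp: l2_rel_def)
    from this(3,4) have "AE x in M01. f x = h x" by eventually_elim simp
    with s show "l2_rel f h" by (simp add: l2_rel_def)
  qed
qed

instantiation L2 :: real_vector
begin

lift_definition zero_L2 :: L2 is "\<lambda>_. 0"
  by (simp add: l2_rel_def sq_int_zero)

lift_definition plus_L2 :: "L2 \<Rightarrow> L2 \<Rightarrow> L2" is "\<lambda>f g x. f x + g x"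
  by (auto simp: l2_rel_def intro: sq_int_add)

lift_definition minus_L2 :: "L2 \<Rightarrow> L2 \<Rightarrow> L2" is "\<lambda>f g x. f x - g x"
  by (auto simp: l2_rel_def intro: sq_int_diff)

lift_definition uminus_L2 :: "L2 \<Rightarrow> L2" is "\<lambda>f x. - f x"
  by (auto simp: l2_rel_def intro: sq_int_uminus)

lift_definition scaleR_L2 :: "real \<Rightarrow> L2 \<Rightarrow> L2" is "\<lambda>c f x. c * f x"
  by (auto simp: l2_rel_def intro: sq_int_cmult)

instance
proof
  fix u v w :: L2 and r s :: real
  show "u + v + w = u + (v + w)"
    by transfer (auto simp: l2_rel_def add.assoc intro!: sq_int_add)
  show "u + v = v + u"
    by transfer (auto simp: l2_rel_def add.commute intro!: sq_int_add)
  show "0 + u = u"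
    by transfer (auto simp: l2_rel_def)
  show "- u + u = 0"
    by transfer (auto simp: l2_rel_def sq_int_zero)
  show "u - v = u + - v"
    by transfer (auto simp: l2_rel_def intro: sq_int_diff)
  show "r *\<^sub>R (u + v) = r *\<^sub>R u + r *\<^sub>R v"
    by transfer (auto simp: l2_rel_def algebra_simps intro!: sq_int_add sq_int_cmult)
  show "(r + s) *\<^sub>R u = r *\<^sub>R u + s *\<^sub>R u"
    by transfer (auto simp: l2_rel_def algebra_simps intro!: sq_int_add sq_int_cmult)
  show "r *\<^sub>R s *\<^sub>R u = (r * s) *\<^sub>R u"
    by transfer (auto simp: l2_rel_def algebra_simps intro!: sq_int_cmult)
  show "1 *\<^sub>R u = u"
    by transfer (auto simp: l2_rel_def)
qed

end

instantiation L2 :: real_inner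
begin

lift_definition inner_L2 :: "L2 \<Rightarrow> L2 \<Rightarrow> real" is "\<lambda>f g. \<integral>x. f x * g x \<partial>M01"
proof -
  fix f f' g g' assume fg: "l2_rel f f'" "l2_rel g g'"
  then have "AE x in M01. f x = f' x" "AE x in M01. g x = g' x"
    by (simp_all add: l2_rel_def)
  then have "AE x in M01. f x * g x = f' x * g' x"
    by eventually_elim simp
  moreover have "(\<lambda>x. f x * g x) \<in> borel_measurable M01" "(\<lambda>x. f' x * g' x) \<in> borel_measurable M01"
    using fg by (simp_all add: l2_rel_def sq_int_def borel_measurable_times)
  ultimately show "(\<integral>x. f x * g x \<partial>M01) = (\<integral>x. f' x * g' x \<partial>M01)"
    by (intro integral_cong_AE)
qed

definition norm_L2 :: "L2 \<Rightarrow> real" where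
  "norm_L2 u = sqrt (inner u u)"

definition dist_L2 :: "L2 \<Rightarrow> L2 \<Rightarrow> real" where
  "dist_L2 u v = norm (u - v)"

definition sgn_L2 :: "L2 \<Rightarrow> L2" where
  "sgn_L2 u = u /\<^sub>R norm u"

definition uniformity_L2 :: "(L2 \<times> L2) filter" where
  "uniformity_L2 = (INF e\<in>{0<..}. principal {(u, v). dist u v < e})"

definition open_L2 :: "L2 set \<Rightarrow> bool" where
  "open_L2 U \<longleftrightarrow> (\<forall>u\<in>U. \<forall>\<^sub>F (u', v) in uniformity. u' = u \<longrightarrow> v \<in> U)"

instance
proof
  fix u v w :: L2 and r :: real
  show "sgn u = u /\<^sub>R norm u" by (rule sgn_L2_def)
  show "dist u v = norm (u - v)" by (rule dist_L2_def)
  show "inner u v = inner v u"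
    by transfer (simp add: mult.commute)
  show "inner (u + v) w = inner u w + inner v w"
    by transfer (simp add: l2_rel_def distrib_right sq_int_mult)
  show "inner (r *\<^sub>R u) v = r * inner u v"
    by transfer (simp add: mult.assoc)
  show "0 \<le> inner u u"
    by transfer (simp add: integral_nonneg_AE)
  show "inner u u = 0 \<longleftrightarrow> u = 0"
  proof transfer
    fix f assume "l2_rel f f"
    then have f: "sq_int f" by (simp add: l2_rel_def)
    have "(\<integral>x. f x * f x \<partial>M01) = 0 \<longleftrightarrow> (AE x in M01. f x * f x = 0)"
      by (intro integral_nonneg_eq_0_iff_AE sq_int_mult f) simp
    then show "(\<integral>x. f x * f x \<partial>M01) = 0 \<longleftrightarrow> l2_rel f (\<lambda>_. 0)"
      using f sq_int_zero by (simp add: l2_rel_def)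
  qed
  show "norm u = sqrt (inner u u)" by (rule norm_L2_def)
qed (rule uniformity_L2_def open_L2_def)+

end

text \<open>The class of \<open>f\<close>; meaningful only for square-integrable \<open>f\<close>.\<close>
abbreviation L2_of :: "(real \<Rightarrow> real) \<Rightarrow> L2" where
  "L2_of f \<equiv> abs_L2 f"


section \<open>The Dirichlet Laplacian and its functional calculus\<close>

text \<open>Test functions are the \<open>C\<^sup>1\<close> functions with compact support in \<open>(0,1)\<close>; they give the same
  Sobolev spaces as smooth ones.\<close>
definition test_fun :: "(real \<Rightarrow> real) \<Rightarrow> bool" where
  "test_fun \<phi> \<longleftrightarrow> \<phi> differentiable_on UNIV \<and> continuous_on UNIV (deriv \<phi>) \<and>
     (\<exists>a b. 0 < a \<and> b < 1 \<and> (\<forall>x. x \<notin> {a..b} \<longrightarrow> \<phi> x = 0))"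

definition has_weak_deriv :: "L2 \<Rightarrow> L2 \<Rightarrow> bool" where
  "has_weak_deriv u g \<longleftrightarrow>
     (\<forall>\<phi>. test_fun \<phi> \<longrightarrow> inner u (L2_of (deriv \<phi>)) = - inner g (L2_of \<phi>))"

definition weak_deriv :: "L2 \<Rightarrow> L2" where
  "weak_deriv u = (THE g. has_weak_deriv u g)"

definition H1 :: "L2 set" where
  "H1 = {u. \<exists>g. has_weak_deriv u g}"

definition H2 :: "L2 set" where
  "H2 = {u \<in> H1. weak_deriv u \<in> H1}"

text \<open>The closure of the test functions in the \<open>H\<^sup>1\<close> norm.\<close>
definition H10 :: "L2 set" where
  "H10 = {u \<in> H1. \<exists>\<phi>. (\<forall>k::nat. test_fun (\<phi> k)) \<and>
     (\<lambda>k. L2_of (\<phi> k)) \<longlonglongrightarrow> u \<and> (\<lambda>k. L2_of (deriv (\<phi> k))) \<longlonglongrightarrow> weak_deriv u}"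

definition dom_lap :: "L2 set" where
  "dom_lap = H10 \<inter> H2"

definition lap :: "L2 \<Rightarrow> L2" where
  "lap u = weak_deriv (weak_deriv u)"

definition neg_A_inv :: "L2 \<Rightarrow> L2" where
  "neg_A_inv = inv_into dom_lap (\<lambda>u. - lap u)"

text \<open>Indices start at \<open>1\<close>.\<close>
definition eb :: "nat \<Rightarrow> L2" where
  "eb i = L2_of (\<lambda>\<xi>. sqrt 2 * sin (real i * pi * \<xi>))"

definition lam :: "nat \<Rightarrow> real" where
  "lam i = pi\<^sup>2 * (real i)\<^sup>2"

definition dom_neg_A_pow :: "real \<Rightarrow> L2 set" where
  "dom_neg_A_pow s = {u. summable (\<lambda>k. (lam (Suc k) powr s * inner u (eb (Suc k)))\<^sup>2)}"

definition neg_A_pow :: "real \<Rightarrow> L2 \<Rightarrow> L2" where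
  "neg_A_pow s u = (\<Sum>k. (lam (Suc k) powr s * inner u (eb (Suc k))) *\<^sub>R eb (Suc k))"

definition Hdot :: "real \<Rightarrow> L2 set" where
  "Hdot \<gamma> = dom_neg_A_pow (\<gamma> / 2)"

definition Hdot_norm :: "real \<Rightarrow> L2 \<Rightarrow> real" where
  "Hdot_norm \<gamma> u = norm (neg_A_pow (\<gamma> / 2) u)"


section \<open>Operators on \<open>H\<close>\<close>

definition self_adjoint :: "(L2 \<Rightarrow> L2) \<Rightarrow> bool" where
  "self_adjoint S \<longleftrightarrow> (\<forall>u v. inner (S u) v = inner u (S v))"

text \<open>\<open>R\<close> is the nonnegative square root of \<open>Q\<close>, which is unique.\<close>
definition is_sqrt_op :: "(L2 \<Rightarrow> L2) \<Rightarrow> (L2 \<Rightarrow> L2) \<Rightarrow> bool" where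
  "is_sqrt_op R Q \<longleftrightarrow> bounded_linear R \<and> self_adjoint R \<and> (\<forall>u. 0 \<le> inner (R u) u) \<and>
     (\<forall>u. R (R u) = Q u)"

text \<open>The Hilbert-Schmidt norm does not depend on the orthonormal basis; we use \<open>eb\<close>.\<close>
definition hilbert_schmidt :: "(L2 \<Rightarrow> L2) \<Rightarrow> bool" where
  "hilbert_schmidt S \<longleftrightarrow> bounded_linear S \<and> summable (\<lambda>k. (norm (S (eb (Suc k))))\<^sup>2)"


section \<open>Spectral Galerkin discretisation\<close>

definition Hn :: "nat \<Rightarrow> L2 set" where
  "Hn n = span (eb ` {1..n})"

text \<open>The orthogonal projection onto \<open>Hn n\<close>, as \<open>eb 1, eb 2, \<dots>\<close> are orthonormal.\<close>
definition Pn :: "nat \<Rightarrow> L2 \<Rightarrow> L2" where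
  "Pn n u = (\<Sum>i\<in>{1..n}. inner u (eb i) *\<^sub>R eb i)"

definition An :: "nat \<Rightarrow> L2 \<Rightarrow> L2" where
  "An n u = Pn n (lap u)"

definition En :: "nat \<Rightarrow> real \<Rightarrow> L2 \<Rightarrow> L2" where
  "En n t u = (\<Sum>k. (t ^ k / fact k) *\<^sub>R ((An n ^^ k) u))"

definition grid :: "real \<Rightarrow> real \<Rightarrow> real" where
  "grid \<tau> t = \<tau> * of_int \<lfloor>t / \<tau>\<rfloor>"


section \<open>Wiener process\<close>

definition usual_filtration :: "'a measure \<Rightarrow> (real \<Rightarrow> 'a measure) \<Rightarrow> bool" where
  "usual_filtration M Ft \<longleftrightarrow>
     (\<forall>t\<ge>0. space (Ft t) = space M \<and> sets (Ft t) \<subseteq> sets M) \<and>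
     (\<forall>s t. 0 \<le> s \<and> s \<le> t \<longrightarrow> sets (Ft s) \<subseteq> sets (Ft t)) \<and>
     (\<forall>N\<in>null_sets M. \<forall>B\<subseteq>N. B \<in> sets (Ft 0)) \<and>
     (\<forall>t\<ge>0. sets (Ft t) = (\<Inter>s\<in>{t<..}. sets (Ft s)))"

definition brownian_motion :: "'a measure \<Rightarrow> (real \<Rightarrow> 'a measure) \<Rightarrow> (real \<Rightarrow> 'a \<Rightarrow> real) \<Rightarrow> bool" where
  "brownian_motion M Ft b \<longleftrightarrow>
     (\<forall>t\<ge>0. b t \<in> borel_measurable (Ft t)) \<and>
     (AE \<omega> in M. b 0 \<omega> = 0) \<and>
     (AE \<omega> in M. continuous_on {0..} (\<lambda>t. b t \<omega>)) \<and>
     (\<forall>s t. 0 \<le> s \<and> s < t \<longrightarrow>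
        distributed M lborel (\<lambda>\<omega>. b t \<omega> - b s \<omega>) (normal_density 0 (sqrt (t - s))) \<and>
        prob_space.indep_set M (sets (Ft s))
          (sets (vimage_algebra (space M) (\<lambda>\<omega>. b t \<omega> - b s \<omega>) borel)))"

text \<open>A cylindrical Wiener process is given by its coordinate processes with respect to \<open>eb\<close>.\<close>
definition cylindrical_wiener ::
  "'a measure \<Rightarrow> (real \<Rightarrow> 'a measure) \<Rightarrow> (nat \<Rightarrow> real \<Rightarrow> 'a \<Rightarrow> real) \<Rightarrow> bool" where
  "cylindrical_wiener M Ft \<beta> \<longleftrightarrow>
     (\<forall>i\<ge>1. brownian_motion M Ft (\<beta> i)) \<and>
     prob_space.indep_vars M (\<lambda>_. Pi\<^sub>M {0..} (\<lambda>_. borel)) (\<lambda>i \<omega>. \<lambda>t\<in>{0..}. \<beta> i t \<omega>) {1..}"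

text \<open>\<open>Pn n\<close> applied to the formal series \<open>W(t) = (\<Sum>i\<ge>1. \<beta> i t *\<^sub>R eb i)\<close>.\<close>
definition Wn :: "(nat \<Rightarrow> real \<Rightarrow> 'a \<Rightarrow> real) \<Rightarrow> nat \<Rightarrow> real \<Rightarrow> 'a \<Rightarrow> L2" where
  "Wn \<beta> n t \<omega> = (\<Sum>i\<in>{1..n}. \<beta> i t \<omega> *\<^sub>R eb i)"


section \<open>The exponential Euler interpolation and its rate function\<close>

text \<open>\<open>Y\<close> solves \<open>dY = (An Y + Fn (Y (grid \<tau> t))) dt + \<epsilon> Qn\<^sup>1\<^sup>/\<^sup>2 dWn\<close>, \<open>Y 0 = y\<close>. Since the noise is
  additive, the stochastic integral up to time \<open>t\<close> is \<open>\<epsilon> Qn\<^sup>1\<^sup>/\<^sup>2 (Wn t)\<close>. The argument \<open>Qh\<close> stands for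
  the square root of \<open>Q\<close>.\<close>
definition euler_interpolation ::
  "'a measure \<Rightarrow> (real \<Rightarrow> 'a measure) \<Rightarrow> (nat \<Rightarrow> real \<Rightarrow> 'a \<Rightarrow> real) \<Rightarrow> (L2 \<Rightarrow> L2) \<Rightarrow> (L2 \<Rightarrow> L2) \<Rightarrow>
   real \<Rightarrow> real \<Rightarrow> nat \<Rightarrow> L2 \<Rightarrow> (real \<Rightarrow> 'a \<Rightarrow> L2) \<Rightarrow> bool" where
  "euler_interpolation M Ft \<beta> F Qh \<tau> \<epsilon> n y Y \<longleftrightarrow>
     (\<forall>t\<ge>0. Y t \<in> borel_measurable (Ft t) \<and> (\<forall>\<omega>\<in>space M. Y t \<omega> \<in> Hn n)) \<and>
     (AE \<omega> in M. continuous_on {0..} (\<lambda>t. Y t \<omega>) \<and>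
        (\<forall>t\<ge>0. ((\<lambda>s. An n (Y s \<omega>) + Pn n (F (Y (grid \<tau> s) \<omega>)))
            has_integral (Y t \<omega> - y - \<epsilon> *\<^sub>R Pn n (Qh (Wn \<beta> n t \<omega>)))) {0..t}))"

text \<open>\<open>C([0,T]; S)\<close> with the supremum metric; its points are functions that are extensional
  on \<open>[0,T]\<close>.\<close>
definition C_space :: "real \<Rightarrow> L2 set \<Rightarrow> (real \<Rightarrow> L2) metric" where
  "C_space T S = cfunspace (top_of_set {0..T}) (submetric euclidean_metric S)"

definition L2_control :: "real \<Rightarrow> nat \<Rightarrow> (real \<Rightarrow> L2) set" where
  "L2_control T n = {\<phi>. \<phi> \<in> borel_measurable (lebesgue_on {0<..<T}) \<and>
     (\<forall>t\<in>{0<..<T}. \<phi> t \<in> Hn n) \<and> integrable (lebesgue_on {0<..<T}) (\<lambda>t. (norm (\<phi> t))\<^sup>2)}"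

text \<open>\<open>z\<close> is the mild solution of the skeleton equation driven by the control \<open>\<phi>\<close>.\<close>
definition is_controlled_path ::
  "(L2 \<Rightarrow> L2) \<Rightarrow> (L2 \<Rightarrow> L2) \<Rightarrow> real \<Rightarrow> real \<Rightarrow> nat \<Rightarrow> L2 \<Rightarrow> (real \<Rightarrow> L2) \<Rightarrow> (real \<Rightarrow> L2) \<Rightarrow> bool" where
  "is_controlled_path F Qh \<tau> T n y \<phi> z \<longleftrightarrow>
     z \<in> mspace (C_space T (Hn n)) \<and>
     (\<forall>t\<in>{0..T}. ((\<lambda>s. En n (t - s) (Pn n (F (z (grid \<tau> s))) + Pn n (Qh (\<phi> s))))
         has_integral (z t - En n t y)) {0..t})"

definition rate_fun ::
  "(L2 \<Rightarrow> L2) \<Rightarrow> (L2 \<Rightarrow> L2) \<Rightarrow> real \<Rightarrow> real \<Rightarrow> nat \<Rightarrow> L2 \<Rightarrow> (real \<Rightarrow> L2) \<Rightarrow> ereal" where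
  "rate_fun F Qh \<tau> T n y z =
     ereal (1 / 2) * Inf {ereal (\<integral>t. (norm (\<phi> t))\<^sup>2 \<partial>lebesgue_on {0<..<T}) |\<phi>.
       \<phi> \<in> L2_control T n \<and> is_controlled_path F Qh \<tau> T n y \<phi> z}"

definition level_set ::
  "(L2 \<Rightarrow> L2) \<Rightarrow> (L2 \<Rightarrow> L2) \<Rightarrow> real \<Rightarrow> real \<Rightarrow> nat \<Rightarrow> L2 \<Rightarrow> real \<Rightarrow> (real \<Rightarrow> L2) set" where
  "level_set F Qh \<tau> T n y \<alpha> =
     {z \<in> mspace (C_space T (Hn n)). rate_fun F Qh \<tau> T n y z \<le> ereal \<alpha>}"

definition C_dist :: "real \<Rightarrow> (real \<Rightarrow> L2) \<Rightarrow> (real \<Rightarrow> L2) \<Rightarrow> real" where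
  "C_dist T z w = mdist (C_space T UNIV) (restrict z {0..T}) (restrict w {0..T})"

definition C_set_dist :: "real \<Rightarrow> (real \<Rightarrow> L2) \<Rightarrow> (real \<Rightarrow> L2) set \<Rightarrow> real" where
  "C_set_dist T z U = (INF z'\<in>U. C_dist T z z')"

end

theory Submission
  imports Defs "HOL-Complex_Analysis.Great_Picard"
begin

text \<open>Since the noise is additive, \<open>Y\<close> is the image of \<open>\<epsilon> Qh W\<close> under the map that sends a driver \<open>w\<close> to the
  solution of \<open>z t = y + \<integral>\<^sub>0\<^sup>t (An n (z s) + Pn n (F (z (grid \<tau> s)))) ds + w t\<close>, and the paths of finite
  rate are the images of \<open>Qh \<integral>\<phi>\<close>. This map is Lipschitz in the supremum norm with a constant
  independent of \<open>y\<close>, so only Brownian motion in \<open>n\<close> coordinates has to be studied. On a fine grid its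
  increments are independent Gaussians, and its oscillation within the cells exceeds a given size with
  a probability that is negligible once the mesh is small. The lower bound shifts
  the increments to those of \<open>\<integral>\<phi>\<close>; the upper bound replaces the path by its piecewise linear
  interpolation, whose energy has a chi-square distribution. Level sets are compact by Arzela-Ascoli
  for the primitives \<open>\<integral>\<phi>\<close> and lower semicontinuity of the energy.\<close>

section \<open>The mild and the integral form of a scalar linear equation\<close>


lemma const_if_increments_small:
  fixes D V :: "real \<Rightarrow> real"
  assumes V: "continuous_on {0..T} V"
    and D: "\<And>a b. 0 \<le> a \<Longrightarrow> a \<le> b \<Longrightarrow> b \<le> T \<Longrightarrow> \<bar>D b - D a\<bar> \<le> K * (b - a) * (V b - V a)"
    and t: "t \<in> {0..T}"
  shows "D t = D 0"
proof -
  have "(D has_field_derivative 0) (at x within {0..T})" if x: "x \<in> {0..T}" for x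
    unfolding has_field_derivative_iff
  proof (rule Lim_null_comparison)
    have "norm ((D y - D x) / (y - x)) \<le> \<bar>K\<bar> * \<bar>V y - V x\<bar>" if y: "y \<in> {0..T}" "y \<noteq> x" for y
    proof -
      have "\<bar>D y - D x\<bar> \<le> \<bar>K\<bar> * \<bar>V y - V x\<bar> * \<bar>y - x\<bar>"
      proof (cases "x \<le> y")
        case True
        then have "\<bar>D y - D x\<bar> \<le> K * (y - x) * (V y - V x)" using D[of x y] x y by auto
        also have "\<dots> \<le> \<bar>K * (y - x) * (V y - V x)\<bar>" by simp
        finally show ?thesis by (simp add: abs_mult mult_ac)
      next
        case False
        then have "\<bar>D x - D y\<bar> \<le> K * (x - y) * (V x - V y)" using D[of y x] x y by auto
        also have "\<dots> \<le> \<bar>K * (x - y) * (V x - V y)\<bar>" by simp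
        finally show ?thesis by (simp add: abs_mult mult_ac abs_minus_commute)
      qed
      then show ?thesis using y by (simp add: abs_divide pos_divide_le_eq)
    qed
    then show "\<forall>\<^sub>F y in at x within {0..T}. norm ((D y - D x) / (y - x)) \<le> \<bar>K\<bar> * \<bar>V y - V x\<bar>"
      by (auto simp: eventually_at_filter)
    have "(V \<longlongrightarrow> V x) (at x within {0..T})" using V x by (simp add: continuous_on_def)
    then have "((\<lambda>y. \<bar>K\<bar> * \<bar>V y - V x\<bar>) \<longlongrightarrow> \<bar>K\<bar> * \<bar>V x - V x\<bar>) (at x within {0..T})"
      by (intro tendsto_intros)
    then show "((\<lambda>y. \<bar>K\<bar> * \<bar>V y - V x\<bar>) \<longlongrightarrow> 0) (at x within {0..T})" by simp
  qed
  then obtain c where "\<And>x. x \<in> {0..T} \<Longrightarrow> D x = c"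
    using has_field_derivative_zero_constant[of "{0..T}" D] by auto
  with t show ?thesis by auto
qed

lemma abs_int_exp_mult:
  fixes g :: "real \<Rightarrow> real"
  assumes "g absolutely_integrable_on {0..T}"
  shows "(\<lambda>s. exp (l * s) * g s) absolutely_integrable_on {0..T}"
proof (rule absolutely_integrable_bounded_measurable_product_real)
  have c: "continuous_on {0..T} (\<lambda>s. exp (l * s))" by (intro continuous_intros)
  show "(\<lambda>s. exp (l * s)) \<in> borel_measurable (lebesgue_on {0..T})"
    using c by (intro continuous_imp_measurable_on_sets_lebesgue) auto
  show "bounded ((\<lambda>s. exp (l * s)) ` {0..T})"
    using compact_continuous_image[OF c] compact_imp_bounded by blast
qed (use assms in auto)

text \<open>As \<open>g\<close> is merely integrable, \<open>G\<close> need not be differentiable and the product rule is not available.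
  Instead the difference of the two sides has increments \<open>o(b - a)\<close>, so it is constant.\<close>

lemma exp_integration_by_parts:
  fixes g :: "real \<Rightarrow> real"
  assumes g: "g absolutely_integrable_on {0..T}" and t: "t \<in> {0..T}"
    and G: "\<And>t. G t = integral {0..t} g"
  shows "((\<lambda>s. exp (l * s) * g s) has_integral
           (exp (l * t) * G t - l * integral {0..t} (\<lambda>s. exp (l * s) * G s))) {0..t}"
proof -
  define V where "V t = integral {0..t} (\<lambda>s. \<bar>g s\<bar>)" for t
  define E where "E = exp (\<bar>l\<bar> * T)"
  define D where "D t = exp (l * t) * G t - l * integral {0..t} (\<lambda>s. exp (l * s) * G s)
      - integral {0..t} (\<lambda>s. exp (l * s) * g s)" for t
  have gi: "g integrable_on {0..T}" and ga: "(\<lambda>s. \<bar>g s\<bar>) integrable_on {0..T}"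
    using g by (auto simp: absolutely_integrable_on_def)
  have ei: "(\<lambda>s. exp (l * s) * g s) integrable_on {0..T}"
    using abs_int_exp_mult[OF g] by (auto simp: absolutely_integrable_on_def)
  have Gc: "continuous_on {0..T} G" unfolding G using indefinite_integral_continuous_1[OF gi] .
  have Vc: "continuous_on {0..T} V" unfolding V_def using indefinite_integral_continuous_1[OF ga] .
  have eGc: "continuous_on {0..T} (\<lambda>s. exp (l * s) * G s)" by (intro continuous_intros Gc)
  then have eGi: "(\<lambda>s. exp (l * s) * G s) integrable_on {0..T}" by (rule integrable_continuous_real)
  have sub: "f integrable_on {a..b}" if "f integrable_on {0..T}" "0 \<le> a" "b \<le> T" for f :: "real \<Rightarrow> real" and a b
    using that by (meson atLeastatMost_subset_iff integrable_on_subinterval)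
  have split: "integral {0..b} f - integral {0..a} f = integral {a..b} f"
    if "f integrable_on {0..T}" "0 \<le> a" "a \<le> b" "b \<le> T" for f :: "real \<Rightarrow> real" and a b
    using Henstock_Kurzweil_Integration.integral_combine[of 0 a b f] sub[OF that(1), of 0 b] that by auto
  have key: "\<bar>D b - D a\<bar> \<le> (2 * \<bar>l\<bar> * E) * (b - a) * (V b - V a)" if ab: "0 \<le> a" "a \<le> b" "b \<le> T" for a b
  proof -
    have Ebd: "exp (l * s) \<le> E" if "s \<in> {a..b}" for s
    proof -
      have "l * s \<le> \<bar>l\<bar> * s" using that ab by (intro mult_right_mono) auto
      also have "\<dots> \<le> \<bar>l\<bar> * T" using that ab by (intro mult_left_mono) auto
      finally show ?thesis unfolding E_def by simp
    qed
    have E0: "0 \<le> E" unfolding E_def by simp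
    have lip: "\<bar>exp (l * b) - exp (l * s)\<bar> \<le> \<bar>l\<bar> * E * (b - a)" if s: "s \<in> {a..b}" for s
    proof -
      have "((\<lambda>u. l * exp (l * u)) has_integral exp (l * b) - exp (l * s)) {s..b}"
        using s by (intro fundamental_theorem_of_calculus)
          (auto intro!: derivative_eq_intros simp: has_real_derivative_iff_has_vector_derivative[symmetric])
      moreover have "norm (l * exp (l * u)) \<le> \<bar>l\<bar> * E" if "u \<in> {s..b}" for u
        using Ebd[of u] that s by (auto simp: abs_mult intro!: mult_left_mono)
      ultimately have "norm (exp (l * b) - exp (l * s)) \<le> \<bar>l\<bar> * E * measure lborel {s..b}"
        using E0 s by (intro has_integral_bound_real[of "\<bar>l\<bar> * E" "{}" "\<lambda>u. l * exp (l * u)"]) auto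
      also have "\<dots> \<le> \<bar>l\<bar> * E * (b - a)" using s E0 by (intro mult_left_mono) auto
      finally show ?thesis by simp
    qed
    have Vd: "V b - V a = integral {a..b} (\<lambda>s. \<bar>g s\<bar>)" unfolding V_def using split[OF ga ab] .
    have gi': "g integrable_on {a..b}" and ga': "(\<lambda>s. \<bar>g s\<bar>) integrable_on {a..b}"
      and ei': "(\<lambda>s. exp (l * s) * g s) integrable_on {a..b}"
      and eGi': "(\<lambda>s. exp (l * s) * G s) integrable_on {a..b}"
      using sub gi ga ei eGi ab by auto
    have i1: "((\<lambda>s. (exp (l * b) - exp (l * s)) * g s) has_integral
        (exp (l * b) * integral {a..b} g - integral {a..b} (\<lambda>s. exp (l * s) * g s))) {a..b}"
      unfolding left_diff_distrib
      by (intro has_integral_diff has_integral_mult_right integrable_integral gi' ei')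
    have FT: "((\<lambda>u. l * exp (l * u)) has_integral exp (l * b) - exp (l * a)) {a..b}"
      using ab by (intro fundamental_theorem_of_calculus)
          (auto intro!: derivative_eq_intros simp: has_real_derivative_iff_has_vector_derivative[symmetric])
    have i2: "((\<lambda>s. l * exp (l * s) * (G a - G s)) has_integral
        ((exp (l * b) - exp (l * a)) * G a - l * integral {a..b} (\<lambda>s. exp (l * s) * G s))) {a..b}"
      using has_integral_diff[OF has_integral_mult_left[OF FT, of "G a"]
          has_integral_mult_right[OF integrable_integral[OF eGi'], of l]]
      by (simp add: algebra_simps)
    have Dd: "D b - D a = integral {a..b} (\<lambda>s. (exp (l * b) - exp (l * s)) * g s)
        + integral {a..b} (\<lambda>s. l * exp (l * s) * (G a - G s))"
      using split[OF ei ab] split[OF eGi ab] split[OF gi ab] integral_unique[OF i1] integral_unique[OF i2]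
      unfolding D_def G[symmetric] by (simp add: algebra_simps)
    have "norm (integral {a..b} (\<lambda>s. (exp (l * b) - exp (l * s)) * g s))
        \<le> integral {a..b} (\<lambda>s. \<bar>l\<bar> * E * (b - a) * \<bar>g s\<bar>)"
    proof (rule Henstock_Kurzweil_Integration.integral_norm_bound_integral)
      show "norm ((exp (l * b) - exp (l * s)) * g s) \<le> \<bar>l\<bar> * E * (b - a) * \<bar>g s\<bar>" if "s \<in> {a..b}" for s
        unfolding real_norm_def abs_mult[of _ "g s"] using lip[OF that] by (intro mult_right_mono) auto
      show "(\<lambda>s. \<bar>l\<bar> * E * (b - a) * \<bar>g s\<bar>) integrable_on {a..b}"
        using ga' by (intro integrable_on_mult_right) auto
    qed (use i1 in auto)
    also have "\<dots> = \<bar>l\<bar> * E * (b - a) * (V b - V a)" unfolding Vd by simp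
    finally have b1: "\<bar>integral {a..b} (\<lambda>s. (exp (l * b) - exp (l * s)) * g s)\<bar> \<le> \<bar>l\<bar> * E * (b - a) * (V b - V a)"
      by simp
    have GV: "\<bar>G a - G s\<bar> \<le> V b - V a" if s: "s \<in> {a..b}" for s
    proof -
      have "G s - G a = integral {a..s} g" unfolding G using split[OF gi, of a s] s ab by auto
      moreover have "norm (integral {a..s} g) \<le> integral {a..s} (\<lambda>s. \<bar>g s\<bar>)"
        using sub[OF gi, of a s] sub[OF ga, of a s] s ab
        by (intro Henstock_Kurzweil_Integration.integral_norm_bound_integral) auto
      moreover have "integral {a..s} (\<lambda>s. \<bar>g s\<bar>) \<le> integral {a..b} (\<lambda>s. \<bar>g s\<bar>)"
        using ga' s sub[OF ga, of a s] ab by (intro integral_subset_le) auto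
      ultimately show ?thesis unfolding Vd by simp
    qed
    have V0: "0 \<le> V b - V a" using GV[of a] ab by auto
    have "norm ((exp (l * b) - exp (l * a)) * G a - l * integral {a..b} (\<lambda>s. exp (l * s) * G s))
       \<le> (\<bar>l\<bar> * E * (V b - V a)) * measure lborel {a..b}"
    proof (rule has_integral_bound_real[OF _ _ i2[unfolded box_real]])
      show "0 \<le> \<bar>l\<bar> * E * (V b - V a)" using E0 V0 by auto
    next
      fix s assume s: "s \<in> {a..b} - {}"
      then have s: "s \<in> {a..b}" by simp
      show "norm (l * exp (l * s) * (G a - G s)) \<le> \<bar>l\<bar> * E * (V b - V a)"
        unfolding real_norm_def abs_mult using GV[OF s] Ebd[OF s] E0 by (intro mult_mono) auto
    qed auto
    then have b2: "\<bar>integral {a..b} (\<lambda>s. l * exp (l * s) * (G a - G s))\<bar> \<le> \<bar>l\<bar> * E * (V b - V a) * (b - a)"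
      using integral_unique[OF i2] ab by simp
    have "\<bar>l\<bar> * E * (b - a) * (V b - V a) + \<bar>l\<bar> * E * (V b - V a) * (b - a) = (2 * \<bar>l\<bar> * E) * (b - a) * (V b - V a)"
      by (simp add: algebra_simps)
    then show ?thesis unfolding Dd using b1 b2 by linarith
  qed
  have "D t = D 0" by (rule const_if_increments_small[OF Vc key t])
  also have "D 0 = 0" unfolding D_def by (simp add: G)
  finally have "integral {0..t} (\<lambda>s. exp (l * s) * g s) =
      exp (l * t) * G t - l * integral {0..t} (\<lambda>s. exp (l * s) * G s)" unfolding D_def by simp
  moreover have "(\<lambda>s. exp (l * s) * g s) integrable_on {0..t}" using sub[OF ei, of 0 t] t by auto
  ultimately show ?thesis using has_integral_iff by blast
qed

lemma mild_iff_strong: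
  fixes g z :: "real \<Rightarrow> real"
  assumes g: "g absolutely_integrable_on {0..T}" and z: "continuous_on {0..T} z"
  shows "(\<forall>t\<in>{0..T}. ((\<lambda>s. exp (- l * (t - s)) * g s) has_integral (z t - exp (- l * t) * y)) {0..t}) \<longleftrightarrow>
         (\<forall>t\<in>{0..T}. ((\<lambda>s. - l * z s + g s) has_integral (z t - y)) {0..t})"
    (is "?mild \<longleftrightarrow> ?strong")
proof
  define Z where "Z t = integral {0..t} z" for t
  have zi: "z integrable_on {0..t}" if "t \<in> {0..T}" for t
    using z that by (intro integrable_continuous_real continuous_on_subset[OF z]) auto
  have FT: "((\<lambda>u. - l * exp (- l * u)) has_integral exp (- l * t) - 1) {0..t}" if "t \<in> {0..T}" for t l
  proof -
    have "((\<lambda>u. - l * exp (- l * u)) has_integral exp (- l * t) - exp (- l * 0)) {0..t}"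
      using that by (intro fundamental_theorem_of_calculus)
        (auto intro!: derivative_eq_intros simp: has_real_derivative_iff_has_vector_derivative[symmetric])
    then show ?thesis by simp
  qed
  have mexp: "exp (- l * (t - s)) = exp (- l * t) * exp (l * s)" for t s
    by (simp add: exp_add[symmetric] algebra_simps)
  {
    assume m: ?mild
    have P: "((\<lambda>s. exp (l * s) * g s) has_integral (exp (l * t) * z t - y)) {0..t}" if t: "t \<in> {0..T}" for t
    proof -
      have "((\<lambda>s. exp (l * t) * (exp (- l * (t - s)) * g s)) has_integral
          (exp (l * t) * (z t - exp (- l * t) * y))) {0..t}"
        using m t by (intro has_integral_mult_right) auto
      moreover have "exp (l * t) * (exp (- l * (t - s)) * g s) = exp (l * s) * g s" for s
        unfolding mexp by (simp add: exp_minus field_simps)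
      moreover have "exp (l * t) * (z t - exp (- l * t) * y) = exp (l * t) * z t - y"
        by (simp add: exp_minus field_simps)
      ultimately show ?thesis by (simp only:)
    qed
    show ?strong
    proof
      fix t assume t: "t \<in> {0..T}"
      define P' where "P' t = integral {0..t} (\<lambda>s. exp (l * s) * g s)" for t
      have P': "P' s = exp (l * s) * z s - y" if "s \<in> {0..T}" for s
        using P[OF that] unfolding P'_def by (rule integral_unique)
      have 1: "((\<lambda>s. exp (- l * s) * (exp (l * s) * g s)) has_integral
          (exp (- l * t) * P' t - (- l) * integral {0..t} (\<lambda>s. exp (- l * s) * P' s))) {0..t}"
        by (rule exp_integration_by_parts[OF abs_int_exp_mult[OF g] t]) (simp add: P'_def)
      have 2: "((\<lambda>s. l * z s + (- l * exp (- l * s)) * y) has_integral (l * Z t + (exp (- l * t) - 1) * y)) {0..t}"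
        unfolding Z_def
        by (intro has_integral_add has_integral_mult_right has_integral_mult_left integrable_integral zi t FT)
      have "l * integral {0..t} (\<lambda>s. exp (- l * s) * P' s) = l * Z t + (exp (- l * t) - 1) * y"
      proof -
        have "integral {0..t} (\<lambda>s. l * (exp (- l * s) * P' s)) = integral {0..t} (\<lambda>s. l * z s + (- l * exp (- l * s)) * y)"
        proof (rule Henstock_Kurzweil_Integration.integral_cong)
          fix s assume "s \<in> {0..t}"
          then have "P' s = exp (l * s) * z s - y" using P' t by auto
          moreover have "exp (- l * s) * exp (l * s) = 1" by (simp add: exp_add[symmetric])
          ultimately show "l * (exp (- l * s) * P' s) = l * z s + (- l * exp (- l * s)) * y"
            by algebra
        qed
        then show ?thesis using integral_unique[OF 2]
          Henstock_Kurzweil_Integration.integral_mult_right[of "{0..t}" l "\<lambda>s. exp (- l * s) * P' s"] by linarith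
      qed
      then have 3: "(exp (- l * t) * P' t - (- l) * integral {0..t} (\<lambda>s. exp (- l * s) * P' s)) = z t - y + l * Z t"
        unfolding P'[OF t] by (simp add: right_diff_distrib left_diff_distrib mult.assoc[symmetric] exp_add[symmetric])
      have "(g has_integral (z t - y + l * Z t)) {0..t}"
        using 1 unfolding 3 by (simp add: exp_minus mult.assoc[symmetric])
      from has_integral_add[OF has_integral_mult_right[OF integrable_integral[OF zi[OF t]], of "- l"] this]
      show "((\<lambda>s. - l * z s + g s) has_integral (z t - y)) {0..t}"
        by (simp add: Z_def algebra_simps)
    qed
  }
  {
    assume s: ?strong
    define G where "G t = integral {0..t} g" for t
    have G: "G t = z t - y + l * Z t" if t: "t \<in> {0..T}" for t
    proof -
      have "((\<lambda>s. (- l * z s + g s) + l * z s) has_integral (z t - y + l * Z t)) {0..t}"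
        unfolding Z_def using s t
        by (intro has_integral_add has_integral_mult_right integrable_integral zi t) auto
      then show ?thesis unfolding G_def by (simp add: integral_unique)
    qed
    have Zd: "(Z has_vector_derivative z t) (at t within {0..T})" if "t \<in> {0..T}" for t
      unfolding Z_def using integral_has_vector_derivative[OF z that] .
    show ?mild
    proof
      fix t assume t: "t \<in> {0..T}"
      have 1: "((\<lambda>s. exp (l * s) * g s) has_integral
           (exp (l * t) * G t - l * integral {0..t} (\<lambda>s. exp (l * s) * G s))) {0..t}"
        by (rule exp_integration_by_parts[OF g t]) (simp add: G_def)
      have "((\<lambda>s. l * (exp (l * s) * z s + l * exp (l * s) * Z s) - (l * exp (l * s)) * y) has_integral
          (l * (exp (l * t) * Z t - exp (l * 0) * Z 0) - (exp (l * t) - 1) * y)) {0..t}"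
      proof (intro has_integral_diff has_integral_mult_right has_integral_mult_left)
        show "((\<lambda>x. l * exp (l * x)) has_integral exp (l * t) - 1) {0..t}" using FT[OF t, of "- l"] by simp
        show "((\<lambda>s. exp (l * s) * z s + l * exp (l * s) * Z s) has_integral exp (l * t) * Z t - exp (l * 0) * Z 0) {0..t}"
        proof (rule fundamental_theorem_of_calculus)
          show "((\<lambda>s. exp (l * s) * Z s) has_vector_derivative exp (l * s) * z s + l * exp (l * s) * Z s)
              (at s within {0..t})" if s: "s \<in> {0..t}" for s
          proof -
            have "(Z has_field_derivative z s) (at s within {0..t})"
              using has_vector_derivative_within_subset[OF Zd, of s "{0..t}"] s t
              by (auto simp: has_real_derivative_iff_has_vector_derivative)
            then have "((\<lambda>s. exp (l * s) * Z s) has_field_derivative (exp (l * s) * z s + l * exp (l * s) * Z s)) (at s within {0..t})"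
              by (auto intro!: derivative_eq_intros)
            then show ?thesis by (simp add: has_real_derivative_iff_has_vector_derivative)
          qed
        qed (use t in auto)
      qed
      moreover have "Z 0 = 0" unfolding Z_def by simp
      ultimately have 2: "((\<lambda>s. l * (exp (l * s) * z s + l * exp (l * s) * Z s) - (l * exp (l * s)) * y) has_integral
          (l * (exp (l * t) * Z t) - (exp (l * t) - 1) * y)) {0..t}" by simp
      have "l * integral {0..t} (\<lambda>s. exp (l * s) * G s) = integral {0..t} (\<lambda>s. l * (exp (l * s) * G s))" by simp
      also have "\<dots> = integral {0..t} (\<lambda>s. l * (exp (l * s) * z s + l * exp (l * s) * Z s) - (l * exp (l * s)) * y)"
      proof (rule Henstock_Kurzweil_Integration.integral_cong)
        fix s assume "s \<in> {0..t}"
        then have "G s = z s - y + l * Z s" using G t by auto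
        then show "l * (exp (l * s) * G s) = l * (exp (l * s) * z s + l * exp (l * s) * Z s) - (l * exp (l * s)) * y"
          by algebra
      qed
      also have "\<dots> = l * (exp (l * t) * Z t) - (exp (l * t) - 1) * y" using 2 by (rule integral_unique)
      finally have 3: "exp (l * t) * G t - l * integral {0..t} (\<lambda>s. exp (l * s) * G s) = exp (l * t) * z t - y"
        unfolding G[OF t] by (simp add: algebra_simps)
      have 4: "exp (- l * t) * (exp (l * t) * z t - y) = z t - exp (- l * t) * y"
        by (simp add: exp_minus field_simps)
      show "((\<lambda>s. exp (- l * (t - s)) * g s) has_integral (z t - exp (- l * t) * y)) {0..t}"
        using has_integral_mult_right[OF 1[unfolded 3], of "exp (- l * t)"] unfolding 4 mexp by (simp add: mult.assoc)
    qed
  }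
qed

section \<open>Square-integrable controls and their primitives\<close>


definition L2_on :: "real \<Rightarrow> (real \<Rightarrow> real) \<Rightarrow> bool" where
  "L2_on T f \<longleftrightarrow> f \<in> borel_measurable (lebesgue_on {0..T}) \<and> (\<lambda>t. (f t)\<^sup>2) integrable_on {0..T}"

abbreviation energy :: "real \<Rightarrow> (real \<Rightarrow> real) \<Rightarrow> real" where
  "energy T f \<equiv> integral {0..T} (\<lambda>t. (f t)\<^sup>2)"

lemma L2_on_mult_integrable:
  assumes "L2_on T f" "L2_on T g"
  shows "(\<lambda>t. f t * g t) integrable_on {0..T}"
proof (rule measurable_bounded_by_integrable_imp_integrable_real)
  show "(\<lambda>t. (f t)\<^sup>2 + (g t)\<^sup>2) integrable_on {0..T}"
    using assms by (auto simp: L2_on_def intro: integrable_add)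
  show "(\<lambda>t. f t * g t) \<in> borel_measurable (lebesgue_on {0..T})"
    using assms by (auto simp: L2_on_def)
  show "\<bar>f t * g t\<bar> \<le> (f t)\<^sup>2 + (g t)\<^sup>2" for t
  proof -
    have "2 * \<bar>f t\<bar> * \<bar>g t\<bar> \<le> (f t)\<^sup>2 + (g t)\<^sup>2"
      using sum_squares_bound[of "\<bar>f t\<bar>" "\<bar>g t\<bar>"] by simp
    moreover have "0 \<le> \<bar>f t\<bar> * \<bar>g t\<bar>" by simp
    ultimately show ?thesis unfolding abs_mult by linarith
  qed
qed auto

lemma L2_on_lincomb:
  assumes "L2_on T f" "L2_on T g"
  shows "L2_on T (\<lambda>t. a * f t + b * g t)"
    and "energy T (\<lambda>t. a * f t + b * g t)
      = a\<^sup>2 * energy T f + b\<^sup>2 * energy T g + 2 * a * b * integral {0..T} (\<lambda>t. f t * g t)"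
proof -
  have "((\<lambda>t. a\<^sup>2 * (f t)\<^sup>2 + b\<^sup>2 * (g t)\<^sup>2 + (2 * a * b) * (f t * g t)) has_integral
      (a\<^sup>2 * energy T f + b\<^sup>2 * energy T g + 2 * a * b * integral {0..T} (\<lambda>t. f t * g t))) {0..T}"
    using assms L2_on_mult_integrable[OF assms]
    by (intro has_integral_add has_integral_mult_right integrable_integral) (auto simp: L2_on_def)
  moreover have "(\<lambda>t. a\<^sup>2 * (f t)\<^sup>2 + b\<^sup>2 * (g t)\<^sup>2 + (2 * a * b) * (f t * g t)) = (\<lambda>t. (a * f t + b * g t)\<^sup>2)"
    by (auto simp: power2_eq_square algebra_simps)
  ultimately have h: "((\<lambda>t. (a * f t + b * g t)\<^sup>2) has_integral
      (a\<^sup>2 * energy T f + b\<^sup>2 * energy T g + 2 * a * b * integral {0..T} (\<lambda>t. f t * g t))) {0..T}"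
    by simp
  then show "energy T (\<lambda>t. a * f t + b * g t)
      = a\<^sup>2 * energy T f + b\<^sup>2 * energy T g + 2 * a * b * integral {0..T} (\<lambda>t. f t * g t)"
    by (rule integral_unique)
  show "L2_on T (\<lambda>t. a * f t + b * g t)"
    unfolding L2_on_def
  proof
    show "(\<lambda>t. (a * f t + b * g t)\<^sup>2) integrable_on {0..T}" using h by (rule has_integral_integrable)
    show "(\<lambda>t. a * f t + b * g t) \<in> borel_measurable (lebesgue_on {0..T})"
      using assms by (intro borel_measurable_add borel_measurable_times) (auto simp: L2_on_def)
  qed
qed

lemma L2_on_abs_integrable:
  assumes "L2_on T f"
  shows "f absolutely_integrable_on {0..T}"
proof (rule measurable_bounded_by_integrable_imp_absolutely_integrable)
  show "(\<lambda>t. 1 + (f t)\<^sup>2) integrable_on {0..T}"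
    using assms unfolding L2_on_def by (intro integrable_add) (auto simp: integrable_const_ivl)
  show "norm (f t) \<le> 1 + (f t)\<^sup>2" for t
  proof -
    have "2 * \<bar>f t\<bar> * 1 \<le> \<bar>f t\<bar>\<^sup>2 + 1\<^sup>2" by (rule sum_squares_bound)
    then show ?thesis by simp
  qed
qed (use assms in \<open>auto simp: L2_on_def\<close>)

lemma L2_on_integrable_sub:
  assumes "L2_on T f" "0 \<le> a" "b \<le> T"
  shows "f integrable_on {a..b}" "(\<lambda>t. (f t)\<^sup>2) integrable_on {a..b}"
proof -
  have "f integrable_on {0..T}" "(\<lambda>t. (f t)\<^sup>2) integrable_on {0..T}"
    using assms L2_on_abs_integrable[OF assms(1)] by (auto simp: L2_on_def absolutely_integrable_on_def)
  then show "f integrable_on {a..b}" "(\<lambda>t. (f t)\<^sup>2) integrable_on {a..b}"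
    using assms by (auto intro: integrable_on_subinterval)
qed

lemma L2_on_Cauchy_Schwarz:
  assumes f: "L2_on T f" and ab: "0 \<le> a" "a \<le> b" "b \<le> T"
  shows "(integral {a..b} f)\<^sup>2 \<le> (b - a) * integral {a..b} (\<lambda>t. (f t)\<^sup>2)"
proof (cases "a = b")
  case False
  then have ab': "a < b" using ab by simp
  define c where "c = integral {a..b} f / (b - a)"
  have "((\<lambda>t. ((f t)\<^sup>2 + (- 2 * c) * f t) + c\<^sup>2) has_integral
      (integral {a..b} (\<lambda>t. (f t)\<^sup>2) + (- 2 * c) * integral {a..b} f + (b - a) *\<^sub>R c\<^sup>2)) {a..b}"
    using L2_on_integrable_sub[OF f ab(1,3)] has_integral_const_real[of "c\<^sup>2" a b] ab
    by (intro has_integral_add has_integral_mult_right integrable_integral) auto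
  moreover have "0 \<le> ((f t)\<^sup>2 + (- 2 * c) * f t) + c\<^sup>2" for t
    using zero_le_power2[of "f t - c"] by (simp add: power2_eq_square algebra_simps)
  ultimately have "0 \<le> integral {a..b} (\<lambda>t. (f t)\<^sup>2) + (- 2 * c) * integral {a..b} f + (b - a) *\<^sub>R c\<^sup>2"
    by (rule has_integral_nonneg) 
  also have "\<dots> = integral {a..b} (\<lambda>t. (f t)\<^sup>2) - (integral {a..b} f)\<^sup>2 / (b - a)"
  proof -
    have "(b - a) * c = integral {a..b} f" using ab' unfolding c_def by simp
    then have "(b - a) *\<^sub>R c\<^sup>2 = c * integral {a..b} f" "(integral {a..b} f)\<^sup>2 / (b - a) = c * integral {a..b} f"
      using ab' by (auto simp: power2_eq_square c_def)
    then show ?thesis by simp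
  qed
  finally show ?thesis using ab' by (simp add: field_simps)
qed simp

lemma energy_nonneg: "0 \<le> energy T f"
  by (cases "(\<lambda>t. (f t)\<^sup>2) integrable_on {0..T}")
    (auto intro: Henstock_Kurzweil_Integration.integral_nonneg simp: not_integrable_integral)

lemma L2_on_nn_integral:
  assumes "L2_on T f"
  shows "(\<integral>\<^sup>+t. ennreal ((f t)\<^sup>2) \<partial>lebesgue_on {0..T}) = ennreal (energy T f)"
proof -
  have "(\<lambda>t. (f t)\<^sup>2) absolutely_integrable_on {0..T}"
    using assms by (intro nonnegative_absolutely_integrable_1) (auto simp: L2_on_def)
  then have i: "integrable (lebesgue_on {0..T}) (\<lambda>t. (f t)\<^sup>2)"
    by (simp add: integrable_restrict_space set_integrable_def)
  then show ?thesis
    using nn_integral_eq_integral[OF i] lebesgue_integral_eq_integral[OF i] by simp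
qed

lemma L2_on_if_nn_integral_le:
  assumes m: "f \<in> borel_measurable (lebesgue_on {0..T})"
    and le: "(\<integral>\<^sup>+t. ennreal ((f t)\<^sup>2) \<partial>lebesgue_on {0..T}) \<le> ennreal c" and c: "0 \<le> c"
  shows "L2_on T f" "energy T f \<le> c"
proof -
  have i: "integrable (lebesgue_on {0..T}) (\<lambda>t. (f t)\<^sup>2)"
  proof (rule integrableI_bounded)
    show "(\<integral>\<^sup>+t. ennreal (norm ((f t)\<^sup>2)) \<partial>lebesgue_on {0..T}) < \<infinity>"
      using order_le_less_trans[OF le ennreal_less_top] by simp
  qed (use m in simp)
  then have "(\<lambda>t. (f t)\<^sup>2) integrable_on {0..T}"
    by (rule integrable_on_lebesgue_on) simp
  with m show l: "L2_on T f" by (simp add: L2_on_def)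
  show "energy T f \<le> c" using le L2_on_nn_integral[OF l] c by simp
qed

lemma energy_Fatou:
  assumes u: "\<And>k. L2_on T (u k)" and v: "v \<in> borel_measurable (lebesgue_on {0..T})"
    and lim: "AE t in lebesgue_on {0..T}. (\<lambda>k. u k t) \<longlonglongrightarrow> v t"
    and le: "\<forall>\<^sub>F k in sequentially. energy T (u k) \<le> c" and c: "0 \<le> c"
  shows "L2_on T v" "energy T v \<le> c"
proof -
  have "(\<integral>\<^sup>+t. ennreal ((v t)\<^sup>2) \<partial>lebesgue_on {0..T}) = (\<integral>\<^sup>+t. liminf (\<lambda>k. ennreal ((u k t)\<^sup>2)) \<partial>lebesgue_on {0..T})"
  proof (rule nn_integral_cong_AE)
    show "AE t in lebesgue_on {0..T}. ennreal ((v t)\<^sup>2) = liminf (\<lambda>k. ennreal ((u k t)\<^sup>2))"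
      using lim
    proof eventually_elim
      case (elim t)
      then have "(\<lambda>k. ennreal ((u k t)\<^sup>2)) \<longlonglongrightarrow> ennreal ((v t)\<^sup>2)"
        by (intro tendsto_ennrealI tendsto_power)
      then show ?case by (metis lim_imp_Liminf sequentially_bot)
    qed
  qed
  also have "\<dots> \<le> liminf (\<lambda>k. (\<integral>\<^sup>+t. ennreal ((u k t)\<^sup>2) \<partial>lebesgue_on {0..T}))"
    by (rule nn_integral_liminf)
      (use u in \<open>auto simp: L2_on_def intro!: measurable_compose[OF _ measurable_ennreal] borel_measurable_power\<close>)
  also have "\<dots> = liminf (\<lambda>k. ennreal (energy T (u k)))"
    using L2_on_nn_integral[OF u] by simp
  also have "\<dots> \<le> ennreal c"
  proof (rule Liminf_le)
    show "\<forall>\<^sub>F k in sequentially. ennreal (energy T (u k)) \<le> ennreal c"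
      using le by eventually_elim (rule ennreal_leI)
  qed simp
  finally show "L2_on T v" "energy T v \<le> c"
    using L2_on_if_nn_integral_le[OF v _ c] by auto
qed

lemma abs_integral_le_energy:
  assumes f: "L2_on T f" and t: "t \<in> {0..T}"
  shows "\<bar>integral {0..t} f\<bar> \<le> sqrt (T * energy T f)"
proof -
  have "(integral {0..t} f)\<^sup>2 \<le> (t - 0) * integral {0..t} (\<lambda>t. (f t)\<^sup>2)"
    using t by (intro L2_on_Cauchy_Schwarz[OF f]) auto
  also have "\<dots> \<le> T * energy T f"
  proof (rule mult_mono)
    show "integral {0..t} (\<lambda>t. (f t)\<^sup>2) \<le> energy T f"
      using L2_on_integrable_sub[OF f, of 0] t by (intro integral_subset_le) auto
    show "0 \<le> integral {0..t} (\<lambda>t. (f t)\<^sup>2)" using L2_on_integrable_sub[OF f, of 0 t] t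
      by (intro Henstock_Kurzweil_Integration.integral_nonneg) auto
  qed (use t in auto)
  finally have "sqrt ((integral {0..t} f)\<^sup>2) \<le> sqrt (T * energy T f)" by (rule real_sqrt_le_mono)
  then show ?thesis by simp
qed

lemma sqrt_mult_less:
  fixes e :: real
  assumes "0 < e" "0 \<le> T" "E \<le> e\<^sup>2 / (T + 1) / 2"
  shows "sqrt (T * E) < e"
proof -
  have "T * E \<le> T * (e\<^sup>2 / (T + 1) / 2)" using assms by (intro mult_left_mono) auto
  also have "\<dots> = e\<^sup>2 * (T / (2 * (T + 1)))" by (simp add: field_simps)
  also have "\<dots> < e\<^sup>2 * 1" using assms by (intro mult_strict_left_mono) (auto simp: divide_simps)
  finally have "sqrt (T * E) < sqrt (e\<^sup>2)" by (intro real_sqrt_less_mono) simp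
  then show ?thesis using assms by simp
qed

lemma parallelogram_arith:
  fixes x :: real
  assumes "x = a + b - 2 * c" "y \<le> a / 4 + b / 4 + c / 2" "a \<le> q" "b \<le> q"
  shows "x \<le> 4 * (q - y)"
  using assms by argo

lemma L2_on_complete:
  fixes u :: "nat \<Rightarrow> real \<Rightarrow> real"
  assumes u: "\<And>k. L2_on T (u k)"
    and C: "\<And>e. 0 < e \<Longrightarrow> \<exists>N. \<forall>i\<ge>N. \<forall>j\<ge>N. energy T (\<lambda>t. u i t - u j t) \<le> e"
    and T: "0 \<le> T"
  shows "\<exists>v r. L2_on T v \<and> strict_mono r \<and> (AE t in lebesgue_on {0..T}. (\<lambda>k. u (r k) t) \<longlonglongrightarrow> v t) \<and>
    (\<forall>e>0. \<exists>N. \<forall>i\<ge>N. energy T (\<lambda>t. u i t - v t) \<le> e)"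
proof -
  let ?M = "lebesgue_on {0..T}"
  have diff: "L2_on T (\<lambda>t. f t - g t)" if "L2_on T f" "L2_on T g" for f g
    using L2_on_lincomb(1)[OF that, of 1 "-1"] by simp
  have ui: "integrable ?M (u k)" for k
    using L2_on_abs_integrable[OF u[of k]] by (simp add: integrable_restrict_space set_integrable_def)
  have um: "u k \<in> borel_measurable ?M" for k using u by (auto simp: L2_on_def)
  have "\<exists>N. \<forall>i\<ge>N. \<forall>j\<ge>N. LINT x|?M. norm (u i x - u j x) < e" if e: "0 < e" for e
  proof -
    have "0 < e\<^sup>2 / (T + 1) / 2" using e T by simp
    from C[OF this] obtain N where N: "\<And>i j. i \<ge> N \<Longrightarrow> j \<ge> N \<Longrightarrow> energy T (\<lambda>t. u i t - u j t) \<le> e\<^sup>2 / (T + 1) / 2"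
      by blast
    have "LINT x|?M. norm (u i x - u j x) < e" if "i \<ge> N" "j \<ge> N" for i j
    proof -
      have d: "L2_on T (\<lambda>t. u i t - u j t)" using diff u by auto
      then have da: "L2_on T (\<lambda>t. norm (u i t - u j t))" unfolding L2_on_def by auto
      have "integrable ?M (\<lambda>x. norm (u i x - u j x))" using ui by auto
      then have "LINT x|?M. norm (u i x - u j x) = integral {0..T} (\<lambda>x. norm (u i x - u j x))"
        by (rule lebesgue_integral_eq_integral) simp
      also have "\<dots> \<le> sqrt (T * energy T (\<lambda>t. u i t - u j t))"
        using abs_integral_le_energy[OF da, of T] T by simp
      also have "\<dots> < e" by (rule sqrt_mult_less[OF e T N[OF that]])
      finally show ?thesis .
    qed
    then show ?thesis by blast
  qed
  from cauchy_L1_AE_cauchy_subseq[of ?M u, OF ui this]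
  obtain r where r: "strict_mono r" "AE x in ?M. Cauchy (\<lambda>i. u (r i) x)" by blast
  define v where "v x = lim (\<lambda>i. u (r i) x)" for x
  have vm: "v \<in> borel_measurable ?M" unfolding v_def using um by (intro borel_measurable_lim_metric) auto
  have lim: "AE t in ?M. (\<lambda>k. u (r k) t) \<longlonglongrightarrow> v t"
    using r(2)
  proof eventually_elim
    case (elim x)
    then show ?case unfolding v_def by (simp add: Cauchy_convergent_iff convergent_LIMSEQ_iff)
  qed
  have E: "L2_on T (\<lambda>t. u i t - v t) \<and> energy T (\<lambda>t. u i t - v t) \<le> e"
    if N: "\<forall>i\<ge>N. \<forall>j\<ge>N. energy T (\<lambda>t. u i t - u j t) \<le> e" and i: "i \<ge> N" and e: "0 < e" for i N e
  proof -
    have "\<forall>\<^sub>F k in sequentially. energy T (\<lambda>t. u i t - u (r k) t) \<le> e"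
      using eventually_ge_at_top[of N]
    proof eventually_elim
      case (elim k)
      then have "r k \<ge> N" using seq_suble[OF r(1), of k] by simp
      then show ?case using N i by simp
    qed
    moreover have "AE t in ?M. (\<lambda>k. u i t - u (r k) t) \<longlonglongrightarrow> u i t - v t"
      using lim by eventually_elim (intro tendsto_intros)
    moreover have "L2_on T (\<lambda>t. u i t - u (r k) t)" for k using diff u by auto
    ultimately show ?thesis
      using energy_Fatou[of T "\<lambda>k t. u i t - u (r k) t" "\<lambda>t. u i t - v t" e] um vm e by auto
  qed
  have "L2_on T v"
  proof -
    obtain N where N: "\<forall>i\<ge>N. \<forall>j\<ge>N. energy T (\<lambda>t. u i t - u j t) \<le> 1" using C[of 1] by auto
    have "L2_on T (\<lambda>t. u N t - v t)" using E[OF N] by auto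
    from diff[OF u[of N] this] show ?thesis by simp
  qed
  moreover have "\<exists>N. \<forall>i\<ge>N. energy T (\<lambda>t. u i t - v t) \<le> e" if e: "0 < e" for e
  proof -
    obtain N where N: "\<forall>i\<ge>N. \<forall>j\<ge>N. energy T (\<lambda>t. u i t - u j t) \<le> e" using C[OF e] by auto
    have "\<forall>i\<ge>N. energy T (\<lambda>t. u i t - v t) \<le> e" using E[OF N _ e] by simp
    then show ?thesis ..
  qed
  ultimately show ?thesis using r lim by blast
qed

text \<open>The set of controls whose primitive is uniformly close to \<open>h\<close> is convex, so by the parallelogram
  law its almost-minimisers form a Cauchy sequence. This replaces weak compactness.\<close>

lemma primitive_energy_lsc:
  fixes h :: "real \<Rightarrow> real"
  assumes T: "0 \<le> T"
    and ex: "\<And>e. 0 < e \<Longrightarrow> \<exists>\<psi>. L2_on T \<psi> \<and> (\<forall>t\<in>{0..T}. \<bar>integral {0..t} \<psi> - h t\<bar> \<le> e) \<and> energy T \<psi> \<le> B"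
  obtains \<psi> where "L2_on T \<psi>" "\<And>t. t \<in> {0..T} \<Longrightarrow> integral {0..t} \<psi> = h t"
    "\<And>\<eta>. 0 < \<eta> \<Longrightarrow> \<exists>e>0. \<forall>\<phi>. L2_on T \<phi> \<longrightarrow> (\<forall>t\<in>{0..T}. \<bar>integral {0..t} \<phi> - h t\<bar> \<le> e) \<longrightarrow>
       energy T \<psi> \<le> energy T \<phi> + \<eta>"
proof -
  define S where "S m = {\<psi>. L2_on T \<psi> \<and> (\<forall>t\<in>{0..T}. \<bar>integral {0..t} \<psi> - h t\<bar> \<le> inverse (real (Suc m)))}" for m :: nat
  define d where "d m = (INF \<psi>\<in>S m. energy T \<psi>)" for m
  have bdd: "bdd_below (energy T ` S m)" for m using energy_nonneg by (intro bdd_belowI2[of _ 0]) auto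
  have exm: "\<exists>\<psi>\<in>S m. energy T \<psi> \<le> B" for m using ex[of "inverse (real (Suc m))"] unfolding S_def by auto
  have ne: "S m \<noteq> {}" for m using exm[of m] by auto
  have dle: "d m \<le> energy T \<psi>" if "\<psi> \<in> S m" for m \<psi>
    unfolding d_def using cINF_lower[OF bdd that] .
  have dB: "d m \<le> B" for m
  proof -
    obtain \<psi> where "\<psi> \<in> S m" "energy T \<psi> \<le> B" using exm[of m] by auto
    then show ?thesis using dle[of \<psi> m] by linarith
  qed
  have anti: "S m \<subseteq> S k" if "k \<le> m" for k m
  proof -
    have "inverse (real (Suc m)) \<le> inverse (real (Suc k))" using that by (intro le_imp_inverse_le) auto
    then show ?thesis unfolding S_def by (auto intro: order_trans)
  qed
  have inc: "incseq d"
  proof (rule incseq_SucI)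
    fix m
    show "d m \<le> d (Suc m)"
      unfolding d_def[of "Suc m"]
    proof (rule cINF_greatest[OF ne])
      fix \<psi> assume "\<psi> \<in> S (Suc m)"
      then show "d m \<le> energy T \<psi>" using anti[of m "Suc m"] dle by auto
    qed
  qed
  obtain D where D: "d \<longlonglongrightarrow> D" "\<And>m. d m \<le> D"
    using incseq_convergent[OF inc, of B] dB by auto
  have "\<exists>\<psi>\<in>S m. energy T \<psi> < d m + inverse (real (Suc m))" for m
    using cInf_lessD[of "energy T ` S m" "d m + inverse (real (Suc m))"] ne unfolding d_def by auto
  then obtain p where p: "\<And>m. p m \<in> S m" "\<And>m. energy T (p m) < d m + inverse (real (Suc m))"
    by metis
  have pL: "L2_on T (p m)" for m using p(1)[of m] by (auto simp: S_def)
  have mid: "(\<lambda>t. (1/2) * f t + (1/2) * g t) \<in> S m" if f: "f \<in> S m" and g: "g \<in> S m" for f g m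
  proof -
    have fL: "L2_on T f" and gL: "L2_on T g" using f g by (auto simp: S_def)
    have "\<bar>integral {0..t} (\<lambda>t. (1/2) * f t + (1/2) * g t) - h t\<bar> \<le> inverse (real (Suc m))" if t: "t \<in> {0..T}" for t
    proof -
      have "((\<lambda>t. (1/2) * f t + (1/2) * g t) has_integral ((1/2) * integral {0..t} f + (1/2) * integral {0..t} g)) {0..t}"
        using t by (intro has_integral_add has_integral_mult_right integrable_integral
            L2_on_integrable_sub(1)[OF fL] L2_on_integrable_sub(1)[OF gL]) auto
      then have "integral {0..t} (\<lambda>t. (1/2) * f t + (1/2) * g t) = (1/2) * integral {0..t} f + (1/2) * integral {0..t} g"
        by (rule integral_unique)
      moreover have "\<bar>integral {0..t} f - h t\<bar> \<le> inverse (real (Suc m))" "\<bar>integral {0..t} g - h t\<bar> \<le> inverse (real (Suc m))"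
        using f g t by (auto simp: S_def)
      ultimately show ?thesis by linarith
    qed
    then show ?thesis using L2_on_lincomb(1)[OF fL gL, of "1/2" "1/2"] unfolding S_def by blast
  qed
  have par: "energy T (\<lambda>t. p i t - p j t) \<le> 4 * (D + inverse (real (Suc m)) - d m)" if ij: "i \<ge> m" "j \<ge> m" for i j m
  proof -
    let ?c = "integral {0..T} (\<lambda>t. p i t * p j t)"
    have e1: "energy T (\<lambda>t. p i t - p j t) = energy T (p i) + energy T (p j) - 2 * ?c"
      using L2_on_lincomb(2)[OF pL pL, of 1 i "-1" j] by simp
    have hm: "energy T (\<lambda>t. (1/2) * p i t + (1/2) * p j t) = energy T (p i) / 4 + energy T (p j) / 4 + ?c / 2"
      using L2_on_lincomb(2)[OF pL pL, of "1/2" i "1/2" j] by (simp add: power2_eq_square)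
    have e2: "d m \<le> energy T (p i) / 4 + energy T (p j) / 4 + ?c / 2"
      unfolding hm[symmetric] using p(1)[of i] p(1)[of j] anti[of m i] anti[of m j] ij by (intro dle mid) auto
    have e: "energy T (p k) \<le> D + inverse (real (Suc m))" if "k \<ge> m" for k
    proof -
      have "inverse (real (Suc k)) \<le> inverse (real (Suc m))" using that by (intro le_imp_inverse_le) auto
      then show ?thesis using p(2)[of k] D(2)[of k] by linarith
    qed
    show ?thesis by (rule parallelogram_arith[OF e1 e2 e[OF ij(1)] e[OF ij(2)]])
  qed
  have sm: "\<exists>m. 4 * (D + inverse (real (Suc m)) - d m) \<le> e" if e: "0 < e" for e
  proof -
    have "(\<lambda>m. 4 * (D + inverse (real (Suc m)) - d m)) \<longlonglongrightarrow> 4 * (D + 0 - D)"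
      by (intro tendsto_intros D(1) LIMSEQ_inverse_real_of_nat)
    then have "\<forall>\<^sub>F m in sequentially. 4 * (D + inverse (real (Suc m)) - d m) < e"
      using order_tendstoD(2)[of _ 0 sequentially e] e by simp
    then obtain m where "4 * (D + inverse (real (Suc m)) - d m) < e"
      by (meson eventually_sequentially le_refl)
    then show ?thesis by (intro exI[of _ m]) simp
  qed
  have cau: "\<exists>N. \<forall>i\<ge>N. \<forall>j\<ge>N. energy T (\<lambda>t. p i t - p j t) \<le> e" if e: "0 < e" for e
  proof -
    obtain m where m: "4 * (D + inverse (real (Suc m)) - d m) \<le> e" using sm[OF e] by auto
    have "energy T (\<lambda>t. p i t - p j t) \<le> e" if "i \<ge> m" "j \<ge> m" for i j
      using par[OF that] m by linarith
    then show ?thesis by auto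
  qed
  have "\<exists>v r. L2_on T v \<and> strict_mono r \<and> (AE t in lebesgue_on {0..T}. (\<lambda>k. p (r k) t) \<longlonglongrightarrow> v t) \<and>
    (\<forall>e>0. \<exists>N. \<forall>i\<ge>N. energy T (\<lambda>t. p i t - v t) \<le> e)"
    by (rule L2_on_complete[OF pL _ T]) (rule cau)
  then obtain \<psi> r where \<psi>: "L2_on T \<psi>" "strict_mono r" "AE t in lebesgue_on {0..T}. (\<lambda>k. p (r k) t) \<longlonglongrightarrow> \<psi> t"
    "\<And>e. 0 < e \<Longrightarrow> \<exists>N. \<forall>i\<ge>N. energy T (\<lambda>t. p i t - \<psi> t) \<le> e"
    by blast
  have prim: "integral {0..t} \<psi> = h t" if t: "t \<in> {0..T}" for t
  proof (rule LIMSEQ_unique)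
    show "(\<lambda>i. integral {0..t} (p i)) \<longlonglongrightarrow> integral {0..t} \<psi>"
    proof (rule LIMSEQ_I)
      fix e :: real assume e: "0 < e"
      have "0 < e\<^sup>2 / (T + 1) / 2" using e T by simp
      from \<psi>(4)[OF this] obtain N where N: "\<And>i. i \<ge> N \<Longrightarrow> energy T (\<lambda>t. p i t - \<psi> t) \<le> e\<^sup>2 / (T + 1) / 2" by blast
      have "norm (integral {0..t} (p i) - integral {0..t} \<psi>) < e" if i: "i \<ge> N" for i
      proof -
        have dL: "L2_on T (\<lambda>t. p i t - \<psi> t)" using L2_on_lincomb(1)[OF pL \<psi>(1), of 1 i "-1"] by simp
        have "integral {0..t} (p i) - integral {0..t} \<psi> = integral {0..t} (\<lambda>t. p i t - \<psi> t)"
          using t by (intro Henstock_Kurzweil_Integration.integral_diff[symmetric]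
              L2_on_integrable_sub(1)[OF pL] L2_on_integrable_sub(1)[OF \<psi>(1)]) auto
        then have "norm (integral {0..t} (p i) - integral {0..t} \<psi>) \<le> sqrt (T * energy T (\<lambda>t. p i t - \<psi> t))"
          using abs_integral_le_energy[OF dL t] by simp
        also have "\<dots> < e" by (rule sqrt_mult_less[OF e T N[OF i]])
        finally show ?thesis .
      qed
      then show "\<exists>N. \<forall>i\<ge>N. norm (integral {0..t} (p i) - integral {0..t} \<psi>) < e" by blast
    qed
    have "(\<lambda>i. integral {0..t} (p i) - h t) \<longlonglongrightarrow> 0"
    proof (rule Lim_null_comparison)
      show "\<forall>\<^sub>F i in sequentially. norm (integral {0..t} (p i) - h t) \<le> inverse (real (Suc i))"
        using p(1) t by (auto simp: S_def)
    qed (rule LIMSEQ_inverse_real_of_nat)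
    then show "(\<lambda>i. integral {0..t} (p i)) \<longlonglongrightarrow> h t" by (simp add: LIM_zero_iff)
  qed
  have "energy T \<psi> \<le> D + \<eta>" if "0 < \<eta>" for \<eta>
  proof (rule energy_Fatou(2)[of T "\<lambda>k. p (r k)"])
    have "(\<lambda>k. d (r k) + inverse (real (Suc (r k)))) \<longlonglongrightarrow> D + 0"
      using LIMSEQ_subseq_LIMSEQ[OF tendsto_add[OF D(1) LIMSEQ_inverse_real_of_nat] \<psi>(2)] by (simp add: o_def)
    then have "\<forall>\<^sub>F k in sequentially. d (r k) + inverse (real (Suc (r k))) < D + \<eta>"
      using that by (intro order_tendstoD(2)) auto
    then show "\<forall>\<^sub>F k in sequentially. energy T (p (r k)) \<le> D + \<eta>"
    proof eventually_elim
      case (elim k)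
      then show ?case using p(2)[of "r k"] by linarith
    qed
    have "0 \<le> d 0" unfolding d_def by (rule cINF_greatest[OF ne energy_nonneg])
    then show "0 \<le> D + \<eta>" using D(2)[of 0] that by simp
  qed (use pL \<psi> in \<open>auto simp: L2_on_def\<close>)
  then have ED: "energy T \<psi> \<le> D" by (rule field_le_epsilon)
  have lsc: "\<exists>e>0. \<forall>\<phi>. L2_on T \<phi> \<longrightarrow> (\<forall>t\<in>{0..T}. \<bar>integral {0..t} \<phi> - h t\<bar> \<le> e) \<longrightarrow>
       energy T \<psi> \<le> energy T \<phi> + \<eta>" if "0 < \<eta>" for \<eta>
  proof -
    have "\<forall>\<^sub>F m in sequentially. D - \<eta> < d m" using D(1) that by (intro order_tendstoD(1)) auto
    then obtain m where m: "D - \<eta> < d m" by (meson eventually_sequentially le_refl)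
    show ?thesis
    proof (intro exI[of _ "inverse (real (Suc m))"] conjI allI impI)
      fix \<phi> assume "L2_on T \<phi>" "\<forall>t\<in>{0..T}. \<bar>integral {0..t} \<phi> - h t\<bar> \<le> inverse (real (Suc m))"
      then have "d m \<le> energy T \<phi>" by (intro dle) (simp add: S_def)
      then show "energy T \<psi> \<le> energy T \<phi> + \<eta>" using m ED by linarith
    qed simp
  qed
  show thesis by (rule that[OF \<psi>(1) prim lsc])
qed

section \<open>Gaussian and Brownian estimates\<close>


lemma exp_neg_le_small:
  fixes c \<eta> :: real
  assumes "0 < c" "0 < \<eta>"
  shows "\<exists>\<epsilon>\<^sub>0>0. \<forall>\<epsilon>. 0 < \<epsilon> \<and> \<epsilon> \<le> \<epsilon>\<^sub>0 \<longrightarrow> exp (- c / \<epsilon>\<^sup>2) \<le> \<eta>"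
proof (intro exI[of _ "sqrt (c * \<eta>)"] conjI allI impI)
  fix \<epsilon> :: real assume e: "0 < \<epsilon> \<and> \<epsilon> \<le> sqrt (c * \<eta>)"
  then have "\<epsilon>\<^sup>2 \<le> (sqrt (c * \<eta>))\<^sup>2" by (intro power_mono) auto
  then have e2: "\<epsilon>\<^sup>2 \<le> c * \<eta>" using assms by simp
  have "c / \<epsilon>\<^sup>2 \<le> exp (c / \<epsilon>\<^sup>2)" using exp_ge_add_one_self[of "c / \<epsilon>\<^sup>2"] by linarith
  then have "inverse (exp (c / \<epsilon>\<^sup>2)) \<le> inverse (c / \<epsilon>\<^sup>2)" using e assms by (intro le_imp_inverse_le) auto
  also have "\<dots> \<le> \<eta>" using e2 assms by (simp add: field_simps)
  finally show "exp (- c / \<epsilon>\<^sup>2) \<le> \<eta>" by (simp add: exp_minus)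
qed (use assms in auto)

lemma le_if_le_on_dyadics:
  fixes f :: "real \<Rightarrow> real"
  assumes f: "continuous_on {a..c} f" and ac: "a < c"
    and le: "\<And>l j. j \<le> 2 ^ l \<Longrightarrow> f (a + (c - a) * (real j / 2 ^ l)) \<le> r"
  shows "\<forall>t\<in>{a..c}. f t \<le> r"
proof
  fix t assume t: "t \<in> {a..c}"
  define x where "x = (t - a) / (c - a)"
  have x: "0 \<le> x" "x \<le> 1" and tx: "t = a + (c - a) * x" using t ac by (auto simp: x_def field_simps)
  define j where "j l = nat \<lfloor>2 ^ l * x\<rfloor>" for l :: nat
  have jr: "real (j l) = of_int \<lfloor>2 ^ l * x\<rfloor>" for l using x by (simp add: j_def)
  have jl: "real (j l) \<le> 2 ^ l * x" "2 ^ l * x < real (j l) + 1" for l unfolding jr by linarith+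
  have jle: "j l \<le> 2 ^ l" for l
  proof -
    have "2 ^ l * x \<le> 2 ^ l * 1" using x by (intro mult_left_mono) auto
    then have "real (j l) \<le> 2 ^ l" using jl(1)[of l] by linarith
    then show ?thesis using of_nat_le_iff[of "j l" "2 ^ l", where 'a = real] by simp
  qed
  have "(\<lambda>l. real (j l) / 2 ^ l) \<longlonglongrightarrow> x"
  proof (rule LIM_zero_cancel, rule Lim_null_comparison)
    show "\<forall>\<^sub>F l in sequentially. norm (real (j l) / 2 ^ l - x) \<le> (1/2) ^ l"
    proof (rule always_eventually, rule allI)
      fix l
      have "\<bar>real (j l) - 2 ^ l * x\<bar> \<le> 1" using jl[of l] by linarith
      then have "\<bar>real (j l) - 2 ^ l * x\<bar> / 2 ^ l \<le> 1 / 2 ^ l" by (intro divide_right_mono) auto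
      moreover have "\<bar>real (j l) - 2 ^ l * x\<bar> / 2 ^ l = \<bar>(real (j l) - 2 ^ l * x) / 2 ^ l\<bar>" by simp
      moreover have "(real (j l) - 2 ^ l * x) / 2 ^ l = real (j l) / 2 ^ l - x" by (simp add: field_simps)
      ultimately show "norm (real (j l) / 2 ^ l - x) \<le> (1/2) ^ l" by (simp add: power_one_over)
    qed
    show "(\<lambda>l. (1/2::real) ^ l) \<longlonglongrightarrow> 0" by (rule LIMSEQ_power_zero) simp
  qed
  then have lim: "(\<lambda>l. a + (c - a) * (real (j l) / 2 ^ l)) \<longlonglongrightarrow> t" unfolding tx by (intro tendsto_intros)
  have in_ac: "a + (c - a) * (real (j l) / 2 ^ l) \<in> {a..c}" for l
  proof -
    have "real (j l) \<le> 2 ^ l" using jle[of l] of_nat_le_iff[of "j l" "2 ^ l", where 'a = real] by simp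
    then have "0 \<le> real (j l) / 2 ^ l" "real (j l) / 2 ^ l \<le> 1" by auto
    then have "0 \<le> (c - a) * (real (j l) / 2 ^ l)" "(c - a) * (real (j l) / 2 ^ l) \<le> (c - a) * 1"
      using ac by (intro mult_nonneg_nonneg mult_left_mono; simp)+
    then show ?thesis by simp
  qed
  have "(\<lambda>l. f (a + (c - a) * (real (j l) / 2 ^ l))) \<longlonglongrightarrow> f t"
    by (rule continuous_on_tendsto_compose[OF f lim t]) (use in_ac in simp)
  then show "f t \<le> r" by (rule LIMSEQ_le_const2) (use le jle in blast)
qed

lemma emeasure_one_le_Markov:
  assumes u: "u \<in> borel_measurable M"
  shows "emeasure M {x \<in> space M. 1 \<le> c * u x} \<le> c * (\<integral>\<^sup>+x. u x \<partial>M)"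
proof -
  have "(\<integral>\<^sup>+x. u x * indicator (space M) x \<partial>M) = (\<integral>\<^sup>+x. u x \<partial>M)"
    by (intro nn_integral_cong) simp
  then show ?thesis
    using nn_integral_Markov_inequality[of u "space M" M c] u by simp
qed

lemma sets_Collect_mem:
  assumes "f \<in> measurable M N" "A \<in> sets N"
  shows "{x \<in> space M. f x \<in> A} \<in> sets M"
  using measurable_sets[OF assms] by (simp add: vimage_def Int_def conj_commute)

lemma usual_filtrationD:
  assumes F: "usual_filtration M Ft" and t: "0 \<le> t"
  shows "space (Ft t) = space M" "sets (Ft t) \<subseteq> sets M" "t \<le> t' \<Longrightarrow> sets (Ft t) \<subseteq> sets (Ft t')"
proof -
  have 1: "\<forall>t\<ge>0. space (Ft t) = space M \<and> sets (Ft t) \<subseteq> sets M"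
    and 2: "\<forall>s t. 0 \<le> s \<and> s \<le> t \<longrightarrow> sets (Ft s) \<subseteq> sets (Ft t)"
    using F[unfolded usual_filtration_def, THEN conjunct1]
      F[unfolded usual_filtration_def, THEN conjunct2, THEN conjunct1] .
  show "space (Ft t) = space M" "sets (Ft t) \<subseteq> sets M" using 1 t by simp_all
  show "t \<le> t' \<Longrightarrow> sets (Ft t) \<subseteq> sets (Ft t')" using 2 t by simp
qed

lemma usual_filtration_measurable:
  assumes F: "usual_filtration M Ft" and s: "0 \<le> s" and f: "f \<in> borel_measurable (Ft s)"
  shows "s \<le> t \<Longrightarrow> f \<in> borel_measurable (Ft t)" "f \<in> borel_measurable M"
proof -
  note sp = usual_filtrationD(1,2)[OF F s]
  then show "f \<in> borel_measurable M" using f by (auto simp: measurable_def)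
  assume t: "s \<le> t"
  then have "space (Ft t) = space M" "sets (Ft s) \<subseteq> sets (Ft t)"
    using usual_filtrationD[OF F s] usual_filtrationD(1)[OF F, of t] s by auto
  then show "f \<in> borel_measurable (Ft t)" using f sp by (auto simp: measurable_def)
qed

context prob_space
begin

lemma gaussian_exp_square:
  assumes X: "distributed M lborel X (normal_density 0 \<sigma>)" and \<sigma>: "0 < \<sigma>" and \<theta>: "\<theta> < 1 / 2"
  shows "(\<integral>\<^sup>+\<omega>. ennreal (exp (\<theta> * (X \<omega>)\<^sup>2 / \<sigma>\<^sup>2)) \<partial>M) = ennreal (1 / sqrt (1 - 2 * \<theta>))"
proof -
  define \<rho> where "\<rho> = \<sigma> / sqrt (1 - 2 * \<theta>)"
  have \<rho>: "0 < \<rho>" using \<sigma> \<theta> by (simp add: \<rho>_def)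
  have \<rho>2: "\<rho>\<^sup>2 = \<sigma>\<^sup>2 / (1 - 2 * \<theta>)" using \<theta> by (simp add: \<rho>_def power_divide)
  have key: "normal_density 0 \<sigma> x * exp (\<theta> * x\<^sup>2 / \<sigma>\<^sup>2) = (1 / sqrt (1 - 2 * \<theta>)) * normal_density 0 \<rho> x" for x
  proof -
    have "exp (- x\<^sup>2 / (2 * \<sigma>\<^sup>2)) * exp (\<theta> * x\<^sup>2 / \<sigma>\<^sup>2) = exp (- x\<^sup>2 / (2 * \<rho>\<^sup>2))"
      unfolding \<rho>2 exp_add[symmetric] using \<sigma> \<theta> by (simp add: field_simps)
    moreover have "1 / sqrt (2 * pi * \<sigma>\<^sup>2) = (1 / sqrt (1 - 2 * \<theta>)) * (1 / sqrt (2 * pi * \<rho>\<^sup>2))"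
      unfolding \<rho>2 using \<sigma> \<theta> by (simp add: real_sqrt_mult real_sqrt_divide)
    ultimately show ?thesis unfolding normal_density_def by (simp add: mult.assoc)
  qed
  have "(\<integral>\<^sup>+\<omega>. ennreal (exp (\<theta> * (X \<omega>)\<^sup>2 / \<sigma>\<^sup>2)) \<partial>M)
      = (\<integral>\<^sup>+x. ennreal (normal_density 0 \<sigma> x) * ennreal (exp (\<theta> * x\<^sup>2 / \<sigma>\<^sup>2)) \<partial>lborel)"
    by (rule distributed_nn_integral[OF X, symmetric]) measurable
  also have "\<dots> = (\<integral>\<^sup>+x. ennreal (1 / sqrt (1 - 2 * \<theta>)) * ennreal (normal_density 0 \<rho> x) \<partial>lborel)"
    using \<theta> by (intro nn_integral_cong) (simp add: ennreal_mult[symmetric] key)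
  also have "\<dots> = ennreal (1 / sqrt (1 - 2 * \<theta>)) * (\<integral>\<^sup>+x. ennreal (normal_density 0 \<rho> x) \<partial>lborel)"
    by (rule nn_integral_cmult) measurable
  also have "(\<integral>\<^sup>+x. ennreal (normal_density 0 \<rho> x) \<partial>lborel) = 1"
    using nn_integral_eq_integral[OF integrable_normal_density[OF \<rho>, of 0]] integral_normal_density[OF \<rho>, of 0] by simp
  finally show ?thesis by simp
qed

lemma gaussian_tail:
  assumes X: "distributed M lborel X (normal_density 0 \<sigma>)" and \<sigma>: "0 < \<sigma>" and r: "0 \<le> r"
  shows "prob {\<omega> \<in> space M. r \<le> \<bar>X \<omega>\<bar>} \<le> 2 * exp (- r\<^sup>2 / (4 * \<sigma>\<^sup>2))"
proof -
  have Xm: "X \<in> borel_measurable M" using distributed_measurable[OF X] by simp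
  let ?u = "\<lambda>\<omega>. ennreal (exp ((1/4) * (X \<omega>)\<^sup>2 / \<sigma>\<^sup>2))"
  have "emeasure M {\<omega> \<in> space M. r \<le> \<bar>X \<omega>\<bar>} \<le> emeasure M {\<omega> \<in> space M. 1 \<le> ennreal (exp (- r\<^sup>2 / (4 * \<sigma>\<^sup>2))) * ?u \<omega>}"
  proof (rule emeasure_mono)
    show "{\<omega> \<in> space M. r \<le> \<bar>X \<omega>\<bar>} \<subseteq> {\<omega> \<in> space M. 1 \<le> ennreal (exp (- r\<^sup>2 / (4 * \<sigma>\<^sup>2))) * ?u \<omega>}"
    proof safe
      fix \<omega> assume w: "\<omega> \<in> space M" "r \<le> \<bar>X \<omega>\<bar>"
      have "r\<^sup>2 \<le> (X \<omega>)\<^sup>2" using w r abs_le_square_iff[of r "X \<omega>"] by simp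
      then have "0 \<le> - r\<^sup>2 / (4 * \<sigma>\<^sup>2) + (1/4) * (X \<omega>)\<^sup>2 / \<sigma>\<^sup>2" using \<sigma> by (simp add: field_simps)
      then have "1 \<le> exp (- r\<^sup>2 / (4 * \<sigma>\<^sup>2) + (1/4) * (X \<omega>)\<^sup>2 / \<sigma>\<^sup>2)" by (simp only: one_le_exp_iff)
      then show "1 \<le> ennreal (exp (- r\<^sup>2 / (4 * \<sigma>\<^sup>2))) * ?u \<omega>"
        unfolding exp_add by (simp add: ennreal_mult[symmetric] del: one_le_exp_iff)
    qed
  qed (use Xm in measurable)
  also have "\<dots> \<le> ennreal (exp (- r\<^sup>2 / (4 * \<sigma>\<^sup>2))) * (\<integral>\<^sup>+\<omega>. ?u \<omega> \<partial>M)"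
    by (rule emeasure_one_le_Markov) (use Xm in simp)
  also have "(\<integral>\<^sup>+\<omega>. ?u \<omega> \<partial>M) = ennreal (sqrt 2)"
    using gaussian_exp_square[OF X \<sigma>, of "1/4"] by (simp add: real_sqrt_divide)
  also have "ennreal (exp (- r\<^sup>2 / (4 * \<sigma>\<^sup>2))) * ennreal (sqrt 2) \<le> ennreal (exp (- r\<^sup>2 / (4 * \<sigma>\<^sup>2))) * ennreal 2"
    using sqrt2_less_2 by (intro mult_left_mono ennreal_leI) auto
  also have "\<dots> = ennreal (exp (- r\<^sup>2 / (4 * \<sigma>\<^sup>2)) * 2)" by (rule ennreal_mult[symmetric]) auto
  also have "\<dots> = ennreal (2 * exp (- r\<^sup>2 / (4 * \<sigma>\<^sup>2)))" by (simp only: mult.commute)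
  finally show ?thesis by (simp add: emeasure_eq_measure)
qed

text \<open>Averaging the density over \<open>a + x\<close> and \<open>a - x\<close> produces the factor \<open>cosh (a x / \<sigma>\<^sup>2) \<ge> 1\<close>.\<close>

lemma gaussian_shifted_ball:
  assumes X: "distributed M lborel X (normal_density 0 \<sigma>)" and \<sigma>: "0 < \<sigma>"
    and \<eta>: "0 < \<eta>" "16 * \<sigma>\<^sup>2 \<le> \<eta>\<^sup>2"
  shows "exp (- a\<^sup>2 / (2 * \<sigma>\<^sup>2)) / 2 \<le> prob {\<omega> \<in> space M. \<bar>X \<omega> - a\<bar> < \<eta>}"
proof -
  have Xm: "X \<in> borel_measurable M" using distributed_measurable[OF X] by simp
  let ?f = "normal_density 0 \<sigma>"
  define c where "c = exp (- a\<^sup>2 / (2 * \<sigma>\<^sup>2))"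
  have c0: "0 \<le> c" by (simp add: c_def)
  have em: "emeasure M {\<omega> \<in> space M. X \<omega> \<in> A} = (\<integral>\<^sup>+x. ennreal (?f x * indicator A x) \<partial>lborel)" if "A \<in> sets borel" for A
  proof -
    have "emeasure M (X -` A \<inter> space M) = (\<integral>\<^sup>+x. ennreal (?f x) * indicator A x \<partial>lborel)"
      using distributed_emeasure[OF X, of A] that by simp
    moreover have "X -` A \<inter> space M = {\<omega> \<in> space M. X \<omega> \<in> A}" by auto
    moreover have "(\<lambda>x. ennreal (?f x) * indicator A x) = (\<lambda>x. ennreal (?f x * indicator A x))"
      by (auto simp: indicator_def)
    ultimately show ?thesis by simp
  qed
  let ?A = "{x. \<bar>x - a\<bar> < \<eta>}" and ?B = "{x::real. \<bar>x\<bar> < \<eta>}"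
  let ?I = "\<integral>\<^sup>+x. ennreal (?f x * indicator ?A x) \<partial>lborel"
  have Am: "?A \<in> sets borel" and Bm: "?B \<in> sets borel" by measurable
  have gm: "(\<lambda>x. ennreal (?f x * indicator ?A x)) \<in> borel_measurable borel" using Am by measurable
  have I1: "?I = (\<integral>\<^sup>+x. ennreal (?f (a + x) * indicator ?B x) \<partial>lborel)"
    using nn_integral_real_affine[OF gm, of 1 a] by (simp add: indicator_def)
  have I2: "?I = (\<integral>\<^sup>+x. ennreal (?f (a - x) * indicator ?B x) \<partial>lborel)"
    using nn_integral_real_affine[OF gm, of "-1" a] by (simp add: indicator_def)
  have pt: "2 * c * ?f x \<le> ?f (a + x) + ?f (a - x)" for x
  proof -
    define u where "u = a * x / \<sigma>\<^sup>2"
    define k where "k = 1 / sqrt (2 * pi * \<sigma>\<^sup>2)"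
    have k0: "0 \<le> k" by (simp add: k_def)
    have f: "?f (a + x) = c * ?f x * exp (- u)" "?f (a - x) = c * ?f x * exp u"
      unfolding normal_density_def c_def u_def using \<sigma>
      by (simp_all add: exp_add[symmetric] power2_eq_square field_simps)
    have "2 \<le> exp (- u) + exp u" using exp_ge_add_one_self[of u] exp_ge_add_one_self[of "- u"] by linarith
    then have "c * ?f x * 2 \<le> c * ?f x * (exp (- u) + exp u)" using c0 by (intro mult_left_mono) auto
    then show ?thesis unfolding f by (simp add: algebra_simps)
  qed
  have half: "ennreal (1 / 2) \<le> (\<integral>\<^sup>+x. ennreal (?f x * indicator ?B x) \<partial>lborel)"
  proof -
    have "exp (- \<eta>\<^sup>2 / (4 * \<sigma>\<^sup>2)) \<le> exp (- 4)" using \<eta> \<sigma> by (simp add: field_simps)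
    also have "\<dots> \<le> 1 / 4"
    proof -
      have "4 \<le> exp (4::real)" using exp_ge_add_one_self[of "4::real"] by linarith
      then show ?thesis by (simp add: exp_minus field_simps)
    qed
    finally have "prob {\<omega> \<in> space M. \<eta> \<le> \<bar>X \<omega>\<bar>} \<le> 1 / 2"
      using gaussian_tail[OF X \<sigma>, of \<eta>] \<eta> by linarith
    moreover have "prob {\<omega> \<in> space M. X \<omega> \<in> ?B} = 1 - prob {\<omega> \<in> space M. \<eta> \<le> \<bar>X \<omega>\<bar>}"
    proof -
      have "{\<omega> \<in> space M. X \<omega> \<in> ?B} = space M - {\<omega> \<in> space M. \<eta> \<le> \<bar>X \<omega>\<bar>}" by auto
      moreover have "{\<omega> \<in> space M. \<eta> \<le> \<bar>X \<omega>\<bar>} \<in> events" using Xm by measurable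
      ultimately show ?thesis using prob_compl by simp
    qed
    ultimately have "1 / 2 \<le> prob {\<omega> \<in> space M. X \<omega> \<in> ?B}" by simp
    then have "ennreal (1 / 2) \<le> ennreal (prob {\<omega> \<in> space M. X \<omega> \<in> ?B})" by (rule ennreal_leI)
    also have "\<dots> = (\<integral>\<^sup>+x. ennreal (?f x * indicator ?B x) \<partial>lborel)"
      unfolding em[OF Bm, symmetric] by (simp only: emeasure_eq_measure)
    finally show ?thesis .
  qed
  have "ennreal c = ennreal (2 * c * (1 / 2))" by simp
  also have "\<dots> = ennreal (2 * c) * ennreal (1 / 2)" using c0 by (intro ennreal_mult) auto
  also have "\<dots> \<le> ennreal (2 * c) * (\<integral>\<^sup>+x. ennreal (?f x * indicator ?B x) \<partial>lborel)"
    by (intro mult_left_mono half) auto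
  also have "\<dots> = (\<integral>\<^sup>+x. ennreal (2 * c) * ennreal (?f x * indicator ?B x) \<partial>lborel)"
    using Bm by (intro nn_integral_cmult[symmetric]) measurable
  also have "\<dots> \<le> (\<integral>\<^sup>+x. ennreal (?f (a + x) * indicator ?B x) + ennreal (?f (a - x) * indicator ?B x) \<partial>lborel)"
  proof (rule nn_integral_mono)
    fix x
    show "ennreal (2 * c) * ennreal (?f x * indicator ?B x) \<le> ennreal (?f (a + x) * indicator ?B x) + ennreal (?f (a - x) * indicator ?B x)"
      using pt[of x] c0 by (cases "x \<in> ?B") (auto simp: ennreal_mult[symmetric] ennreal_plus[symmetric] intro!: ennreal_leI simp del: ennreal_plus)
  qed
  also have "\<dots> = ?I + ?I"
    unfolding I1 by (subst nn_integral_add) (use Bm I1 I2 in \<open>auto intro!: borel_measurable_times measurable_compose[OF _ measurable_ennreal] simp: normal_density_def\<close>)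
  also have "?I = ennreal (prob {\<omega> \<in> space M. \<bar>X \<omega> - a\<bar> < \<eta>})"
    using em[OF Am] by (simp add: emeasure_eq_measure)
  also have "ennreal (prob {\<omega> \<in> space M. \<bar>X \<omega> - a\<bar> < \<eta>}) + ennreal (prob {\<omega> \<in> space M. \<bar>X \<omega> - a\<bar> < \<eta>})
      = ennreal (2 * prob {\<omega> \<in> space M. \<bar>X \<omega> - a\<bar> < \<eta>})"
    by (simp add: ennreal_plus[symmetric] del: ennreal_plus)
  finally have "c \<le> 2 * prob {\<omega> \<in> space M. \<bar>X \<omega> - a\<bar> < \<eta>}" by simp
  then show ?thesis unfolding c_def by simp
qed

lemma brownian_increment_measurable:
  assumes F: "usual_filtration M Ft" and b: "brownian_motion M Ft b" and s: "0 \<le> s" "0 \<le> t"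
  shows "(\<lambda>\<omega>. b t \<omega> - b s \<omega>) \<in> borel_measurable M" "b t \<in> borel_measurable M"
proof -
  have "b t \<in> borel_measurable M" "b s \<in> borel_measurable M"
    using usual_filtration_measurable(2)[OF F] b s unfolding brownian_motion_def by auto
  then show "(\<lambda>\<omega>. b t \<omega> - b s \<omega>) \<in> borel_measurable M" "b t \<in> borel_measurable M" by auto
qed

lemma brownian_indep_increment:
  assumes F: "usual_filtration M Ft" and b: "brownian_motion M Ft b" and s: "0 \<le> s" "s < t"
    and A: "A \<in> sets (Ft s)" and B: "B \<in> sets borel"
  shows "prob (A \<inter> {\<omega> \<in> space M. b t \<omega> - b s \<omega> \<in> B}) = prob A * prob {\<omega> \<in> space M. b t \<omega> - b s \<omega> \<in> B}"
proof -
  have "indep_set (sets (Ft s)) (sets (vimage_algebra (space M) (\<lambda>\<omega>. b t \<omega> - b s \<omega>) borel))"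
    using b s unfolding brownian_motion_def by auto
  moreover have "(\<lambda>\<omega>. b t \<omega> - b s \<omega>) -` B \<inter> space M \<in> sets (vimage_algebra (space M) (\<lambda>\<omega>. b t \<omega> - b s \<omega>) borel)"
    using B by (rule in_vimage_algebra)
  moreover have "(\<lambda>\<omega>. b t \<omega> - b s \<omega>) -` B \<inter> space M = {\<omega> \<in> space M. b t \<omega> - b s \<omega> \<in> B}" by auto
  ultimately show ?thesis using indep_setD[OF _ A] by simp
qed

text \<open>Ottaviani's inequality, which unlike the reflection principle needs no symmetry.\<close>

lemma brownian_maximal_finite:
  fixes u :: "nat \<Rightarrow> real"
  assumes F: "usual_filtration M Ft" and b: "brownian_motion M Ft b" and r: "0 < r"
    and u: "strict_mono u" "u 0 = a" "0 \<le> a" "u m = c"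
    and p: "\<And>s t. a \<le> s \<Longrightarrow> s < t \<Longrightarrow> t \<le> c \<Longrightarrow> prob {\<omega> \<in> space M. r / 2 \<le> \<bar>b t \<omega> - b s \<omega>\<bar>} \<le> p"
    and p0: "0 \<le> p" and m: "0 < m"
  shows "prob {\<omega> \<in> space M. \<exists>j\<le>m. r \<le> \<bar>b (u j) \<omega> - b a \<omega>\<bar>} \<le> 2 * p"
proof (cases "p \<le> 1 / 2")
  case False
  then show ?thesis using prob_le_1[of "{\<omega> \<in> space M. \<exists>j\<le>m. r \<le> \<bar>b (u j) \<omega> - b a \<omega>\<bar>}"] by linarith
next
  case True
  define S where "S j \<omega> = b (u j) \<omega> - b a \<omega>" for j \<omega>
  define A where "A k = {\<omega> \<in> space M. r \<le> \<bar>S k \<omega>\<bar> \<and> (\<forall>j\<in>{..<k}. \<bar>S j \<omega>\<bar> < r)}" for k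
  have rB: "{x. \<bar>x\<bar> < r / 2} \<in> sets borel" by measurable
  define B where "B k = {\<omega> \<in> space M. b c \<omega> - b (u k) \<omega> \<in> {x. \<bar>x\<bar> < r / 2}}" for k
  have ua: "a \<le> u j" for j using strict_mono_less_eq[OF u(1), of 0 j] u(2) by simp
  have u0: "0 \<le> u j" for j using ua[of j] u(3) by simp
  have [measurable]: "b (u j) \<in> borel_measurable M" for j
    using brownian_increment_measurable(2)[OF F b u(3) u0] .
  have [measurable]: "b c \<in> borel_measurable M" "b a \<in> borel_measurable M"
    using brownian_increment_measurable(2)[OF F b u(3) u0[of m]] brownian_increment_measurable(2)[OF F b u(3) u(3)] u(4)
    by auto
  have bF: "b t \<in> borel_measurable (Ft t)" if "0 \<le> t" for t using b that unfolding brownian_motion_def by auto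
  have SF: "S j \<in> borel_measurable (Ft (u k))" if "j \<le> k" for j k
  proof -
    have "u j \<le> u k" using strict_mono_less_eq[OF u(1)] that by simp
    then have "b (u j) \<in> borel_measurable (Ft (u k))" "b a \<in> borel_measurable (Ft (u k))"
      using usual_filtration_measurable(1)[OF F u0 bF[OF u0]] usual_filtration_measurable(1)[OF F u(3) bF[OF u(3)]] ua by auto
    then show ?thesis unfolding S_def by simp
  qed
  have sp: "space (Ft (u k)) = space M" "sets (Ft (u k)) \<subseteq> events" for k
    using usual_filtrationD[OF F u0[of k]] by auto
  have AF: "A k \<in> sets (Ft (u k))" for k
  proof -
    have [measurable]: "S k \<in> borel_measurable (Ft (u k))" by (rule SF) simp
    have [measurable]: "\<And>j. j \<in> {..<k} \<Longrightarrow> S j \<in> borel_measurable (Ft (u k))" by (rule SF) simp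
    have "{\<omega> \<in> space (Ft (u k)). r \<le> \<bar>S k \<omega>\<bar> \<and> (\<forall>j\<in>{..<k}. \<bar>S j \<omega>\<bar> < r)} \<in> sets (Ft (u k))"
      by measurable
    then show ?thesis unfolding A_def sp .
  qed
  then have AM: "A k \<in> events" for k by (rule subsetD[OF sp(2)])
  have BM: "B k \<in> events" for k
    unfolding B_def using brownian_increment_measurable(1)[OF F b u0[of k] u0[of m]] u(4)
    by (intro sets_Collect_mem[where N = borel] rB) auto
  have disj: "disjoint_family_on A {..m}"
    unfolding disjoint_family_on_def
  proof (intro ballI impI equals0I)
    fix i j \<omega> assume ij: "i \<noteq> j" and w: "\<omega> \<in> A i \<inter> A j"
    have "\<bar>S (min i j) \<omega>\<bar> < r" using w ij unfolding A_def by (cases "i < j") (auto simp: min_def)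
    moreover have "r \<le> \<bar>S (min i j) \<omega>\<bar>" using w unfolding A_def by (auto simp: min_def)
    ultimately show False by simp
  qed
  have Un: "{\<omega> \<in> space M. \<exists>j\<le>m. r \<le> \<bar>b (u j) \<omega> - b a \<omega>\<bar>} = (\<Union>k\<in>{..m}. A k)" (is "?L = ?R")
  proof
    show "?L \<subseteq> ?R"
    proof
      fix \<omega> assume "\<omega> \<in> ?L"
      then obtain j where j: "\<omega> \<in> space M" "j \<le> m" "r \<le> \<bar>S j \<omega>\<bar>" by (auto simp: S_def)
      define k where "k = (LEAST k. r \<le> \<bar>S k \<omega>\<bar>)"
      have "r \<le> \<bar>S k \<omega>\<bar>" unfolding k_def using j(3) by (rule LeastI)
      moreover have "k \<le> j" unfolding k_def using j(3) by (rule Least_le)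
      moreover have "\<bar>S i \<omega>\<bar> < r" if "i < k" for i
        using not_less_Least[of i "\<lambda>k. r \<le> \<bar>S k \<omega>\<bar>"] that unfolding k_def by auto
      ultimately show "\<omega> \<in> ?R" using j unfolding A_def by auto
    qed
    show "?R \<subseteq> ?L" unfolding A_def S_def by auto
  qed
  have AB: "prob (A k) * (1 - p) \<le> prob (A k \<inter> B k)" if k: "k \<le> m" for k
  proof (cases "k = m")
    case True
    then have "B k = space M" unfolding B_def using u(4) r by auto
    then have "A k \<inter> B k = A k" using sets.sets_into_space[OF AM] by auto
    then show ?thesis using p0 mult_left_le[of "1 - p" "prob (A k)"] by simp
  next
    case False
    then have lt: "u k < c" using k u by (auto simp: strict_mono_less[OF u(1)] u(4)[symmetric])
    have "prob (A k \<inter> B k) = prob (A k) * prob (B k)"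
      unfolding B_def by (rule brownian_indep_increment[OF F b u0 lt AF rB])
    moreover have "1 - p \<le> prob (B k)"
    proof -
      have "B k = space M - {\<omega> \<in> space M. r / 2 \<le> \<bar>b c \<omega> - b (u k) \<omega>\<bar>}" unfolding B_def by auto
      moreover have "{\<omega> \<in> space M. r / 2 \<le> \<bar>b c \<omega> - b (u k) \<omega>\<bar>} \<in> events"
        by measurable
      ultimately show ?thesis using prob_compl p[OF ua lt] by simp
    qed
    ultimately show ?thesis by (simp add: mult_left_mono)
  qed
  have "prob (\<Union>k\<in>{..m}. A k) * (1 - p) = (\<Sum>k\<le>m. prob (A k)) * (1 - p)"
    using AM disj by (subst finite_measure_finite_Union) auto
  also have "\<dots> \<le> (\<Sum>k\<le>m. prob (A k \<inter> B k))"
    unfolding sum_distrib_right using AB by (intro sum_mono) auto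
  also have "\<dots> = prob (\<Union>k\<in>{..m}. A k \<inter> B k)"
  proof (subst finite_measure_finite_Union)
    show "disjoint_family_on (\<lambda>k. A k \<inter> B k) {..m}"
      using disj by (rule disjoint_family_on_bisimulation) blast
  qed (use AM BM in auto)
  also have "\<dots> \<le> prob {\<omega> \<in> space M. r / 2 \<le> \<bar>b c \<omega> - b a \<omega>\<bar>}"
  proof (rule finite_measure_mono)
    show "(\<Union>k\<in>{..m}. A k \<inter> B k) \<subseteq> {\<omega> \<in> space M. r / 2 \<le> \<bar>b c \<omega> - b a \<omega>\<bar>}"
    proof
      fix \<omega> assume "\<omega> \<in> (\<Union>k\<in>{..m}. A k \<inter> B k)"
      then obtain k where k: "\<omega> \<in> A k" "\<omega> \<in> B k" by blast
      then have w: "\<omega> \<in> space M" "r \<le> \<bar>b (u k) \<omega> - b a \<omega>\<bar>" "\<bar>b c \<omega> - b (u k) \<omega>\<bar> < r / 2"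
        unfolding A_def B_def S_def by simp_all
      from w(2,3) have "r / 2 \<le> \<bar>b c \<omega> - b a \<omega>\<bar>" by argo
      then show "\<omega> \<in> {\<omega> \<in> space M. r / 2 \<le> \<bar>b c \<omega> - b a \<omega>\<bar>}" using w(1) by simp
    qed
    show "{\<omega> \<in> space M. r / 2 \<le> \<bar>b c \<omega> - b a \<omega>\<bar>} \<in> events"
      by measurable
  qed
  also have "\<dots> \<le> p"
  proof (rule p)
    show "a < c" using strict_mono_less[OF u(1), of 0 m] m u by simp
  qed auto
  finally have *: "prob (\<Union>k\<in>{..m}. A k) * (1 - p) \<le> p" .
  have "prob (\<Union>k\<in>{..m}. A k) * (1 / 2) \<le> prob (\<Union>k\<in>{..m}. A k) * (1 - p)"
    using True by (intro mult_left_mono) auto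
  then show ?thesis using * unfolding Un by linarith
qed

lemma brownian_oscillation:
  assumes F: "usual_filtration M Ft" and b: "brownian_motion M Ft b" and r: "0 < r"
    and ac: "0 \<le> a" "a < c"
  obtains G where "G \<in> events" "prob G \<le> 4 * exp (- r\<^sup>2 / (16 * (c - a)))"
    "AE \<omega> in M. \<omega> \<notin> G \<longrightarrow> (\<forall>t\<in>{a..c}. \<bar>b t \<omega> - b a \<omega>\<bar> \<le> r)"
proof -
  define p where "p = 2 * exp (- r\<^sup>2 / (16 * (c - a)))"
  define u where "u l j = a + (c - a) * (real j / 2 ^ l)" for l j :: nat
  define U where "U l = {\<omega> \<in> space M. \<exists>j\<le>2^l. r \<le> \<bar>b (u l j) \<omega> - b a \<omega>\<bar>}" for l :: nat
  have p: "prob {\<omega> \<in> space M. r / 2 \<le> \<bar>b t \<omega> - b s \<omega>\<bar>} \<le> p" if st: "a \<le> s" "s < t" "t \<le> c" for s t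
  proof -
    have "distributed M lborel (\<lambda>\<omega>. b t \<omega> - b s \<omega>) (normal_density 0 (sqrt (t - s)))"
      using b st ac unfolding brownian_motion_def by auto
    then have "prob {\<omega> \<in> space M. r / 2 \<le> \<bar>b t \<omega> - b s \<omega>\<bar>} \<le> 2 * exp (- (r / 2)\<^sup>2 / (4 * (sqrt (t - s))\<^sup>2))"
      using st r by (intro gaussian_tail) auto
    also have "(r / 2)\<^sup>2 / (4 * (sqrt (t - s))\<^sup>2) = r\<^sup>2 / (16 * (t - s))" using st by (simp add: power_divide)
    then have "- (r / 2)\<^sup>2 / (4 * (sqrt (t - s))\<^sup>2) = - (r\<^sup>2 / (16 * (t - s)))" by simp
    also have "2 * exp (- (r\<^sup>2 / (16 * (t - s)))) \<le> p"
      unfolding p_def using st r by (auto intro!: divide_left_mono)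
    finally show ?thesis .
  qed
  have u0: "0 \<le> u l j" for l j using ac unfolding u_def by auto
  have UM: "U l \<in> events" for l
  proof -
    have [measurable]: "\<And>j. (\<lambda>\<omega>. b (u l j) \<omega> - b a \<omega>) \<in> borel_measurable M"
      using brownian_increment_measurable(1)[OF F b ac(1) u0] .
    show ?thesis unfolding U_def by measurable
  qed
  have UP: "prob (U l) \<le> 2 * p" for l
    unfolding U_def
  proof (rule brownian_maximal_finite[OF F b r, where c = c])
    show "strict_mono (u l)" unfolding u_def using ac by (intro strict_monoI) (auto simp: divide_strict_right_mono)
  qed (use p ac in \<open>auto simp: u_def p_def\<close>)
  have inc: "incseq U"
  proof (rule incseq_SucI)
    fix l
    show "U l \<subseteq> U (Suc l)"
    proof
      fix \<omega> assume "\<omega> \<in> U l"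
      then obtain j where j: "\<omega> \<in> space M" "j \<le> 2^l" "r \<le> \<bar>b (u l j) \<omega> - b a \<omega>\<bar>" unfolding U_def by auto
      have "u (Suc l) (2 * j) = u l j" unfolding u_def by simp
      then show "\<omega> \<in> U (Suc l)" unfolding U_def using j by (auto intro!: exI[of _ "2 * j"])
    qed
  qed
  let ?G = "\<Union>l. U l"
  have G: "?G \<in> events" using UM by auto
  have "(\<lambda>l. prob (U l)) \<longlonglongrightarrow> prob ?G"
    using UM inc by (intro finite_Lim_measure_incseq) auto
  then have "prob ?G \<le> 2 * p" using UP by (intro LIMSEQ_le_const2) auto
  then have GP: "prob ?G \<le> 4 * exp (- r\<^sup>2 / (16 * (c - a)))" unfolding p_def by simp
  have "AE \<omega> in M. continuous_on {0..} (\<lambda>t. b t \<omega>)" using b unfolding brownian_motion_def by auto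
  then have "AE \<omega> in M. \<omega> \<notin> ?G \<longrightarrow> (\<forall>t\<in>{a..c}. \<bar>b t \<omega> - b a \<omega>\<bar> \<le> r)"
    using AE_space
  proof eventually_elim
    case (elim \<omega>)
    show ?case
    proof
      assume w: "\<omega> \<notin> ?G"
      show "\<forall>t\<in>{a..c}. \<bar>b t \<omega> - b a \<omega>\<bar> \<le> r"
      proof (rule le_if_le_on_dyadics)
        show "continuous_on {a..c} (\<lambda>t. \<bar>b t \<omega> - b a \<omega>\<bar>)"
          using ac by (intro continuous_intros continuous_on_subset[OF elim(1)]) auto
        fix l j :: nat assume "j \<le> 2 ^ l"
        moreover have "\<omega> \<notin> U l" using w by auto
        ultimately show "\<bar>b (a + (c - a) * (real j / 2 ^ l)) \<omega> - b a \<omega>\<bar> \<le> r"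
          using elim(2) unfolding U_def u_def by auto
      qed (use ac in simp)
    qed
  qed
  with G GP show thesis by (rule that)
qed

lemma brownian_increments_prob:
  assumes F: "usual_filtration M Ft" and b: "brownian_motion M Ft b" and d: "0 < d"
    and A: "\<And>k. k < N \<Longrightarrow> A k \<in> sets borel"
  shows "prob {\<omega> \<in> space M. \<forall>k<N. b (real (Suc k) * d) \<omega> - b (real k * d) \<omega> \<in> A k}
       = (\<Prod>k<N. prob {\<omega> \<in> space M. b (real (Suc k) * d) \<omega> - b (real k * d) \<omega> \<in> A k})"
  using A
proof (induction N)
  case 0
  then show ?case using prob_space by simp
next
  case (Suc N)
  let ?E = "{\<omega> \<in> space M. \<forall>k<N. b (real (Suc k) * d) \<omega> - b (real k * d) \<omega> \<in> A k}"
  let ?D = "{\<omega> \<in> space M. b (real (Suc N) * d) \<omega> - b (real N * d) \<omega> \<in> A N}"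
  have t0: "0 \<le> real k * d" for k using d by simp
  have sp: "space (Ft (real N * d)) = space M"
    by (rule usual_filtrationD(1)[OF F t0])
  have bF: "b (real k * d) \<in> borel_measurable (Ft (real N * d))" if "k \<le> N" for k
  proof (rule usual_filtration_measurable(1)[OF F t0])
    show "b (real k * d) \<in> borel_measurable (Ft (real k * d))"
      using b t0[of k] unfolding brownian_motion_def by simp
    show "real k * d \<le> real N * d" using that d by (intro mult_right_mono) auto
  qed
  have "{\<omega> \<in> space (Ft (real N * d)). \<forall>k\<in>{..<N}. b (real (Suc k) * d) \<omega> - b (real k * d) \<omega> \<in> A k} \<in> sets (Ft (real N * d))"
  proof (rule sets.sets_Collect_finite_All)
    fix k assume k: "k \<in> {..<N}"
    have "(\<lambda>\<omega>. b (real (Suc k) * d) \<omega> - b (real k * d) \<omega>) \<in> borel_measurable (Ft (real N * d))"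
      using bF[of k] bF[of "Suc k"] k by (intro borel_measurable_diff) auto
    moreover have "A k \<in> sets borel" using Suc.prems k by auto
    ultimately show "{\<omega> \<in> space (Ft (real N * d)). b (real (Suc k) * d) \<omega> - b (real k * d) \<omega> \<in> A k} \<in> sets (Ft (real N * d))"
      by (rule sets_Collect_mem) 
  qed simp
  then have E: "?E \<in> sets (Ft (real N * d))" unfolding sp Ball_def lessThan_iff .
  have ED: "{\<omega> \<in> space M. \<forall>k<Suc N. b (real (Suc k) * d) \<omega> - b (real k * d) \<omega> \<in> A k} = ?E \<inter> ?D"
    unfolding less_Suc_eq by blast
  have "prob (?E \<inter> ?D) = prob ?E * prob ?D"
    by (rule brownian_indep_increment[OF F b t0 _ E]) (use Suc.prems d in auto)
  also have "prob ?E = (\<Prod>k<N. prob {\<omega> \<in> space M. b (real (Suc k) * d) \<omega> - b (real k * d) \<omega> \<in> A k})"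
    by (rule Suc.IH) (use Suc.prems in auto)
  finally show ?case unfolding ED by (simp only: prod.lessThan_Suc)
qed

lemma wiener_increments_indep:
  assumes F: "usual_filtration M Ft" and W: "cylindrical_wiener M Ft \<beta>" and d: "0 < d" and n: "1 \<le> n" and N: "1 \<le> N"
  shows "indep_vars (\<lambda>_. borel) (\<lambda>(i, k) \<omega>. \<beta> i (real (Suc k) * d) \<omega> - \<beta> i (real k * d) \<omega>) ({1..n} \<times> {..<N})"
proof -
  define D where "D = (\<lambda>(i, k) \<omega>. \<beta> i (real (Suc k) * d) \<omega> - \<beta> i (real k * d) \<omega>)"
  let ?I = "{1..n} \<times> {..<N}"
  have b: "brownian_motion M Ft (\<beta> i)" if "1 \<le> i" for i using W that unfolding cylindrical_wiener_def by auto
  have iv: "indep_vars (\<lambda>_. Pi\<^sub>M {0..} (\<lambda>_. borel)) (\<lambda>i \<omega>. \<lambda>t\<in>{0..}. \<beta> i t \<omega>) {1..}"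
    using W unfolding cylindrical_wiener_def by auto
  have t0: "0 \<le> real k * d" for k using d by simp
  have Dm: "D x \<in> borel_measurable M" if "x \<in> ?I" for x
    using brownian_increment_measurable(1)[OF F b t0 t0] that unfolding D_def by (auto simp del: of_nat_Suc)
  have "indep_sets (\<lambda>x. {D x -` A \<inter> space M |A. A \<in> sets borel}) ?I"
  proof (subst indep_sets_finite)
    show "?I \<noteq> {}" using n N by (auto simp: lessThan_empty_iff)
    show "{D x -` A \<inter> space M |A. A \<in> sets borel} \<subseteq> events" if "x \<in> ?I" for x
      using Dm[OF that] by (auto intro: measurable_sets)
    show "space M \<in> {D x -` A \<inter> space M |A. A \<in> sets borel}" for x
      by (auto intro!: exI[of _ UNIV])
    show "\<forall>A\<in>Pi ?I (\<lambda>x. {D x -` A \<inter> space M |A. A \<in> sets borel}). prob (\<Inter>x\<in>?I. A x) = (\<Prod>x\<in>?I. prob (A x))"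
    proof
      fix A assume "A \<in> Pi ?I (\<lambda>x. {D x -` A \<inter> space M |A. A \<in> sets borel})"
      then have "\<forall>x\<in>?I. \<exists>B. A x = D x -` B \<inter> space M \<and> B \<in> sets borel" by auto
      then obtain B where B: "\<And>x. x \<in> ?I \<Longrightarrow> A x = D x -` B x \<inter> space M" "\<And>x. x \<in> ?I \<Longrightarrow> B x \<in> sets borel" by metis
      define C where "C i = {f \<in> space (Pi\<^sub>M {0..} (\<lambda>_. borel)). \<forall>k\<in>{..<N}. f (real (Suc k) * d) - f (real k * d) \<in> B (i, k)}"
        for i :: nat
      let ?P = "Pi\<^sub>M {0..} (\<lambda>_. borel) :: (real \<Rightarrow> real) measure"
      have Cm: "C i \<in> sets ?P" if i: "i \<in> {1..n}" for i
        unfolding C_def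
      proof (rule sets.sets_Collect_finite_All)
        fix k assume k: "k \<in> {..<N}"
        have "(\<lambda>f. f (real (Suc k) * d) - f (real k * d)) \<in> borel_measurable ?P"
          using t0 by (intro borel_measurable_diff measurable_component_singleton) (auto simp del: of_nat_Suc)
        then show "{f \<in> space ?P. f (real (Suc k) * d) - f (real k * d) \<in> B (i, k)} \<in> sets ?P"
          by (rule sets_Collect_mem) (use B i k in auto)
      qed simp
      let ?V = "\<lambda>i. (\<lambda>\<omega>. \<lambda>t\<in>{0..}. \<beta> i t \<omega>) -` C i \<inter> space M"
      have V: "?V i = {\<omega> \<in> space M. \<forall>k<N. \<beta> i (real (Suc k) * d) \<omega> - \<beta> i (real k * d) \<omega> \<in> B (i, k)}" for i
        unfolding C_def using t0 by (auto simp: space_PiM simp del: of_nat_Suc)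
      have AV: "A (i, k) = {\<omega> \<in> space M. \<beta> i (real (Suc k) * d) \<omega> - \<beta> i (real k * d) \<omega> \<in> B (i, k)}" if "i \<in> {1..n}" "k < N" for i k
        using B(1)[of "(i, k)"] that unfolding D_def by auto
      have IV: "(\<Inter>x\<in>?I. A x) = (\<Inter>i\<in>{1..n}. ?V i)"
      proof -
        have "0 < N" "1 \<in> {1..n}" using n N by auto
        have "(\<Inter>x\<in>?I. A x) = (\<Inter>i\<in>{1..n}. \<Inter>k\<in>{..<N}. A (i, k))" by auto
        also have "\<dots> = (\<Inter>i\<in>{1..n}. ?V i)"
        proof (rule INF_cong[OF refl])
          fix i assume i: "i \<in> {1..n}"
          have "(\<Inter>k\<in>{..<N}. A (i, k)) = (\<Inter>k\<in>{..<N}. {\<omega> \<in> space M. \<beta> i (real (Suc k) * d) \<omega> - \<beta> i (real k * d) \<omega> \<in> B (i, k)})"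
            using AV[OF i] by (intro INF_cong) auto
          also have "\<dots> = ?V i" unfolding V using \<open>0 < N\<close> by auto
          finally show "(\<Inter>k\<in>{..<N}. A (i, k)) = ?V i" .
        qed
        finally show ?thesis .
      qed
      have "prob (\<Inter>i\<in>{1..n}. ?V i) = (\<Prod>i\<in>{1..n}. prob (?V i))"
        by (rule indep_varsD[OF iv]) (use n Cm in auto)
      also have "\<dots> = (\<Prod>i\<in>{1..n}. \<Prod>k<N. prob (A (i, k)))"
      proof (rule prod.cong[OF refl])
        fix i assume i: "i \<in> {1..n}"
        have "prob (?V i) = (\<Prod>k<N. prob {\<omega> \<in> space M. \<beta> i (real (Suc k) * d) \<omega> - \<beta> i (real k * d) \<omega> \<in> B (i, k)})"
          unfolding V by (rule brownian_increments_prob[OF F b d]) (use i B in auto)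
        also have "\<dots> = (\<Prod>k<N. prob (A (i, k)))" using AV[OF i] by (intro prod.cong) auto
        finally show "prob (?V i) = (\<Prod>k<N. prob (A (i, k)))" .
      qed
      also have "\<dots> = (\<Prod>x\<in>?I. prob (A x))" by (simp add: prod.cartesian_product)
      finally show "prob (\<Inter>x\<in>?I. A x) = (\<Prod>x\<in>?I. prob (A x))" unfolding IV .
    qed
  qed auto
  then have "indep_vars (\<lambda>_. borel) D ?I" unfolding indep_vars_def2 using Dm by auto
  then show ?thesis unfolding D_def .
qed

end

section \<open>Large deviation bounds for Brownian motion\<close>


lemma floor_step_eq:
  assumes d: "0 < d" and t: "real k * d \<le> t" "t < real (Suc k) * d"
  shows "nat \<lfloor>t / d\<rfloor> = k"
proof -
  have "real k \<le> t / d" "t / d < real k + 1" using d t by (simp_all add: field_simps)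
  then have "\<lfloor>t / d\<rfloor> = int k" by (intro floor_unique) auto
  then show ?thesis by simp
qed

lemma step_function_on_cell:
  fixes c :: "nat \<Rightarrow> real"
  assumes d: "0 < d" and t: "real k * d \<le> t" "t \<le> real (Suc k) * d"
  shows "((\<lambda>s. c (nat \<lfloor>s / d\<rfloor>)) has_integral ((t - real k * d) * c k)) {real k * d..t}"
proof (rule has_integral_spike_finite[of "{t}"])
  show "((\<lambda>_. c k) has_integral ((t - real k * d) * c k)) {real k * d..t}"
    using has_integral_const_real[of "c k" "real k * d" t] t by simp
  fix s assume "s \<in> {real k * d..t} - {t}"
  then have "nat \<lfloor>s / d\<rfloor> = k" using t by (intro floor_step_eq[OF d]) auto
  then show "c (nat \<lfloor>s / d\<rfloor>) = c k" by simp
qed simp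

lemma step_function_has_integral:
  fixes c :: "nat \<Rightarrow> real"
  assumes d: "0 < d" and t: "real k * d \<le> t" "t \<le> real (Suc k) * d"
  shows "((\<lambda>s. c (nat \<lfloor>s / d\<rfloor>)) has_integral (d * (\<Sum>j<k. c j) + (t - real k * d) * c k)) {0..t}"
proof -
  have "((\<lambda>s. c (nat \<lfloor>s / d\<rfloor>)) has_integral (d * (\<Sum>j<k. c j))) {0..real k * d}"
  proof (induction k)
    case 0
    then show ?case by (simp add: has_integral_refl)
  next
    case (Suc k)
    have "((\<lambda>s. c (nat \<lfloor>s / d\<rfloor>)) has_integral ((real (Suc k) * d - real k * d) * c k)) {real k * d..real (Suc k) * d}"
      using d by (intro step_function_on_cell) (auto simp: mult_right_mono)
    with Suc have "((\<lambda>s. c (nat \<lfloor>s / d\<rfloor>)) has_integral (d * (\<Sum>j<k. c j) + (real (Suc k) * d - real k * d) * c k)) {0..real (Suc k) * d}"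
      using d by (intro has_integral_combine[of 0 "real k * d"]) (auto simp: mult_right_mono)
    then show ?case by (simp add: algebra_simps)
  qed
  then show ?thesis
    using d t by (intro has_integral_combine[OF _ _ _ step_function_on_cell[OF d t]]) auto
qed

lemma step_function_L2_on:
  fixes c :: "nat \<Rightarrow> real"
  assumes d: "0 < d"
  shows "L2_on (real N * d) (\<lambda>s. c (nat \<lfloor>s / d\<rfloor>))"
    and "energy (real N * d) (\<lambda>s. c (nat \<lfloor>s / d\<rfloor>)) = d * (\<Sum>k<N. (c k)\<^sup>2)"
proof -
  have i: "((\<lambda>s. (c (nat \<lfloor>s / d\<rfloor>))\<^sup>2) has_integral (d * (\<Sum>k<N. (c k)\<^sup>2))) {0..real N * d}"
    using step_function_has_integral[OF d, of N "real N * d" "\<lambda>k. (c k)\<^sup>2"] d by (simp add: mult_right_mono)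
  then show "energy (real N * d) (\<lambda>s. c (nat \<lfloor>s / d\<rfloor>)) = d * (\<Sum>k<N. (c k)\<^sup>2)" by (rule integral_unique)
  have "(\<lambda>s. c (nat \<lfloor>s / d\<rfloor>)) \<in> borel_measurable borel" by measurable
  then have "(\<lambda>s. c (nat \<lfloor>s / d\<rfloor>)) \<in> borel_measurable (lebesgue_on {0..real N * d})"
    by (intro measurable_restrict_space1 borel_measurable_if_D) (auto intro: measurable_completion)
  then show "L2_on (real N * d) (\<lambda>s. c (nat \<lfloor>s / d\<rfloor>))"
    using i unfolding L2_on_def by (auto intro: has_integral_integrable)
qed

lemma grid_cell:
  assumes d: "0 < d" and N: "1 \<le> N" and t: "t \<in> {0..real N * d}"
  obtains k where "k < N" "real k * d \<le> t" "t \<le> real (Suc k) * d"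
proof (cases "t = real N * d")
  case True
  show thesis using that[of "N - 1"] True N d by (simp add: of_nat_diff algebra_simps)
next
  case False
  define k where "k = nat \<lfloor>t / d\<rfloor>"
  have "real k = of_int \<lfloor>t / d\<rfloor>" unfolding k_def using t d by simp
  then have "real k \<le> t / d" "t / d < real k + 1" by linarith+
  then have k: "real k * d \<le> t" "t < real (Suc k) * d" using d by (simp_all add: field_simps)
  then have "real k * d < real N * d" using False t by auto
  then have "k < N" using d by simp
  then show thesis using that[of k] k by auto
qed

lemma small_mesh:
  assumes T: "0 < T" and e: "0 < e"
  obtains N d where "1 \<le> N" "0 < d" "d \<le> e" "T = real N * (d::real)"
proof -
  obtain N where N: "T / e < real N" using reals_Archimedean2 by blast
  have N1: "1 \<le> N" using N T e by (cases N) (auto simp: divide_less_0_iff)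
  show thesis
    using that[of N "T / real N"] N N1 T e by (auto simp: field_simps)
qed

context prob_space
begin

lemma wiener_oscillation:
  assumes F: "usual_filtration M Ft" and W: "cylindrical_wiener M Ft \<beta>" and d: "0 < d" and r: "0 < r"
  obtains G where "G \<in> events" "prob G \<le> real (n * N) * (4 * exp (- r\<^sup>2 / (16 * d)))"
    "AE \<omega> in M. \<omega> \<notin> G \<longrightarrow> (\<forall>i\<in>{1..n}. \<forall>k<N. \<forall>t\<in>{real k * d..real (Suc k) * d}. \<bar>\<beta> i t \<omega> - \<beta> i (real k * d) \<omega>\<bar> \<le> r)"
proof -
  have b: "brownian_motion M Ft (\<beta> i)" if "1 \<le> i" for i using W that unfolding cylindrical_wiener_def by auto
  let ?P = "\<lambda>x G. G \<in> events \<and> prob G \<le> 4 * exp (- r\<^sup>2 / (16 * d)) \<and>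
      (AE \<omega> in M. \<omega> \<notin> G \<longrightarrow> (\<forall>t\<in>{real (snd x) * d..real (Suc (snd x)) * d}. \<bar>\<beta> (fst x) t \<omega> - \<beta> (fst x) (real (snd x) * d) \<omega>\<bar> \<le> r))"
  have ex: "\<exists>G. ?P x G" if x: "x \<in> {1..n} \<times> {..<N}" for x
  proof -
    have h: "real (Suc (snd x)) * d - real (snd x) * d = d" by (simp add: algebra_simps)
    have 1: "0 \<le> real (snd x) * d" "real (snd x) * d < real (Suc (snd x)) * d" "1 \<le> fst x"
      using d x by (simp, simp only: mult_less_cancel_right of_nat_less_iff, simp, simp add: mem_Times_iff)
    have bx: "brownian_motion M Ft (\<beta> (fst x))" using b 1(3) by simp
    show ?thesis
      by (rule brownian_oscillation[OF F bx r 1(1,2), unfolded h], rule exI, intro conjI)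
  qed
  obtain H where "\<forall>x\<in>{1..n} \<times> {..<N}. ?P x (H x)" using bchoice[of "{1..n} \<times> {..<N}" ?P] ex by presburger
  then have H: "\<And>x. x \<in> {1..n} \<times> {..<N} \<Longrightarrow> ?P x (H x)" by (rule bspec)
  let ?I = "{1..n} \<times> {..<N}"
  let ?G = "\<Union>x\<in>?I. H x"
  have "prob ?G \<le> (\<Sum>x\<in>?I. prob (H x))"
    using H by (intro finite_measure_subadditive_finite) auto
  also have "\<dots> \<le> (\<Sum>x\<in>?I. 4 * exp (- r\<^sup>2 / (16 * d)))" using H by (intro sum_mono) auto
  also have "\<dots> = real (n * N) * (4 * exp (- r\<^sup>2 / (16 * d)))" by simp
  finally have P: "prob ?G \<le> real (n * N) * (4 * exp (- r\<^sup>2 / (16 * d)))" .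
  have "AE \<omega> in M. \<forall>x\<in>?I. \<omega> \<notin> H x \<longrightarrow> (\<forall>t\<in>{real (snd x) * d..real (Suc (snd x)) * d}. \<bar>\<beta> (fst x) t \<omega> - \<beta> (fst x) (real (snd x) * d) \<omega>\<bar> \<le> r)"
    using H by (intro AE_finite_allI) auto
  then have "AE \<omega> in M. \<omega> \<notin> ?G \<longrightarrow> (\<forall>i\<in>{1..n}. \<forall>k<N. \<forall>t\<in>{real k * d..real (Suc k) * d}. \<bar>\<beta> i t \<omega> - \<beta> i (real k * d) \<omega>\<bar> \<le> r)"
  proof eventually_elim
    case (elim \<omega>)
    show ?case
    proof (intro impI ballI allI)
      fix i k t assume a: "\<omega> \<notin> ?G" "i \<in> {1..n}" "k < N" "t \<in> {real k * d..real (Suc k) * d}"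
      then have "(i, k) \<in> ?I" "\<omega> \<notin> H (i, k)" by auto
      with elim a(4) show "\<bar>\<beta> i t \<omega> - \<beta> i (real k * d) \<omega>\<bar> \<le> r" by fastforce
    qed
  qed
  moreover have "?G \<in> events" using H by (intro sets.finite_UN) auto
  ultimately show thesis using P that by blast
qed

lemma wiener_increment_distributed:
  assumes W: "cylindrical_wiener M Ft \<beta>" and d: "0 < d" and i: "1 \<le> i"
  shows "distributed M lborel (\<lambda>\<omega>. \<beta> i (real (Suc k) * d) \<omega> - \<beta> i (real k * d) \<omega>) (normal_density 0 (sqrt d))"
proof -
  have h: "real (Suc k) * d - real k * d = d" "0 \<le> real k * d" "real k * d < real (Suc k) * d"
    using d by (simp_all add: algebra_simps)
  have "brownian_motion M Ft (\<beta> i)" using W i unfolding cylindrical_wiener_def by simp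
  then have "distributed M lborel (\<lambda>\<omega>. \<beta> i (real (Suc k) * d) \<omega> - \<beta> i (real k * d) \<omega>)
      (normal_density 0 (sqrt (real (Suc k) * d - real k * d)))"
    using h(2,3) unfolding brownian_motion_def by simp
  then show ?thesis unfolding h(1) .
qed

lemma wiener_chi_square_tail:
  assumes F: "usual_filtration M Ft" and W: "cylindrical_wiener M Ft \<beta>" and d: "0 < d" and n: "1 \<le> n" and N: "1 \<le> N"
    and th: "0 < \<theta>" "\<theta> < 1 / 2"
  defines "D \<equiv> \<lambda>i k \<omega>. \<beta> i (real (Suc k) * d) \<omega> - \<beta> i (real k * d) \<omega>"
  shows "prob {\<omega> \<in> space M. c \<le> (\<Sum>i\<in>{1..n}. \<Sum>k<N. (D i k \<omega>)\<^sup>2 / d)}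
     \<le> (1 / sqrt (1 - 2 * \<theta>)) ^ (n * N) * exp (- \<theta> * c)" (is "prob ?A \<le> _")
    and "{\<omega> \<in> space M. c \<le> (\<Sum>i\<in>{1..n}. \<Sum>k<N. (D i k \<omega>)\<^sup>2 / d)} \<in> events"
proof -
  let ?I = "{1..n} \<times> {..<N}"
  define X where "X x = D (fst x) (snd x)" for x
  have iv: "indep_vars (\<lambda>_. borel) X ?I"
    using wiener_increments_indep[OF F W d n N] unfolding X_def D_def by (simp add: case_prod_unfold)
  have Xm[measurable]: "\<And>x. x \<in> ?I \<Longrightarrow> X x \<in> borel_measurable M" using iv unfolding indep_vars_def by auto
  have sumX: "(\<Sum>i\<in>{1..n}. \<Sum>k<N. (D i k \<omega>)\<^sup>2 / d) = (\<Sum>x\<in>?I. (X x \<omega>)\<^sup>2 / d)" for \<omega>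
    unfolding X_def by (simp add: sum.cartesian_product case_prod_unfold)
  have Sm: "(\<lambda>\<omega>. \<Sum>x\<in>?I. (X x \<omega>)\<^sup>2 / d) \<in> borel_measurable M" by measurable
  show "?A \<in> events" unfolding sumX using Sm by measurable
  define Z where "Z x \<omega> = exp (\<theta> * (X x \<omega>)\<^sup>2 / d)" for x \<omega>
  have ivZ: "indep_vars (\<lambda>_. borel) (\<lambda>x \<omega>. ennreal (Z x \<omega>)) ?I"
    unfolding Z_def by (rule indep_vars_compose2[OF iv, of "\<lambda>_ y. ennreal (exp (\<theta> * y\<^sup>2 / d))"]) measurable
  have Zi: "(\<integral>\<^sup>+\<omega>. ennreal (Z x \<omega>) \<partial>M) = ennreal (1 / sqrt (1 - 2 * \<theta>))" if "x \<in> ?I" for x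
    using gaussian_exp_square[OF wiener_increment_distributed[OF W d, of "fst x" "snd x"], of \<theta>] that d th
    unfolding Z_def X_def D_def by auto
  have "(\<integral>\<^sup>+\<omega>. (\<Prod>x\<in>?I. ennreal (Z x \<omega>)) \<partial>M) = (\<Prod>x\<in>?I. \<integral>\<^sup>+\<omega>. ennreal (Z x \<omega>) \<partial>M)"
    by (rule indep_vars_nn_integral[OF _ ivZ]) auto
  also have "\<dots> = (\<Prod>x\<in>?I. ennreal (1 / sqrt (1 - 2 * \<theta>)))" using Zi by (intro prod.cong) auto
  also have "\<dots> = ennreal ((1 / sqrt (1 - 2 * \<theta>)) ^ (n * N))"
    using th by (simp add: ennreal_power)
  finally have E: "(\<integral>\<^sup>+\<omega>. (\<Prod>x\<in>?I. ennreal (Z x \<omega>)) \<partial>M) = ennreal ((1 / sqrt (1 - 2 * \<theta>)) ^ (n * N))" .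
  have PZ: "(\<Prod>x\<in>?I. ennreal (Z x \<omega>)) = ennreal (exp (\<theta> * (\<Sum>x\<in>?I. (X x \<omega>)\<^sup>2 / d)))" for \<omega>
  proof -
    have "(\<Prod>x\<in>?I. ennreal (Z x \<omega>)) = ennreal (\<Prod>x\<in>?I. Z x \<omega>)" by (rule prod_ennreal) (simp add: Z_def)
    also have "(\<Prod>x\<in>?I. Z x \<omega>) = exp (\<Sum>x\<in>?I. \<theta> * (X x \<omega>)\<^sup>2 / d)"
      unfolding Z_def by (rule exp_sum[symmetric]) simp
    also have "(\<Sum>x\<in>?I. \<theta> * (X x \<omega>)\<^sup>2 / d) = \<theta> * (\<Sum>x\<in>?I. (X x \<omega>)\<^sup>2 / d)"
      by (simp add: sum_distrib_left)
    finally show ?thesis .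
  qed
  have "emeasure M ?A \<le> emeasure M {\<omega> \<in> space M. 1 \<le> ennreal (exp (- \<theta> * c)) * (\<Prod>x\<in>?I. ennreal (Z x \<omega>))}"
  proof (rule emeasure_mono)
    show "?A \<subseteq> {\<omega> \<in> space M. 1 \<le> ennreal (exp (- \<theta> * c)) * (\<Prod>x\<in>?I. ennreal (Z x \<omega>))}"
    proof safe
      fix \<omega> assume "c \<le> (\<Sum>i\<in>{1..n}. \<Sum>k<N. (D i k \<omega>)\<^sup>2 / d)"
      then have "\<theta> * c \<le> \<theta> * (\<Sum>x\<in>?I. (X x \<omega>)\<^sup>2 / d)" unfolding sumX using th by simp
      then have "1 \<le> exp (- \<theta> * c + \<theta> * (\<Sum>x\<in>?I. (X x \<omega>)\<^sup>2 / d))" by simp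
      then have "1 \<le> exp (- \<theta> * c) * exp (\<theta> * (\<Sum>x\<in>?I. (X x \<omega>)\<^sup>2 / d))" unfolding exp_add .
      then have "ennreal 1 \<le> ennreal (exp (- \<theta> * c) * exp (\<theta> * (\<Sum>x\<in>?I. (X x \<omega>)\<^sup>2 / d)))" by (rule ennreal_leI)
      then show "1 \<le> ennreal (exp (- \<theta> * c)) * (\<Prod>x\<in>?I. ennreal (Z x \<omega>))"
        unfolding PZ by (simp add: ennreal_mult)
    qed
    show "{\<omega> \<in> space M. 1 \<le> ennreal (exp (- \<theta> * c)) * (\<Prod>x\<in>?I. ennreal (Z x \<omega>))} \<in> events"
      unfolding PZ using Sm by measurable
  qed
  also have "\<dots> \<le> ennreal (exp (- \<theta> * c)) * ennreal ((1 / sqrt (1 - 2 * \<theta>)) ^ (n * N))"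
    unfolding E[symmetric] by (rule emeasure_one_le_Markov) (unfold PZ, use Sm in measurable)
  also have "\<dots> = ennreal ((1 / sqrt (1 - 2 * \<theta>)) ^ (n * N) * exp (- \<theta> * c))"
    using th by (simp add: ennreal_mult[symmetric] mult.commute)
  finally show "prob ?A \<le> (1 / sqrt (1 - 2 * \<theta>)) ^ (n * N) * exp (- \<theta> * c)"
    using th by (simp add: emeasure_eq_measure)
qed

lemma wiener_upper_bound:
  assumes F: "usual_filtration M Ft" and W: "cylindrical_wiener M Ft \<beta>" and n: "1 \<le> n" and T: "0 < T"
    and \<alpha>: "0 \<le> \<alpha>" and \<delta>: "0 < \<delta>" and \<gamma>: "0 < \<gamma>"
  shows "\<exists>\<epsilon>\<^sub>0>0. \<forall>\<epsilon>. 0 < \<epsilon> \<and> \<epsilon> \<le> \<epsilon>\<^sub>0 \<longrightarrow>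
    (\<exists>G\<in>events. prob G \<le> exp (- (\<alpha> - \<gamma>) / \<epsilon>\<^sup>2) \<and>
     (AE \<omega> in M. \<omega> \<notin> G \<longrightarrow> (\<exists>\<phi>. (\<forall>i\<in>{1..n}. L2_on T (\<phi> i)) \<and> (\<Sum>i\<in>{1..n}. energy T (\<phi> i)) \<le> 2 * \<alpha> \<and>
        (\<forall>i\<in>{1..n}. \<forall>t\<in>{0..T}. \<bar>\<epsilon> * \<beta> i t \<omega> - integral {0..t} (\<phi> i)\<bar> < \<delta>))))"
proof -
  define r where "r = \<delta> / 3"
  have r: "0 < r" using \<delta> by (simp add: r_def)
  obtain N d where N: "1 \<le> N" and d: "0 < d" "d \<le> r\<^sup>2 / (16 * (\<alpha> + 1))" and TN: "T = real N * d"
    using small_mesh[OF T, of "r\<^sup>2 / (16 * (\<alpha> + 1))"] r \<alpha> by auto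
  have rd: "\<alpha> \<le> r\<^sup>2 / (16 * d)"
  proof -
    have "d * (16 * (\<alpha> + 1)) \<le> r\<^sup>2" using d \<alpha> by (simp add: pos_le_divide_eq)
    then have "\<alpha> * (16 * d) \<le> r\<^sup>2" using d by (simp add: algebra_simps)
    then show ?thesis using d by (simp add: pos_le_divide_eq)
  qed
  define \<kappa> where "\<kappa> = min (1/2) (\<gamma> / (2 * (\<alpha> + 1)))"
  define \<theta> where "\<theta> = (1 - \<kappa>) / 2"
  have \<kappa>: "0 < \<kappa>" "\<kappa> \<le> 1/2" unfolding \<kappa>_def using \<gamma> \<alpha> by (simp, intro min.cobounded1)
  have th: "0 < \<theta>" "\<theta> < 1/2" unfolding \<theta>_def using \<kappa> by auto
  have \<kappa>\<alpha>: "\<kappa> * \<alpha> \<le> \<gamma> / 2"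
  proof -
    have "\<kappa> * \<alpha> \<le> \<gamma> / (2 * (\<alpha> + 1)) * \<alpha>" using \<alpha> by (intro mult_right_mono) (auto simp: \<kappa>_def)
    also have "\<dots> \<le> \<gamma> / 2" using \<alpha> \<gamma> by (simp add: field_simps)
    finally show ?thesis .
  qed
  have th\<alpha>: "\<alpha> - \<gamma> / 2 \<le> \<theta> * (2 * \<alpha>)" using \<kappa>\<alpha> unfolding \<theta>_def by (simp add: algebra_simps)
  define K where "K = (1 / sqrt (1 - 2 * \<theta>)) ^ (n * N) + real (n * N) * 4"
  have K: "0 < K" unfolding K_def using th by (intro add_pos_nonneg zero_less_power) auto
  obtain \<epsilon>\<^sub>0 where e0: "0 < \<epsilon>\<^sub>0" "\<And>\<epsilon>. 0 < \<epsilon> \<Longrightarrow> \<epsilon> \<le> \<epsilon>\<^sub>0 \<Longrightarrow> exp (- (\<gamma> / 2) / \<epsilon>\<^sup>2) \<le> inverse K"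
    using exp_neg_le_small[of "\<gamma> / 2" "inverse K"] \<gamma> K by auto
  show ?thesis
  proof (intro exI[of _ \<epsilon>\<^sub>0] conjI allI impI)
    show "0 < \<epsilon>\<^sub>0" by (rule e0(1))
    fix \<epsilon> :: real assume "0 < \<epsilon> \<and> \<epsilon> \<le> \<epsilon>\<^sub>0"
    then have e: "0 < \<epsilon>" "\<epsilon> \<le> \<epsilon>\<^sub>0" by auto
    let ?D = "\<lambda>i k \<omega>. \<beta> i (real (Suc k) * d) \<omega> - \<beta> i (real k * d) \<omega>"
    define A where "A = {\<omega> \<in> space M. 2 * \<alpha> / \<epsilon>\<^sup>2 \<le> (\<Sum>i\<in>{1..n}. \<Sum>k<N. (?D i k \<omega>)\<^sup>2 / d)}"
    have A: "A \<in> events" "prob A \<le> (1 / sqrt (1 - 2 * \<theta>)) ^ (n * N) * exp (- \<theta> * (2 * \<alpha> / \<epsilon>\<^sup>2))"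
      unfolding A_def
      by (rule wiener_chi_square_tail(2)[OF F W d(1) n N th], rule wiener_chi_square_tail(1)[OF F W d(1) n N th])
    obtain H where H: "H \<in> events" "prob H \<le> real (n * N) * (4 * exp (- (r / \<epsilon>)\<^sup>2 / (16 * d)))"
      "AE \<omega> in M. \<omega> \<notin> H \<longrightarrow> (\<forall>i\<in>{1..n}. \<forall>k<N. \<forall>t\<in>{real k * d..real (Suc k) * d}. \<bar>\<beta> i t \<omega> - \<beta> i (real k * d) \<omega>\<bar> \<le> r / \<epsilon>)"
      using wiener_oscillation[OF F W d(1), of "r / \<epsilon>" n N] r e by auto
    have ex1: "exp (- \<theta> * (2 * \<alpha> / \<epsilon>\<^sup>2)) \<le> exp (- (\<alpha> - \<gamma> / 2) / \<epsilon>\<^sup>2)"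
    proof -
      have "(\<alpha> - \<gamma> / 2) / \<epsilon>\<^sup>2 \<le> \<theta> * (2 * \<alpha>) / \<epsilon>\<^sup>2" using th\<alpha> by (rule divide_right_mono) simp
      moreover have "- (\<alpha> - \<gamma> / 2) / \<epsilon>\<^sup>2 = - ((\<alpha> - \<gamma> / 2) / \<epsilon>\<^sup>2)" "- \<theta> * (2 * \<alpha> / \<epsilon>\<^sup>2) = - (\<theta> * (2 * \<alpha>) / \<epsilon>\<^sup>2)"
        by (simp_all only: minus_divide_left times_divide_eq_right mult_minus_left)
      ultimately have "- \<theta> * (2 * \<alpha> / \<epsilon>\<^sup>2) \<le> - (\<alpha> - \<gamma> / 2) / \<epsilon>\<^sup>2" by linarith
      then show ?thesis by (simp only: exp_le_cancel_iff)
    qed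
    have ex2: "exp (- (r / \<epsilon>)\<^sup>2 / (16 * d)) \<le> exp (- (\<alpha> - \<gamma> / 2) / \<epsilon>\<^sup>2)"
    proof -
      have "(\<alpha> - \<gamma> / 2) / \<epsilon>\<^sup>2 \<le> (r\<^sup>2 / (16 * d)) / \<epsilon>\<^sup>2" using rd \<gamma> by (intro divide_right_mono) auto
      also have "\<dots> = (r / \<epsilon>)\<^sup>2 / (16 * d)" by (simp add: power_divide)
      finally show ?thesis by (simp only: minus_divide_left[symmetric] neg_le_iff_le exp_le_cancel_iff)
    qed
    have "prob (A \<union> H) \<le> prob A + prob H" using A H by (intro measure_Un_le) auto
    also have "\<dots> \<le> (1 / sqrt (1 - 2 * \<theta>)) ^ (n * N) * exp (- (\<alpha> - \<gamma> / 2) / \<epsilon>\<^sup>2)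
        + real (n * N) * (4 * exp (- (\<alpha> - \<gamma> / 2) / \<epsilon>\<^sup>2))"
      using th by (intro add_mono order_trans[OF A(2)] order_trans[OF H(2)] mult_left_mono ex1 ex2) auto
    also have "\<dots> = K * exp (- (\<alpha> - \<gamma> / 2) / \<epsilon>\<^sup>2)" unfolding K_def by (simp add: algebra_simps)
    also have "- (\<alpha> - \<gamma> / 2) / \<epsilon>\<^sup>2 = - (\<alpha> - \<gamma>) / \<epsilon>\<^sup>2 + (- (\<gamma> / 2) / \<epsilon>\<^sup>2)"
      unfolding add_divide_distrib[symmetric] by (intro arg_cong[where f = "\<lambda>x. x / \<epsilon>\<^sup>2"]) argo
    also have "K * exp (- (\<alpha> - \<gamma>) / \<epsilon>\<^sup>2 + (- (\<gamma> / 2) / \<epsilon>\<^sup>2)) = exp (- (\<alpha> - \<gamma>) / \<epsilon>\<^sup>2) * (K * exp (- (\<gamma> / 2) / \<epsilon>\<^sup>2))"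
      by (simp only: exp_add mult_ac)
    also have "\<dots> \<le> exp (- (\<alpha> - \<gamma>) / \<epsilon>\<^sup>2) * 1"
    proof (intro mult_left_mono)
      show "K * exp (- (\<gamma> / 2) / \<epsilon>\<^sup>2) \<le> 1" using mult_left_mono[OF e0(2)[OF e], of K] K by simp
    qed simp
    finally have P: "prob (A \<union> H) \<le> exp (- (\<alpha> - \<gamma>) / \<epsilon>\<^sup>2)" by simp
    have z: "AE \<omega> in M. \<forall>i\<in>{1..n}. \<beta> i 0 \<omega> = 0"
      using W unfolding cylindrical_wiener_def brownian_motion_def by (intro AE_finite_allI) auto
    have "AE \<omega> in M. \<omega> \<notin> A \<union> H \<longrightarrow> (\<exists>\<phi>. (\<forall>i\<in>{1..n}. L2_on T (\<phi> i)) \<and> (\<Sum>i\<in>{1..n}. energy T (\<phi> i)) \<le> 2 * \<alpha> \<and>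
        (\<forall>i\<in>{1..n}. \<forall>t\<in>{0..T}. \<bar>\<epsilon> * \<beta> i t \<omega> - integral {0..t} (\<phi> i)\<bar> < \<delta>))"
      using H(3) z AE_space
    proof eventually_elim
      case (elim \<omega>)
      show ?case
      proof
        assume w: "\<omega> \<notin> A \<union> H"
        define c where "c i k = \<epsilon> * ?D i k \<omega> / d" for i k
        define \<phi> where "\<phi> i s = c i (nat \<lfloor>s / d\<rfloor>)" for i s
        have L: "L2_on T (\<phi> i)" for i unfolding \<phi>_def TN by (rule step_function_L2_on(1)[OF d(1)])
        have En: "energy T (\<phi> i) = \<epsilon>\<^sup>2 * (\<Sum>k<N. (?D i k \<omega>)\<^sup>2 / d)" for i
        proof -
          have "energy T (\<phi> i) = d * (\<Sum>k<N. (c i k)\<^sup>2)"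
            unfolding \<phi>_def TN by (rule step_function_L2_on(2)[OF d(1)])
          also have "\<dots> = \<epsilon>\<^sup>2 * (\<Sum>k<N. (?D i k \<omega>)\<^sup>2 / d)"
            unfolding sum_distrib_left c_def using d by (intro sum.cong) (auto simp: power2_eq_square)
          finally show ?thesis .
        qed
        have "(\<Sum>i\<in>{1..n}. energy T (\<phi> i)) = \<epsilon>\<^sup>2 * (\<Sum>i\<in>{1..n}. \<Sum>k<N. (?D i k \<omega>)\<^sup>2 / d)"
          unfolding En by (simp add: sum_distrib_left)
        also have "\<dots> \<le> \<epsilon>\<^sup>2 * (2 * \<alpha> / \<epsilon>\<^sup>2)"
          using w elim(3) unfolding A_def by (intro mult_left_mono) auto
        also have "\<dots> = 2 * \<alpha>" using e by simp
        finally have E: "(\<Sum>i\<in>{1..n}. energy T (\<phi> i)) \<le> 2 * \<alpha>" .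
        have "\<bar>\<epsilon> * \<beta> i t \<omega> - integral {0..t} (\<phi> i)\<bar> < \<delta>" if i: "i \<in> {1..n}" and t: "t \<in> {0..T}" for i t
        proof -
          obtain k where k: "k < N" "real k * d \<le> t" "t \<le> real (Suc k) * d"
            using grid_cell[OF d(1) N] t TN by metis
          have osc: "\<bar>\<beta> i s \<omega> - \<beta> i (real k * d) \<omega>\<bar> \<le> r / \<epsilon>" if "s \<in> {real k * d..real (Suc k) * d}" for s
            using elim(1) w i k(1) that by blast
          have "integral {0..t} (\<phi> i) = d * (\<Sum>j<k. c i j) + (t - real k * d) * c i k"
            unfolding \<phi>_def by (rule integral_unique[OF step_function_has_integral[OF d(1) k(2,3)]])
          also have "d * (\<Sum>j<k. c i j) = \<epsilon> * (\<Sum>j<k. ?D i j \<omega>)"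
            unfolding c_def sum_distrib_left using d by simp
          also have "(\<Sum>j<k. ?D i j \<omega>) = \<beta> i (real k * d) \<omega> - \<beta> i (real 0 * d) \<omega>"
            by (rule sum_lessThan_telescope)
          also have "\<beta> i (real 0 * d) \<omega> = 0" using elim(2) i by simp
          finally have I: "integral {0..t} (\<phi> i) = \<epsilon> * \<beta> i (real k * d) \<omega> + (t - real k * d) * c i k" by simp
          have "\<bar>(t - real k * d) * c i k\<bar> \<le> \<epsilon> * \<bar>?D i k \<omega>\<bar>"
          proof -
            have "\<bar>(t - real k * d) * c i k\<bar> = ((t - real k * d) / d) * (\<epsilon> * \<bar>?D i k \<omega>\<bar>)"
              unfolding c_def using k d e by (simp add: abs_mult)
            also have "\<dots> \<le> 1 * (\<epsilon> * \<bar>?D i k \<omega>\<bar>)"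
              using k d e by (intro mult_right_mono) (auto simp: field_simps)
            finally show ?thesis by simp
          qed
          also have "\<dots> \<le> \<epsilon> * (r / \<epsilon>)" using osc[of "real (Suc k) * d"] k e by (intro mult_left_mono) auto
          also have "\<dots> = r" using e by simp
          finally have 1: "\<bar>(t - real k * d) * c i k\<bar> \<le> r" .
          have "\<bar>\<epsilon> * \<beta> i t \<omega> - \<epsilon> * \<beta> i (real k * d) \<omega>\<bar> = \<epsilon> * \<bar>\<beta> i t \<omega> - \<beta> i (real k * d) \<omega>\<bar>"
            using e by (simp add: abs_mult right_diff_distrib[symmetric])
          also have "\<dots> \<le> \<epsilon> * (r / \<epsilon>)" using osc[of t] k e by (intro mult_left_mono) auto
          also have "\<dots> = r" using e by simp
          finally have 2: "\<bar>\<epsilon> * \<beta> i t \<omega> - \<epsilon> * \<beta> i (real k * d) \<omega>\<bar> \<le> r" .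
          have "3 * r = \<delta>" by (simp add: r_def)
          then show ?thesis unfolding I using 1 2 r by linarith
        qed
        with L E show "\<exists>\<phi>. (\<forall>i\<in>{1..n}. L2_on T (\<phi> i)) \<and> (\<Sum>i\<in>{1..n}. energy T (\<phi> i)) \<le> 2 * \<alpha> \<and>
          (\<forall>i\<in>{1..n}. \<forall>t\<in>{0..T}. \<bar>\<epsilon> * \<beta> i t \<omega> - integral {0..t} (\<phi> i)\<bar> < \<delta>)" by blast
      qed
    qed
    with P A(1) H(1) show "\<exists>G\<in>events. prob G \<le> exp (- (\<alpha> - \<gamma>) / \<epsilon>\<^sup>2) \<and>
     (AE \<omega> in M. \<omega> \<notin> G \<longrightarrow> (\<exists>\<phi>. (\<forall>i\<in>{1..n}. L2_on T (\<phi> i)) \<and> (\<Sum>i\<in>{1..n}. energy T (\<phi> i)) \<le> 2 * \<alpha> \<and>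
        (\<forall>i\<in>{1..n}. \<forall>t\<in>{0..T}. \<bar>\<epsilon> * \<beta> i t \<omega> - integral {0..t} (\<phi> i)\<bar> < \<delta>)))"
      by (intro bexI[of _ "A \<union> H"]) auto
  qed
qed

end


lemma L2_on_increment_sum:
  assumes f: "L2_on (real N * d) f" and d: "0 < d"
  shows "(\<Sum>k<N. (integral {real k * d..real (Suc k) * d} f)\<^sup>2 / d) \<le> energy (real N * d) f"
proof -
  have T: "real k * d \<le> real N * d" if "k \<le> N" for k using that d by (intro mult_right_mono) auto
  have mono: "0 \<le> real k * d" "real k * d \<le> real (Suc k) * d" for k using d by (auto simp: mult_right_mono)
  have "(\<Sum>k<m. (integral {real k * d..real (Suc k) * d} f)\<^sup>2 / d) \<le> integral {0..real m * d} (\<lambda>t. (f t)\<^sup>2)" if "m \<le> N" for m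
    using that
  proof (induction m)
    case (Suc m)
    have le: "real (Suc m) * d \<le> real N * d" using T[of "Suc m"] Suc.prems by simp
    have "(integral {real m * d..real (Suc m) * d} f)\<^sup>2 \<le> (real (Suc m) * d - real m * d) * integral {real m * d..real (Suc m) * d} (\<lambda>t. (f t)\<^sup>2)"
      by (rule L2_on_Cauchy_Schwarz[OF f mono(1) mono(2) le])
    also have "real (Suc m) * d - real m * d = d" by (simp add: algebra_simps)
    finally have "(integral {real m * d..real (Suc m) * d} f)\<^sup>2 / d \<le> integral {real m * d..real (Suc m) * d} (\<lambda>t. (f t)\<^sup>2)"
      using d by (simp add: pos_divide_le_eq mult.commute)
    moreover have "integral {0..real m * d} (\<lambda>t. (f t)\<^sup>2) + integral {real m * d..real (Suc m) * d} (\<lambda>t. (f t)\<^sup>2)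
        = integral {0..real (Suc m) * d} (\<lambda>t. (f t)\<^sup>2)"
      by (rule Henstock_Kurzweil_Integration.integral_combine[OF mono(1) mono(2) L2_on_integrable_sub(2)[OF f order_refl le]])
    ultimately show ?case using Suc by simp
  qed simp
  from this[of N] show ?thesis by simp
qed

lemma L2_on_primitive_diff:
  assumes f: "L2_on T f" and st: "0 \<le> s" "s \<le> t" "t \<le> T" and E: "energy T f \<le> C"
  shows "\<bar>integral {0..t} f - integral {0..s} f\<bar> \<le> sqrt ((t - s) * C)"
proof -
  have "integral {0..t} f - integral {0..s} f = integral {s..t} f"
    using Henstock_Kurzweil_Integration.integral_combine[OF st(1,2) L2_on_integrable_sub(1)[OF f order_refl st(3)]] by simp
  moreover have "(integral {s..t} f)\<^sup>2 \<le> (t - s) * C"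
  proof -
    have "integral {s..t} (\<lambda>t. (f t)\<^sup>2) \<le> energy T f"
      using L2_on_integrable_sub(2)[OF f] st by (intro integral_subset_le) auto
    then have "(t - s) * integral {s..t} (\<lambda>t. (f t)\<^sup>2) \<le> (t - s) * C" using E st by (intro mult_left_mono) auto
    then show ?thesis using L2_on_Cauchy_Schwarz[OF f st] by linarith
  qed
  then have "sqrt ((integral {s..t} f)\<^sup>2) \<le> sqrt ((t - s) * C)" by (rule real_sqrt_le_mono)
  ultimately show ?thesis by simp
qed

context prob_space
begin

lemma wiener_lower_bound:
  assumes F: "usual_filtration M Ft" and W: "cylindrical_wiener M Ft \<beta>" and n: "1 \<le> n" and T: "0 < T"
    and \<alpha>: "0 \<le> \<alpha>" and \<delta>: "0 < \<delta>" and \<gamma>: "0 < \<gamma>"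
  shows "\<exists>\<epsilon>\<^sub>0>0. \<forall>\<epsilon> \<phi>. 0 < \<epsilon> \<and> \<epsilon> \<le> \<epsilon>\<^sub>0 \<and> (\<forall>i\<in>{1..n}. L2_on T (\<phi> i)) \<and>
    (\<Sum>i\<in>{1..n}. energy T (\<phi> i)) \<le> 2 * \<alpha> \<longrightarrow>
    (\<exists>G\<in>events. exp (- ((\<Sum>i\<in>{1..n}. energy T (\<phi> i)) / 2 + \<gamma>) / \<epsilon>\<^sup>2) \<le> prob G \<and>
     (AE \<omega> in M. \<omega> \<in> G \<longrightarrow> (\<forall>i\<in>{1..n}. \<forall>t\<in>{0..T}. \<bar>\<epsilon> * \<beta> i t \<omega> - integral {0..t} (\<phi> i)\<bar> < \<delta>)))"
proof -
  define r where "r = \<delta> / 4"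
  have r: "0 < r" using \<delta> by (simp add: r_def)
  have mp: "0 < r\<^sup>2 / (16 * (\<alpha> + 1))" using r \<alpha> by auto
  obtain N d where N: "1 \<le> N" and d: "0 < d" "d \<le> r\<^sup>2 / (16 * (\<alpha> + 1))" and TN: "T = real N * d"
    using small_mesh[OF T mp] by blast
  have d16: "d * (16 * (\<alpha> + 1)) \<le> r\<^sup>2" using d \<alpha> by (simp add: pos_le_divide_eq)
  have rd: "\<alpha> + 1 \<le> r\<^sup>2 / (16 * d)" using d16 d by (simp add: pos_le_divide_eq mult_ac)
  have d2: "d * (2 * \<alpha>) \<le> r\<^sup>2"
  proof -
    have "d * (2 * \<alpha>) \<le> d * (16 * (\<alpha> + 1))" using d \<alpha> by (intro mult_left_mono) auto
    then show ?thesis using d16 by linarith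
  qed
  define \<eta> where "\<eta> = r / real N"
  have \<eta>: "0 < \<eta>" using r N by (simp add: \<eta>_def)
  define q where "q = (1/2::real) ^ (n * N)"
  have q: "0 < q" by (simp add: q_def)
  define K where "K = real (n * N) * 4"
  have K: "0 < K" unfolding K_def using n N by simp
  obtain e1 where e1: "0 < e1" "\<And>\<epsilon>. 0 < \<epsilon> \<Longrightarrow> \<epsilon> \<le> e1 \<Longrightarrow> exp (- \<gamma> / \<epsilon>\<^sup>2) \<le> q / 2"
    using exp_neg_le_small[of \<gamma> "q / 2"] \<gamma> q by auto
  obtain e2 where e2: "0 < e2" "\<And>\<epsilon>. 0 < \<epsilon> \<Longrightarrow> \<epsilon> \<le> e2 \<Longrightarrow> exp (- 1 / \<epsilon>\<^sup>2) \<le> q / (2 * K)"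
    using exp_neg_le_small[of 1 "q / (2 * K)"] K q by auto
  define e3 where "e3 = \<eta> / (4 * sqrt d)"
  have e3: "0 < e3" using \<eta> d by (simp add: e3_def)
  define \<epsilon>\<^sub>0 where "\<epsilon>\<^sub>0 = min e1 (min e2 e3)"
  have e0: "0 < \<epsilon>\<^sub>0" unfolding \<epsilon>\<^sub>0_def using e1 e2 e3 by simp
  show ?thesis
  proof (intro exI[of _ \<epsilon>\<^sub>0] conjI allI impI)
    show "0 < \<epsilon>\<^sub>0" by (rule e0)
    fix \<epsilon> :: real and \<phi> :: "nat \<Rightarrow> real \<Rightarrow> real"
    assume a: "0 < \<epsilon> \<and> \<epsilon> \<le> \<epsilon>\<^sub>0 \<and> (\<forall>i\<in>{1..n}. L2_on T (\<phi> i)) \<and> (\<Sum>i\<in>{1..n}. energy T (\<phi> i)) \<le> 2 * \<alpha>"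
    then have e: "0 < \<epsilon>" "\<epsilon> \<le> \<epsilon>\<^sub>0" and L: "\<And>i. i \<in> {1..n} \<Longrightarrow> L2_on T (\<phi> i)"
      and En: "(\<Sum>i\<in>{1..n}. energy T (\<phi> i)) \<le> 2 * \<alpha>" by blast+
    define E where "E = (\<Sum>i\<in>{1..n}. energy T (\<phi> i)) / 2"
    have E\<alpha>: "E \<le> \<alpha>" unfolding E_def using En by simp
    have Ei: "energy T (\<phi> i) \<le> 2 * \<alpha>" if "i \<in> {1..n}" for i
      using member_le_sum[of i "{1..n}" "\<lambda>i. energy T (\<phi> i)"] that energy_nonneg En by fastforce
    let ?I = "{1..n} \<times> {..<N}"
    define h where "h i k = integral {real k * d..real (Suc k) * d} (\<phi> i)" for i k
    define X where "X x \<omega> = \<beta> (fst x) (real (Suc (snd x)) * d) \<omega> - \<beta> (fst x) (real (snd x) * d) \<omega>" for x :: "nat \<times> nat" and \<omega>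
    define B where "B x = {y. \<bar>y - h (fst x) (snd x) / \<epsilon>\<bar> < \<eta> / \<epsilon>}" for x :: "nat \<times> nat"
    have BB: "B x \<in> sets borel" for x unfolding B_def by measurable
    have iv: "indep_vars (\<lambda>_. borel) X ?I"
      using wiener_increments_indep[OF F W d(1) n N] unfolding X_def by (simp add: case_prod_unfold)
    define A where "A = (\<Inter>x\<in>?I. X x -` B x \<inter> space M)"
    have ne: "?I \<noteq> {}" using n N by (auto simp: lessThan_empty_iff)
    have PA: "prob A = (\<Prod>x\<in>?I. prob (X x -` B x \<inter> space M))"
      unfolding A_def by (rule indep_varsD_finite[OF iv ne]) (use BB in auto)
    have Xm: "X x \<in> borel_measurable M" if "x \<in> ?I" for x using iv that unfolding indep_vars_def by auto
    have Aev: "A \<in> events" unfolding A_def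
      using Xm BB ne by (intro sets.finite_INT) (auto intro: measurable_sets)
    have one: "exp (- (h (fst x) (snd x))\<^sup>2 / (2 * d) / \<epsilon>\<^sup>2) / 2 \<le> prob (X x -` B x \<inter> space M)" if x: "x \<in> ?I" for x
    proof -
      have D: "distributed M lborel (X x) (normal_density 0 (sqrt d))"
        unfolding X_def using x by (intro wiener_increment_distributed[OF W d(1)]) auto
      have "\<epsilon> \<le> e3" using e(2) unfolding \<epsilon>\<^sub>0_def by simp
      then have "\<epsilon> * (4 * sqrt d) \<le> \<eta>" unfolding e3_def using d by (simp add: pos_le_divide_eq)
      then have "4 * sqrt d \<le> \<eta> / \<epsilon>" using e by (simp add: pos_le_divide_eq mult.commute)
      then have "(4 * sqrt d)\<^sup>2 \<le> (\<eta> / \<epsilon>)\<^sup>2" using d by (intro power_mono) auto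
      then have "16 * (sqrt d)\<^sup>2 \<le> (\<eta> / \<epsilon>)\<^sup>2" by (simp add: power_mult_distrib)
      then have "exp (- (h (fst x) (snd x) / \<epsilon>)\<^sup>2 / (2 * (sqrt d)\<^sup>2)) / 2
          \<le> prob {\<omega> \<in> space M. \<bar>X x \<omega> - h (fst x) (snd x) / \<epsilon>\<bar> < \<eta> / \<epsilon>}"
        using \<eta> e d by (intro gaussian_shifted_ball[OF D]) auto
      moreover have "{\<omega> \<in> space M. \<bar>X x \<omega> - h (fst x) (snd x) / \<epsilon>\<bar> < \<eta> / \<epsilon>} = X x -` B x \<inter> space M"
        unfolding B_def by auto
      moreover have "- (h (fst x) (snd x) / \<epsilon>)\<^sup>2 / (2 * (sqrt d)\<^sup>2) = - (h (fst x) (snd x))\<^sup>2 / (2 * d) / \<epsilon>\<^sup>2"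
        using d by (simp add: power_divide)
      ultimately show ?thesis by simp
    qed
    have "q * exp (- E / \<epsilon>\<^sup>2) \<le> (\<Prod>x\<in>?I. exp (- (h (fst x) (snd x))\<^sup>2 / (2 * d) / \<epsilon>\<^sup>2) / 2)"
    proof -
      have "(\<Sum>x\<in>?I. (h (fst x) (snd x))\<^sup>2 / (2 * d)) = (\<Sum>i\<in>{1..n}. (\<Sum>k<N. (h i k)\<^sup>2 / d) / 2)"
        by (simp add: sum.cartesian_product case_prod_unfold sum_divide_distrib mult.commute)
      also have "\<dots> \<le> (\<Sum>i\<in>{1..n}. energy T (\<phi> i) / 2)"
        using L2_on_increment_sum[OF _ d(1), of N] L unfolding h_def TN by (intro sum_mono divide_right_mono) auto
      also have "\<dots> = E" unfolding E_def by (simp add: sum_divide_distrib)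
      finally have s: "(\<Sum>x\<in>?I. (h (fst x) (snd x))\<^sup>2 / (2 * d)) \<le> E" .
      have "(\<Prod>x\<in>?I. exp (- (h (fst x) (snd x))\<^sup>2 / (2 * d) / \<epsilon>\<^sup>2) / 2)
          = (\<Prod>x\<in>?I. exp (- (h (fst x) (snd x))\<^sup>2 / (2 * d) / \<epsilon>\<^sup>2)) * (\<Prod>x\<in>?I. 1/2)"
        unfolding prod.distrib[symmetric] by simp
      also have "(\<Prod>x\<in>?I. 1/2::real) = q" unfolding q_def by simp
      also have "(\<Prod>x\<in>?I. exp (- (h (fst x) (snd x))\<^sup>2 / (2 * d) / \<epsilon>\<^sup>2)) = exp (\<Sum>x\<in>?I. - (h (fst x) (snd x))\<^sup>2 / (2 * d) / \<epsilon>\<^sup>2)"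
        by (rule exp_sum[symmetric]) simp
      also have "(\<Sum>x\<in>?I. - (h (fst x) (snd x))\<^sup>2 / (2 * d) / \<epsilon>\<^sup>2) = - (\<Sum>x\<in>?I. (h (fst x) (snd x))\<^sup>2 / (2 * d)) / \<epsilon>\<^sup>2"
        by (simp add: sum_negf sum_divide_distrib)
      finally have eq: "(\<Prod>x\<in>?I. exp (- (h (fst x) (snd x))\<^sup>2 / (2 * d) / \<epsilon>\<^sup>2) / 2)
         = exp (- (\<Sum>x\<in>?I. (h (fst x) (snd x))\<^sup>2 / (2 * d)) / \<epsilon>\<^sup>2) * q" .
      have "- E / \<epsilon>\<^sup>2 \<le> - (\<Sum>x\<in>?I. (h (fst x) (snd x))\<^sup>2 / (2 * d)) / \<epsilon>\<^sup>2"
        using s by (intro divide_right_mono) auto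
      then show ?thesis unfolding eq using q by (simp add: mult.commute)
    qed
    also have "\<dots> \<le> prob A" unfolding PA using one by (intro prod_mono) auto
    finally have PA': "q * exp (- E / \<epsilon>\<^sup>2) \<le> prob A" .
    have re: "0 < r / \<epsilon>" using r e by simp
    obtain H where H: "H \<in> events" "prob H \<le> real (n * N) * (4 * exp (- (r / \<epsilon>)\<^sup>2 / (16 * d)))"
      "AE \<omega> in M. \<omega> \<notin> H \<longrightarrow> (\<forall>i\<in>{1..n}. \<forall>k<N. \<forall>t\<in>{real k * d..real (Suc k) * d}. \<bar>\<beta> i t \<omega> - \<beta> i (real k * d) \<omega>\<bar> \<le> r / \<epsilon>)"
      by (rule wiener_oscillation[OF F W d(1) re])
    have PH: "prob H \<le> (q / 2) * exp (- E / \<epsilon>\<^sup>2)"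
    proof -
      have "exp (- (r / \<epsilon>)\<^sup>2 / (16 * d)) \<le> exp (- E / \<epsilon>\<^sup>2 + - 1 / \<epsilon>\<^sup>2)"
      proof -
        have "(E + 1) / \<epsilon>\<^sup>2 \<le> (r\<^sup>2 / (16 * d)) / \<epsilon>\<^sup>2" using rd E\<alpha> by (intro divide_right_mono) auto
        also have "\<dots> = (r / \<epsilon>)\<^sup>2 / (16 * d)" by (simp add: power_divide)
        finally have "- (r / \<epsilon>)\<^sup>2 / (16 * d) \<le> - E / \<epsilon>\<^sup>2 + - 1 / \<epsilon>\<^sup>2" by (simp add: add_divide_distrib)
        then show ?thesis by (simp only: exp_le_cancel_iff)
      qed
      also have "\<dots> = exp (- E / \<epsilon>\<^sup>2) * exp (- 1 / \<epsilon>\<^sup>2)" by (rule exp_add)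
      also have "\<dots> \<le> exp (- E / \<epsilon>\<^sup>2) * (q / (2 * K))"
        using e2(2)[of \<epsilon>] e unfolding \<epsilon>\<^sub>0_def by (intro mult_left_mono) auto
      finally have "K * exp (- (r / \<epsilon>)\<^sup>2 / (16 * d)) \<le> K * (exp (- E / \<epsilon>\<^sup>2) * (q / (2 * K)))"
        using K by (intro mult_left_mono) auto
      also have "\<dots> = (q / 2) * exp (- E / \<epsilon>\<^sup>2)" using K by simp
      finally show ?thesis using H(2) unfolding K_def by simp
    qed
    have "exp (- (E + \<gamma>) / \<epsilon>\<^sup>2) = exp (- E / \<epsilon>\<^sup>2) * exp (- \<gamma> / \<epsilon>\<^sup>2)"
      unfolding exp_add[symmetric] by (simp add: add_divide_distrib diff_divide_distrib)
    also have "\<dots> \<le> exp (- E / \<epsilon>\<^sup>2) * (q / 2)"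
      using e1(2)[of \<epsilon>] e unfolding \<epsilon>\<^sub>0_def by (intro mult_left_mono) auto
    also have "\<dots> \<le> prob A - prob H" using PA' PH by (simp add: algebra_simps)
    also have "\<dots> \<le> prob (A - H)"
    proof -
      have "prob A \<le> prob ((A - H) \<union> H)" using Aev H(1) by (intro finite_measure_mono) auto
      also have "\<dots> \<le> prob (A - H) + prob H" using Aev H(1) by (intro measure_Un_le) auto
      finally show ?thesis by simp
    qed
    finally have P: "exp (- (E + \<gamma>) / \<epsilon>\<^sup>2) \<le> prob (A - H)" .
    have z: "AE \<omega> in M. \<forall>i\<in>{1..n}. \<beta> i 0 \<omega> = 0"
      using W unfolding cylindrical_wiener_def brownian_motion_def by (intro AE_finite_allI) auto
    have "AE \<omega> in M. \<omega> \<in> A - H \<longrightarrow> (\<forall>i\<in>{1..n}. \<forall>t\<in>{0..T}. \<bar>\<epsilon> * \<beta> i t \<omega> - integral {0..t} (\<phi> i)\<bar> < \<delta>)"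
      using H(3) z
    proof eventually_elim
      case (elim \<omega>)
      show ?case
      proof (intro impI ballI)
        fix i t assume w: "\<omega> \<in> A - H" and i: "i \<in> {1..n}" and t: "t \<in> {0..T}"
        obtain k where k: "k < N" "real k * d \<le> t" "t \<le> real (Suc k) * d"
          using grid_cell[OF d(1) N] t TN by blast
        let ?b = "\<lambda>k. \<epsilon> * \<beta> i (real k * d) \<omega>" and ?h = "\<lambda>k. integral {0..real k * d} (\<phi> i)"
        have osc: "\<bar>\<beta> i t \<omega> - \<beta> i (real k * d) \<omega>\<bar> \<le> r / \<epsilon>"
          using elim(1) w i k by auto
        have "\<bar>\<epsilon> * \<beta> i t \<omega> - ?b k\<bar> = \<epsilon> * \<bar>\<beta> i t \<omega> - \<beta> i (real k * d) \<omega>\<bar>"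
          using e by (simp add: abs_mult right_diff_distrib[symmetric])
        also have "\<dots> \<le> \<epsilon> * (r / \<epsilon>)" using osc e by (intro mult_left_mono) auto
        also have "\<dots> = r" using e by simp
        finally have 1: "\<bar>\<epsilon> * \<beta> i t \<omega> - ?b k\<bar> \<le> r" .
        have t0: "0 \<le> real j * d" for j using d by simp
        have TT: "real j * d \<le> T" if "j \<le> N" for j unfolding TN using that d by (intro mult_right_mono) auto
        have inc: "\<bar>(?b (Suc j) - ?h (Suc j)) - (?b j - ?h j)\<bar> \<le> \<eta>" if j: "j < N" for j
        proof -
          have "?h j + h i j = ?h (Suc j)" unfolding h_def
            using d TT[of "Suc j"] j by (intro Henstock_Kurzweil_Integration.integral_combine
              L2_on_integrable_sub(1)[OF L[OF i]]) (auto simp: mult_right_mono)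
          moreover have "\<omega> \<in> X (i, j) -` B (i, j) \<inter> space M" using w i j unfolding A_def by blast
          then have "\<bar>X (i, j) \<omega> - h i j / \<epsilon>\<bar> < \<eta> / \<epsilon>" unfolding B_def by simp
          then have "\<epsilon> * \<bar>X (i, j) \<omega> - h i j / \<epsilon>\<bar> \<le> \<epsilon> * (\<eta> / \<epsilon>)" using e by (intro mult_left_mono) auto
          then have "\<bar>\<epsilon> * (X (i, j) \<omega> - h i j / \<epsilon>)\<bar> \<le> \<eta>" using e by (simp add: abs_mult)
          moreover have "\<epsilon> * (X (i, j) \<omega> - h i j / \<epsilon>) = ?b (Suc j) - ?b j - h i j"
            unfolding X_def fst_conv snd_conv using e by (simp add: right_diff_distrib)
          ultimately show ?thesis by linarith
        qed
        have "\<bar>?b j - ?h j\<bar> \<le> real j * \<eta>" if "j \<le> N" for j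
          using that
        proof (induction j)
          case 0
          then show ?case using elim(2) i by simp
        next
          case (Suc j)
          then have "\<bar>?b j - ?h j\<bar> \<le> real j * \<eta>" "\<bar>(?b (Suc j) - ?h (Suc j)) - (?b j - ?h j)\<bar> \<le> \<eta>"
            using inc[of j] by auto
          moreover have "real (Suc j) * \<eta> = real j * \<eta> + \<eta>" by (simp add: algebra_simps)
          ultimately show ?case by linarith
        qed
        from this[of k] have "\<bar>?b k - ?h k\<bar> \<le> real k * \<eta>" using k by simp
        also have "\<dots> \<le> real N * \<eta>" using k \<eta> by (intro mult_right_mono) auto
        also have "\<dots> = r" unfolding \<eta>_def using N by simp
        finally have 2: "\<bar>?b k - ?h k\<bar> \<le> r" .
        have "\<bar>integral {0..t} (\<phi> i) - ?h k\<bar> \<le> sqrt ((t - real k * d) * (2 * \<alpha>))"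
          using t k t0 by (intro L2_on_primitive_diff[OF L[OF i] _ _ _ Ei[OF i]]) auto
        also have "\<dots> \<le> sqrt (r\<^sup>2)"
        proof (rule real_sqrt_le_mono)
          have "(t - real k * d) * (2 * \<alpha>) \<le> d * (2 * \<alpha>)"
            using k \<alpha> by (intro mult_right_mono) (auto simp: algebra_simps)
          then show "(t - real k * d) * (2 * \<alpha>) \<le> r\<^sup>2" using d2 by linarith
        qed
        also have "\<dots> = r" using r by simp
        finally have 3: "\<bar>integral {0..t} (\<phi> i) - ?h k\<bar> \<le> r" .
        have "4 * r = \<delta>" by (simp add: r_def)
        then show "\<bar>\<epsilon> * \<beta> i t \<omega> - integral {0..t} (\<phi> i)\<bar> < \<delta>" using 1 2 3 r by linarith
      qed
    qed
    with P Aev H(1) show "\<exists>G\<in>events. exp (- ((\<Sum>i\<in>{1..n}. energy T (\<phi> i)) / 2 + \<gamma>) / \<epsilon>\<^sup>2) \<le> prob G \<and>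
     (AE \<omega> in M. \<omega> \<in> G \<longrightarrow> (\<forall>i\<in>{1..n}. \<forall>t\<in>{0..T}. \<bar>\<epsilon> * \<beta> i t \<omega> - integral {0..t} (\<phi> i)\<bar> < \<delta>))"
      unfolding E_def[symmetric] by (intro bexI[of _ "A - H"] conjI) auto
  qed
qed

end

section \<open>The eigenbasis of the Dirichlet Laplacian\<close>


lemma continuous_M01_integral:
  fixes f :: "real \<Rightarrow> real"
  assumes "continuous_on UNIV f"
  shows "integrable M01 f" "(\<integral>x. f x \<partial>M01) = integral {0..1} f"
proof -
  have "f absolutely_integrable_on {0..1}"
    using assms by (intro absolutely_integrable_continuous_real) (auto intro: continuous_on_subset)
  then have "f absolutely_integrable_on {0<..<1}" by (rule set_integrable_subset) auto
  then show i: "integrable M01 f" by (simp add: integrable_restrict_space set_integrable_def)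
  show "(\<integral>x. f x \<partial>M01) = integral {0..1} f"
    using lebesgue_integral_eq_integral[OF i] integral_open_interval_real[of 0 1 f] by simp
qed

lemma continuous_sq_int:
  assumes "continuous_on UNIV f"
  shows "sq_int f"
  unfolding sq_int_def
proof
  show "integrable M01 (\<lambda>x. (f x)\<^sup>2)"
    using assms by (intro continuous_M01_integral continuous_intros)
  show "f \<in> borel_measurable M01" using continuous_M01_integral(1)[OF assms] by (rule borel_measurable_integrable)
qed

lemma l2_rel_refl: "l2_rel f f \<longleftrightarrow> sq_int f"
  by (simp add: l2_rel_def)

lemma inner_L2_of:
  assumes "sq_int f" "sq_int g"
  shows "inner (L2_of f) (L2_of g) = (\<integral>x. f x * g x \<partial>M01)"
  using assms by (simp add: inner_L2.abs_eq l2_rel_refl)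

lemma inner_L2_of_continuous:
  assumes "continuous_on UNIV f" "continuous_on UNIV g"
  shows "inner (L2_of f) (L2_of g) = integral {0..1} (\<lambda>x. f x * g x)"
proof -
  have "continuous_on UNIV (\<lambda>x. f x * g x)" using assms by (intro continuous_intros)
  then show ?thesis
    using inner_L2_of[of f g] continuous_M01_integral(2)[of "\<lambda>x. f x * g x"] assms by (simp add: continuous_sq_int)
qed

lemma test_funD:
  assumes "test_fun \<phi>"
  shows "(\<phi> has_field_derivative deriv \<phi> x) (at x)" "continuous_on UNIV (deriv \<phi>)" "continuous_on UNIV \<phi>"
    "\<phi> 0 = 0" "\<phi> 1 = 0"
proof -
  have d: "\<phi> differentiable_on UNIV" using assms by (simp add: test_fun_def)
  then have "\<phi> differentiable (at x)" for x unfolding differentiable_on_def by simp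
  then show *: "(\<phi> has_field_derivative deriv \<phi> x) (at x)" for x
    by (simp add: real_differentiable_def[of \<phi>] DERIV_deriv_iff_real_differentiable)
  show "continuous_on UNIV (deriv \<phi>)" using assms by (simp add: test_fun_def)
  show "continuous_on UNIV \<phi>" using d by (rule differentiable_imp_continuous_on)
  obtain a b where "0 < a" "b < 1" "\<forall>x. x \<notin> {a..b} \<longrightarrow> \<phi> x = 0" using assms by (auto simp: test_fun_def)
  then show "\<phi> 0 = 0" "\<phi> 1 = 0" by auto
qed

lemma has_weak_deriv_C1:
  assumes f: "\<And>x. (f has_field_derivative f' x) (at x)" and f': "continuous_on UNIV f'"
  shows "has_weak_deriv (L2_of f) (L2_of f')"
  unfolding has_weak_deriv_def
proof (intro allI impI)
  fix \<phi> assume t: "test_fun \<phi>"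
  note T = test_funD[OF t]
  have fc: "continuous_on UNIV f"
    by (rule DERIV_continuous_on[of UNIV f f']) (simp add: f)
  have "((\<lambda>x. f x * deriv \<phi> x + f' x * \<phi> x) has_integral (f 1 * \<phi> 1 - f 0 * \<phi> 0)) {0..1}"
  proof (rule fundamental_theorem_of_calculus)
    fix x :: real
    have "((\<lambda>x. f x * \<phi> x) has_field_derivative (f x * deriv \<phi> x + f' x * \<phi> x)) (at x)"
      using DERIV_mult[OF f T(1)] by (simp add: add.commute mult.commute)
    then show "((\<lambda>x. f x * \<phi> x) has_vector_derivative (f x * deriv \<phi> x + f' x * \<phi> x)) (at x within {0..1})"
      unfolding has_real_derivative_iff_has_vector_derivative by (rule has_vector_derivative_at_within)
  qed simp
  then have "integral {0..1} (\<lambda>x. f x * deriv \<phi> x + f' x * \<phi> x) = 0" using T by (simp add: integral_unique)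
  moreover have "integral {0..1} (\<lambda>x. f x * deriv \<phi> x + f' x * \<phi> x)
      = integral {0..1} (\<lambda>x. f x * deriv \<phi> x) + integral {0..1} (\<lambda>x. f' x * \<phi> x)"
  proof (rule Henstock_Kurzweil_Integration.integral_add)
    have "continuous_on UNIV (\<lambda>x. f x * deriv \<phi> x)" "continuous_on UNIV (\<lambda>x. f' x * \<phi> x)"
      by (rule continuous_on_mult[OF fc T(2)], rule continuous_on_mult[OF f' T(3)])
    then show "(\<lambda>x. f x * deriv \<phi> x) integrable_on {0..1}" "(\<lambda>x. f' x * \<phi> x) integrable_on {0..1}"
      by (auto intro: integrable_continuous_real continuous_on_subset)
  qed
  ultimately show "inner (L2_of f) (L2_of (deriv \<phi>)) = - inner (L2_of f') (L2_of \<phi>)"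
    using inner_L2_of_continuous[OF fc T(2)] inner_L2_of_continuous[OF f' T(3)] by simp
qed

lemma max_0_square_deriv:
  "((\<lambda>y::real. (max 0 y)\<^sup>2) has_field_derivative 2 * max 0 y) (at y)"
  unfolding has_field_derivative_iff
proof (rule LIM_zero_cancel, rule Lim_null_comparison)
  have key: "\<bar>(max 0 z)\<^sup>2 - (max 0 y)\<^sup>2 - 2 * max 0 y * (z - y)\<bar> \<le> (z - y)\<^sup>2" for z :: real
  proof -
    consider "0 \<le> y" "0 \<le> z" | "0 \<le> y" "z < 0" | "y < 0" "0 \<le> z" | "y < 0" "z < 0" by linarith
    then show ?thesis
    proof cases
      case 1
      then have "(max 0 z)\<^sup>2 - (max 0 y)\<^sup>2 - 2 * max 0 y * (z - y) = (z - y)\<^sup>2"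
        by (simp add: power2_eq_square algebra_simps)
      then show ?thesis by simp
    next
      case 2
      have "y * z \<le> 0" using 2 by (simp add: mult_nonneg_nonpos)
      moreover have "(max 0 z)\<^sup>2 - (max 0 y)\<^sup>2 - 2 * max 0 y * (z - y) = y\<^sup>2 - 2 * (y * z)"
        using 2 by (simp add: power2_eq_square algebra_simps)
      moreover have "(z - y)\<^sup>2 = z\<^sup>2 + y\<^sup>2 - 2 * (y * z)" by (simp add: power2_eq_square algebra_simps)
      moreover have "0 \<le> y\<^sup>2" "0 \<le> z\<^sup>2" by simp_all
      ultimately show ?thesis by linarith
    next
      case 3
      then have "z\<^sup>2 \<le> (z - y)\<^sup>2" by (intro power_mono) auto
      then show ?thesis using 3 by simp
    next
      case 4
      then show ?thesis by simp
    qed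
  qed
  have "norm (((max 0 z)\<^sup>2 - (max 0 y)\<^sup>2) / (z - y) - 2 * max 0 y) \<le> \<bar>z - y\<bar>" if "z \<noteq> y" for z
  proof -
    have "((max 0 z)\<^sup>2 - (max 0 y)\<^sup>2) / (z - y) - 2 * max 0 y = ((max 0 z)\<^sup>2 - (max 0 y)\<^sup>2 - 2 * max 0 y * (z - y)) / (z - y)"
      using that by (simp add: diff_divide_distrib)
    then have "norm (((max 0 z)\<^sup>2 - (max 0 y)\<^sup>2) / (z - y) - 2 * max 0 y)
        = \<bar>(max 0 z)\<^sup>2 - (max 0 y)\<^sup>2 - 2 * max 0 y * (z - y)\<bar> / \<bar>z - y\<bar>"
      by (simp add: abs_divide)
    also have "\<dots> \<le> (z - y)\<^sup>2 / \<bar>z - y\<bar>" using key by (intro divide_right_mono) auto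
    also have "(z - y)\<^sup>2 / \<bar>z - y\<bar> = \<bar>z - y\<bar>\<^sup>2 / \<bar>z - y\<bar>" by simp
    also have "\<dots> = \<bar>z - y\<bar>" unfolding power2_eq_square using that by (simp del: abs_mult_self_eq)
    finally show ?thesis .
  qed
  then show "\<forall>\<^sub>F z in at y. norm (((max 0 z)\<^sup>2 - (max 0 y)\<^sup>2) / (z - y) - 2 * max 0 y) \<le> \<bar>z - y\<bar>"
    by (auto simp: eventually_at_filter)
  show "((\<lambda>z. \<bar>z - y\<bar>) \<longlongrightarrow> 0) (at y)"
    by (rule tendsto_eq_intros refl | simp)+
qed

definition bump :: "real \<Rightarrow> real \<Rightarrow> real \<Rightarrow> real" where
  "bump a b x = (max 0 (x - a))\<^sup>2 * (max 0 (b - x))\<^sup>2"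

definition cutoff :: "real \<Rightarrow> nat \<Rightarrow> real \<Rightarrow> real" where
  "cutoff a k x = 1 - 1 / (1 + real k * bump (a + 1 / real (Suc k)) (1 - 1 / real (Suc k)) x)"

lemma bump_nonneg: "0 \<le> bump a b x"
  by (simp add: bump_def)

lemma test_fun_cutoff:
  assumes a: "0 \<le> a"
  shows "test_fun (cutoff a k)"
proof -
  define l r where "l = a + 1 / real (Suc k)" and "r = 1 - 1 / real (Suc k)"
  define b' where "b' x = (2 * max 0 (x - l)) * (max 0 (r - x))\<^sup>2 - (max 0 (x - l))\<^sup>2 * (2 * max 0 (r - x))" for x
  have bd: "(bump l r has_field_derivative b' x) (at x)" for x
  proof -
    have 1: "((\<lambda>x. (max 0 (x - l))\<^sup>2) has_field_derivative 2 * max 0 (x - l)) (at x)"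
    proof -
      have "((\<lambda>x. x - l) has_field_derivative 1) (at x)" by (auto intro!: derivative_eq_intros)
      from DERIV_chain2[OF max_0_square_deriv this] show ?thesis by simp
    qed
    have 2: "((\<lambda>x. (max 0 (r - x))\<^sup>2) has_field_derivative - (2 * max 0 (r - x))) (at x)"
    proof -
      have "((\<lambda>x. r - x) has_field_derivative - 1) (at x)" by (auto intro!: derivative_eq_intros)
      from DERIV_chain2[OF max_0_square_deriv this] show ?thesis by simp
    qed
    show ?thesis
      using DERIV_mult[OF 1 2] unfolding bump_def[abs_def] b'_def by (simp add: algebra_simps)
  qed
  have pos: "0 < 1 + real k * bump l r x" for x using bump_nonneg[of l r x] by (simp add: add_pos_nonneg)
  define c' where "c' x = real k * b' x / (1 + real k * bump l r x)\<^sup>2" for x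
  have cd: "(cutoff a k has_field_derivative c' x) (at x)" for x
    unfolding cutoff_def[abs_def] l_def[symmetric] r_def[symmetric] c'_def
    using pos[of x] by (auto intro!: derivative_eq_intros bd simp: power2_eq_square)
  have b'c: "continuous_on UNIV b'" unfolding b'_def by (intro continuous_intros)
  have bc: "continuous_on UNIV (bump l r)" unfolding bump_def[abs_def] by (intro continuous_intros)
  have "continuous_on UNIV c'" unfolding c'_def[abs_def]
    using pos by (intro continuous_intros b'c bc) (auto simp: less_imp_neq[OF pos, symmetric])
  moreover have "deriv (cutoff a k) = c'" using cd by (intro ext DERIV_imp_deriv)
  moreover have "cutoff a k differentiable_on UNIV"
    using cd unfolding differentiable_on_def by (auto simp: real_differentiable_def intro: field_differentiable_imp_differentiable)
  moreover have "cutoff a k x = 0" if "x \<notin> {l..r}" for x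
  proof -
    have "bump l r x = 0" using that unfolding bump_def by auto
    then show ?thesis unfolding cutoff_def l_def[symmetric] r_def[symmetric] by simp
  qed
  moreover have "0 < l" "r < 1" unfolding l_def r_def using a by (auto intro: add_nonneg_pos)
  ultimately show ?thesis unfolding test_fun_def by (metis (no_types))
qed

lemma cutoff_bounds: "0 \<le> cutoff a k x" "cutoff a k x \<le> 1"
proof -
  have "1 \<le> 1 + real k * bump (a + 1 / real (Suc k)) (1 - 1 / real (Suc k)) x" using bump_nonneg by simp
  moreover have "0 \<le> 1 - 1 / d" "1 - 1 / d \<le> 1" if "1 \<le> d" for d :: real using that by auto
  ultimately show "0 \<le> cutoff a k x" "cutoff a k x \<le> 1" unfolding cutoff_def by blast+
qed

lemma cutoff_tendsto: "(\<lambda>k. cutoff a k x) \<longlonglongrightarrow> indicator {a<..<1} x"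
proof (cases "x \<in> {a<..<1}")
  case True
  have lim0: "(\<lambda>k. 1 / real (Suc k)) \<longlonglongrightarrow> 0"
    using LIMSEQ_inverse_real_of_nat by (simp add: inverse_eq_divide)
  have "(\<lambda>k. bump (a + 1 / real (Suc k)) (1 - 1 / real (Suc k)) x) \<longlonglongrightarrow> bump (a + 0) (1 - 0) x"
    unfolding bump_def by (intro tendsto_intros lim0)
  moreover have "0 < bump (a + 0) (1 - 0) x" using True unfolding bump_def by simp
  ultimately have "filterlim (\<lambda>k. bump (a + 1 / real (Suc k)) (1 - 1 / real (Suc k)) x * real k) at_top sequentially"
    using filterlim_tendsto_pos_mult_at_top filterlim_real_sequentially by blast
  then have "filterlim (\<lambda>k. 1 + real k * bump (a + 1 / real (Suc k)) (1 - 1 / real (Suc k)) x) at_top sequentially"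
    by (intro filterlim_tendsto_add_at_top[OF tendsto_const]) (simp add: mult.commute)
  then have "(\<lambda>k. 1 - 1 / (1 + real k * bump (a + 1 / real (Suc k)) (1 - 1 / real (Suc k)) x)) \<longlonglongrightarrow> 1 - 0"
    by (intro tendsto_diff tendsto_const tendsto_divide_0[OF tendsto_const] filterlim_at_top_imp_at_infinity)
  then show ?thesis using True unfolding cutoff_def by simp
next
  case False
  have "cutoff a k x = 0" for k
  proof -
    have "x \<le> a + 1 / real (Suc k) \<or> 1 - 1 / real (Suc k) \<le> x"
    proof (cases "x \<le> a")
      case True
      then show ?thesis by (simp add: add_increasing2)
    next
      case F: False
      then have "1 \<le> x" using False by simp
      moreover have "0 \<le> 1 / real (Suc k)" by simp
      ultimately show ?thesis by linarith
    qed
    then have "bump (a + 1 / real (Suc k)) (1 - 1 / real (Suc k)) x = 0" unfolding bump_def by auto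
    then show ?thesis unfolding cutoff_def by simp
  qed
  then show ?thesis using False by simp
qed

lemma sq_int_integrable:
  assumes "sq_int f" shows "integrable M01 f"
proof -
  have "sq_int (\<lambda>_. 1)" by (intro continuous_sq_int continuous_intros)
  from sq_int_mult[OF assms this] show ?thesis by simp
qed

lemma AE_zero_if_tail_integrals_zero:
  fixes f :: "real \<Rightarrow> real"
  assumes f: "integrable lebesgue f" and z: "\<And>a. (\<integral>x. f x * indicator {a<..} x \<partial>lebesgue) = 0"
  shows "AE x in lebesgue. f x = 0"
proof -
  obtain g where g: "g \<in> borel_measurable lborel" "AE x in lborel. f x = g x"
    using completion_ex_borel_measurable_real[of f lborel] f by auto
  have fg: "AE x in lebesgue. f x = g x" using g(2) by (rule AE_completion)
  have gi: "integrable lborel g"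
  proof -
    have "integrable lebesgue g \<longleftrightarrow> integrable lebesgue f"
      using fg g(1) f by (intro integrable_cong_AE) (auto intro: measurable_completion)
    then show ?thesis using f g(1) by (simp add: integrable_completion)
  qed
  have gz: "(\<integral>x. g x * indicator {a<..} x \<partial>lborel) = 0" for a
  proof -
    have gm: "(\<lambda>x. g x * indicator {a<..} x) \<in> borel_measurable lborel" using g(1) by measurable
    have "(\<integral>x. g x * indicator {a<..} x \<partial>lborel) = (\<integral>x. g x * indicator {a<..} x \<partial>lebesgue)"
      using gm by (simp add: integral_completion)
    also have "\<dots> = (\<integral>x. f x * indicator {a<..} x \<partial>lebesgue)"
    proof (rule integral_cong_AE)
      show "(\<lambda>x. g x * indicator {a<..} x) \<in> borel_measurable lebesgue" using gm by (rule measurable_completion)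
      have "(\<lambda>x. indicator {a<..} x :: real) \<in> borel_measurable lborel" by simp
      then have "(\<lambda>x. indicator {a<..} x :: real) \<in> borel_measurable lebesgue" by (rule measurable_completion)
      then show "(\<lambda>x. f x * indicator {a<..} x) \<in> borel_measurable lebesgue"
        using f by (intro borel_measurable_times) auto
      show "AE x in lebesgue. g x * indicator {a<..} x = f x * indicator {a<..} x"
        using fg by eventually_elim simp
    qed
    finally show ?thesis using z by simp
  qed
  have eq: "(\<integral>\<^sup>+x. ennreal (g x) * indicator {a<..} x \<partial>lborel) = (\<integral>\<^sup>+x. ennreal (- g x) * indicator {a<..} x \<partial>lborel)
      \<and> (\<integral>\<^sup>+x. ennreal (g x) * indicator {a<..} x \<partial>lborel) < \<infinity>" for a
  proof -
    have "integrable lborel (\<lambda>x. g x * indicator {a<..} x)"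
      using integrable_mult_indicator[OF _ gi, of "{a<..}"] by (simp add: mult.commute)
    then obtain r q where rq: "0 \<le> r" "0 \<le> q" "(\<integral>\<^sup>+x. ennreal (g x * indicator {a<..} x) \<partial>lborel) = ennreal r"
      "(\<integral>\<^sup>+x. ennreal (- (g x * indicator {a<..} x)) \<partial>lborel) = ennreal q"
      "(\<integral>x. g x * indicator {a<..} x \<partial>lborel) = r - q"
      by (rule integrableE)
    have "(\<lambda>x. ennreal (g x * indicator {a<..} x)) = (\<lambda>x. ennreal (g x) * indicator {a<..} x)"
      "(\<lambda>x. ennreal (- (g x * indicator {a<..} x))) = (\<lambda>x. ennreal (- g x) * indicator {a<..} x)"
      by (auto simp: indicator_def)
    then show ?thesis using rq gz[of a] by simp
  qed
  have "density lborel (\<lambda>x. ennreal (g x)) = density lborel (\<lambda>x. ennreal (- g x))"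
  proof (rule measure_eqI_lessThan)
    fix a
    have p: "emeasure (density lborel (\<lambda>x. ennreal (h x))) {a<..} = (\<integral>\<^sup>+x. ennreal (h x) * indicator {a<..} x \<partial>lborel)"
      if "h \<in> borel_measurable borel" for h :: "real \<Rightarrow> real"
      using that by (intro emeasure_density) auto
    have gb: "g \<in> borel_measurable borel" "(\<lambda>x. - g x) \<in> borel_measurable borel" using g(1) by auto
    show "emeasure (density lborel (\<lambda>x. ennreal (g x))) {a<..} < \<infinity>"
      unfolding p[OF gb(1)] using eq by blast
    show "emeasure (density lborel (\<lambda>x. ennreal (g x))) {a<..} = emeasure (density lborel (\<lambda>x. ennreal (- g x))) {a<..}"
      unfolding p[OF gb(1)] p[OF gb(2)] using eq by blast
  qed auto
  then have "AE x in lborel. ennreal (g x) = ennreal (- g x)"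
    using g(1) by (intro sigma_finite_measure.density_unique[OF sigma_finite_lborel]) auto
  then have "AE x in lborel. g x = 0"
  proof eventually_elim
    case (elim x)
    show "g x = 0"
    proof (cases "0 \<le> g x")
      case True
      then show ?thesis using elim by (simp add: ennreal_neg)
    next
      case False
      then have "ennreal (g x) = 0" by (simp add: ennreal_neg)
      then show ?thesis using elim False by (simp add: ennreal_eq_0_iff)
    qed
  qed
  then have "AE x in lebesgue. g x = 0" by (rule AE_completion)
  with fg show ?thesis by eventually_elim simp
qed

lemma L2_eq_0_if_orthogonal_test_fun:
  assumes "\<And>\<phi>. test_fun \<phi> \<Longrightarrow> inner u (L2_of \<phi>) = 0"
  shows "u = 0"
  using assms
proof (induct u rule: L2.abs_induct)
  case (1 f)
  then have sq: "sq_int f" and orth: "\<And>\<phi>. test_fun \<phi> \<Longrightarrow> inner (L2_of f) (L2_of \<phi>) = 0"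
    by (auto simp: l2_rel_refl)
  have fi: "integrable M01 f" using sq by (rule sq_int_integrable)
  define h where "h x = indicator {0<..<1} x * f x" for x
  have hi: "integrable lebesgue h"
    using fi unfolding h_def by (simp add: integrable_restrict_space)
  have "(\<integral>x. h x * indicator {a<..} x \<partial>lebesgue) = 0" for a
  proof -
    define a' where "a' = max 0 a"
    have sqc: "sq_int (cutoff a' k)" for k
      using test_funD(3)[OF test_fun_cutoff, of a' k] by (intro continuous_sq_int) (simp add: a'_def)
    have "(\<integral>x. f x * cutoff a' k x \<partial>M01) = 0" for k
      using orth[OF test_fun_cutoff, of a' k] inner_L2_of[OF sq sqc, of k] by (simp add: a'_def)
    moreover have "(\<lambda>k. \<integral>x. f x * cutoff a' k x \<partial>M01) \<longlonglongrightarrow> (\<integral>x. f x * indicator {a'<..<1} x \<partial>M01)"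
    proof (rule integral_dominated_convergence)
      show "integrable M01 (\<lambda>x. \<bar>f x\<bar>)" using fi by simp
      show "AE x in M01. (\<lambda>k. f x * cutoff a' k x) \<longlonglongrightarrow> f x * indicator {a'<..<1} x"
        by (intro AE_I2 tendsto_intros cutoff_tendsto)
      show "AE x in M01. norm (f x * cutoff a' k x) \<le> \<bar>f x\<bar>" for k
        using cutoff_bounds[of a' k] by (intro AE_I2) (auto simp: abs_mult intro!: mult_left_le)
      show "(\<lambda>x. f x * cutoff a' k x) \<in> borel_measurable M01" for k
        using sq sqc[of k] by (auto simp: sq_int_def)
      have "(\<lambda>x. indicator {a'<..<1} x :: real) \<in> borel_measurable lborel" by simp
      then have "(\<lambda>x. indicator {a'<..<1} x :: real) \<in> borel_measurable lebesgue" by (rule measurable_completion)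
      then have "(\<lambda>x. indicator {a'<..<1} x :: real) \<in> borel_measurable M01" by (rule measurable_restrict_space1)
      then show "(\<lambda>x. f x * indicator {a'<..<1} x) \<in> borel_measurable M01"
        using sq by (auto simp: sq_int_def)
    qed
    ultimately have "(\<integral>x. f x * indicator {a'<..<1} x \<partial>M01) = 0"
      by (simp add: LIMSEQ_const_iff)
    also have "(\<integral>x. f x * indicator {a'<..<1} x \<partial>M01) = (\<integral>x. indicator {0<..<1} x *\<^sub>R (f x * indicator {a'<..<1} x) \<partial>lebesgue)"
      by (rule integral_restrict_space) simp
    also have "\<dots> = (\<integral>x. h x * indicator {a<..} x \<partial>lebesgue)"
      by (intro Bochner_Integration.integral_cong refl) (auto simp: h_def a'_def indicator_def)
    finally show ?thesis .
  qed
  from AE_zero_if_tail_integrals_zero[OF hi this] have "AE x in lebesgue. h x = 0" .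
  then have "AE x in lebesgue. x \<in> {0<..<1} \<longrightarrow> f x = 0"
    by eventually_elim (auto simp: h_def)
  then have "AE x in M01. f x = 0" by (simp add: AE_restrict_space_iff)
  then have "l2_rel f (\<lambda>_. 0)" using sq sq_int_zero by (simp add: l2_rel_def)
  then show "L2_of f = 0" unfolding zero_L2_def using Quotient3_rel_abs[OF Quotient3_L2] by simp
qed

lemma weak_deriv_eq:
  assumes "has_weak_deriv u g"
  shows "weak_deriv u = g"
  unfolding weak_deriv_def
proof (rule the_equality[of _ g])
  fix g' assume "has_weak_deriv u g'"
  then have "inner (g' - g) (L2_of \<phi>) = 0" if "test_fun \<phi>" for \<phi>
    using assms that unfolding has_weak_deriv_def by (simp add: inner_diff_left)
  then have "g' - g = 0" by (rule L2_eq_0_if_orthogonal_test_fun)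
  then show "g' = g" by simp
qed (fact assms)

lemma has_weak_deriv_scaleR: "has_weak_deriv u g \<Longrightarrow> has_weak_deriv (c *\<^sub>R u) (c *\<^sub>R g)"
  by (simp add: has_weak_deriv_def)

lemma has_weak_deriv_sum:
  "(\<And>i. i \<in> I \<Longrightarrow> has_weak_deriv (u i) (g i)) \<Longrightarrow> has_weak_deriv (\<Sum>i\<in>I. u i) (\<Sum>i\<in>I. g i)"
  by (simp add: has_weak_deriv_def inner_sum_left sum_negf)

definition eb' :: "nat \<Rightarrow> L2" where
  "eb' i = L2_of (\<lambda>x. sqrt 2 * (real i * pi) * cos (real i * pi * x))"

lemma eb_weak_deriv: "has_weak_deriv (eb i) (eb' i)" "has_weak_deriv (eb' i) (- lam i *\<^sub>R eb i)"
proof -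
  show "has_weak_deriv (eb i) (eb' i)" unfolding eb_def eb'_def
    by (intro has_weak_deriv_C1 continuous_intros) (auto intro!: derivative_eq_intros)
  have "has_weak_deriv (eb' i) (L2_of (\<lambda>x. - lam i * (sqrt 2 * sin (real i * pi * x))))" unfolding eb'_def lam_def
    by (intro has_weak_deriv_C1 continuous_intros) (auto intro!: derivative_eq_intros simp: power2_eq_square)
  moreover have "sq_int (\<lambda>x. sqrt 2 * sin (real i * pi * x))" by (intro continuous_sq_int continuous_intros)
  then have "- lam i *\<^sub>R eb i = L2_of (\<lambda>x. - lam i * (sqrt 2 * sin (real i * pi * x)))"
    unfolding eb_def by (intro scaleR_L2.abs_eq) (simp add: l2_rel_refl)
  ultimately show "has_weak_deriv (eb' i) (- lam i *\<^sub>R eb i)" by (simp only:)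
qed

lemma lap_sum_eb: "lap (\<Sum>i\<in>I. c i *\<^sub>R eb i) = (\<Sum>i\<in>I. (- lam i * c i) *\<^sub>R eb i)"
proof -
  have "weak_deriv (\<Sum>i\<in>I. c i *\<^sub>R eb i) = (\<Sum>i\<in>I. c i *\<^sub>R eb' i)"
    by (intro weak_deriv_eq has_weak_deriv_sum has_weak_deriv_scaleR eb_weak_deriv)
  moreover have "weak_deriv (\<Sum>i\<in>I. c i *\<^sub>R eb' i) = (\<Sum>i\<in>I. c i *\<^sub>R (- lam i *\<^sub>R eb i))"
    by (intro weak_deriv_eq has_weak_deriv_sum has_weak_deriv_scaleR eb_weak_deriv)
  ultimately show ?thesis unfolding lap_def by (simp add: mult.commute)
qed

lemma integral_cos_int_pi:
  "((\<lambda>x. cos (real_of_int k * pi * x)) has_integral (if k = 0 then 1 else 0)) {0..1}"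
proof (cases "k = 0")
  case True
  then show ?thesis using has_integral_const_real[of "1::real" 0 1] by simp
next
  case False
  have "((\<lambda>x. cos (real_of_int k * pi * x)) has_integral
      (sin (real_of_int k * pi * 1) / (real_of_int k * pi) - sin (real_of_int k * pi * 0) / (real_of_int k * pi))) {0..1}"
    using False by (intro fundamental_theorem_of_calculus)
      (auto intro!: derivative_eq_intros simp: has_real_derivative_iff_has_vector_derivative[symmetric])
  then show ?thesis using False by (simp add: mult.commute[of _ pi] sin_integer_2pi sin_int_times_real sin_npi_int)
qed

lemma inner_eb:
  assumes "1 \<le> i" "1 \<le> j"
  shows "inner (eb i) (eb j) = (if i = j then 1 else 0)"
proof -
  have "((\<lambda>x. cos (real_of_int (int i - int j) * pi * x) - cos (real_of_int (int i + int j) * pi * x)) has_integral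
     ((if int i - int j = 0 then 1 else 0) - (if int i + int j = 0 then 1 else 0))) {0..1}"
    by (intro has_integral_diff integral_cos_int_pi)
  moreover have "cos (real_of_int (int i - int j) * pi * x) - cos (real_of_int (int i + int j) * pi * x)
     = (sqrt 2 * sin (real i * pi * x)) * (sqrt 2 * sin (real j * pi * x))" for x
  proof -
    have "(sqrt 2 * sin (real i * pi * x)) * (sqrt 2 * sin (real j * pi * x)) = 2 * (sin (real i * pi * x) * sin (real j * pi * x))"
      by simp
    also have "\<dots> = cos (real i * pi * x - real j * pi * x) - cos (real i * pi * x + real j * pi * x)"
      by (simp add: cos_diff cos_add)
    finally show ?thesis by (simp add: algebra_simps)
  qed
  ultimately have "integral {0..1} (\<lambda>x. (sqrt 2 * sin (real i * pi * x)) * (sqrt 2 * sin (real j * pi * x)))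
      = (if i = j then 1 else 0)"
    using assms by (intro integral_unique) (auto simp: if_splits)
  then show ?thesis unfolding eb_def
    by (subst inner_L2_of_continuous) (intro continuous_intros | simp)+
qed

lemma inner_sum_eb: "j \<in> {1..n} \<Longrightarrow> inner (\<Sum>i\<in>{1..n}. c i *\<^sub>R eb i) (eb j) = c j"
  by (simp add: inner_sum_left inner_eb if_distrib[of "(*) _"] sum.delta cong: if_cong)

lemma norm_sum_eb: "(norm (\<Sum>i\<in>{1..n}. c i *\<^sub>R eb i))\<^sup>2 = (\<Sum>i\<in>{1..n}. (c i)\<^sup>2)"
proof -
  have "(norm (\<Sum>i\<in>{1..n}. c i *\<^sub>R eb i))\<^sup>2 = (\<Sum>j\<in>{1..n}. c j * inner (\<Sum>i\<in>{1..n}. c i *\<^sub>R eb i) (eb j))"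
    by (subst power2_norm_eq_inner, subst inner_sum_right) simp
  also have "\<dots> = (\<Sum>j\<in>{1..n}. (c j)\<^sup>2)"
    by (intro sum.cong refl) (simp only: inner_sum_eb power2_eq_square)
  finally show ?thesis .
qed

lemma sum_eb_in_Hn: "(\<Sum>i\<in>{1..n}. c i *\<^sub>R eb i) \<in> Hn n"
  unfolding Hn_def by (intro span_sum span_scale span_base) auto

lemma Pn_in_Hn: "Pn n u \<in> Hn n"
  unfolding Pn_def by (rule sum_eb_in_Hn)

lemma bounded_linear_Pn: "bounded_linear (Pn n)"
  unfolding Pn_def[abs_def]
  by (intro bounded_linear_sum bounded_linear_scaleR_const bounded_linear_inner_left)

lemma Hn_eq:
  assumes "u \<in> Hn n"
  shows "u = (\<Sum>i\<in>{1..n}. inner u (eb i) *\<^sub>R eb i)"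
proof -
  have "Pn n u = u"
    using assms unfolding Hn_def
  proof (induction rule: span_induct_alt)
    case base
    then show ?case by (simp add: Pn_def)
  next
    case (step c x y)
    then obtain j where j: "j \<in> {1..n}" "x = eb j" by auto
    have "Pn n x = x" unfolding Pn_def j(2) using j(1)
      by (simp add: inner_eb if_distrib[of "\<lambda>c. c *\<^sub>R _"] sum.delta' cong: if_cong)
    then show ?case using step(2) bounded_linear.linear[OF bounded_linear_Pn, of n]
      by (simp add: linear_add linear_scale)
  qed
  then show ?thesis by (simp add: Pn_def)
qed

lemma An_sum_eb: "An n (\<Sum>i\<in>{1..n}. c i *\<^sub>R eb i) = (\<Sum>i\<in>{1..n}. (- lam i * c i) *\<^sub>R eb i)"
  unfolding An_def lap_sum_eb using Hn_eq[OF sum_eb_in_Hn, of "\<lambda>i. - lam i * c i" n] unfolding Pn_def by (rule sym)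

lemma An_eq: "u \<in> Hn n \<Longrightarrow> An n u = (\<Sum>i\<in>{1..n}. (- lam i * inner u (eb i)) *\<^sub>R eb i)"
  using arg_cong[OF Hn_eq, of u n "An n"] by (simp only: An_sum_eb)

lemma En_eq:
  assumes u: "u \<in> Hn n"
  shows "En n t u = (\<Sum>i\<in>{1..n}. (exp (- lam i * t) * inner u (eb i)) *\<^sub>R eb i)"
proof -
  have pow: "(An n ^^ k) u = (\<Sum>i\<in>{1..n}. ((- lam i) ^ k * inner u (eb i)) *\<^sub>R eb i)" for k
  proof (induction k)
    case 0
    then show ?case using Hn_eq[OF u] by simp
  next
    case (Suc k)
    then show ?case by (simp only: funpow.simps o_apply An_sum_eb power_Suc mult.assoc)
  qed
  have "(\<lambda>k. (t ^ k / fact k) *\<^sub>R ((An n ^^ k) u)) sums (\<Sum>i\<in>{1..n}. (exp (- lam i * t) * inner u (eb i)) *\<^sub>R eb i)"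
  proof -
    have "(\<lambda>k. (- lam i * t) ^ k /\<^sub>R fact k) sums exp (- lam i * t)" for i by (rule exp_converges)
    then have "(\<lambda>k. ((- lam i * t) ^ k /\<^sub>R fact k * inner u (eb i)) *\<^sub>R eb i) sums ((exp (- lam i * t) * inner u (eb i)) *\<^sub>R eb i)" for i
      by (intro bounded_linear.sums[OF bounded_linear_scaleR_left] sums_mult2)
    then have "(\<lambda>k. \<Sum>i\<in>{1..n}. ((- lam i * t) ^ k /\<^sub>R fact k * inner u (eb i)) *\<^sub>R eb i) sums
        (\<Sum>i\<in>{1..n}. (exp (- lam i * t) * inner u (eb i)) *\<^sub>R eb i)"
      by (rule sums_sum)
    moreover have "(t ^ k / fact k) *\<^sub>R ((An n ^^ k) u) = (\<Sum>i\<in>{1..n}. ((- lam i * t) ^ k /\<^sub>R fact k * inner u (eb i)) *\<^sub>R eb i)" for k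
      unfolding pow scaleR_sum_right
      by (intro sum.cong refl, unfold power_mult_distrib[of "- lam _" t]) (simp add: divide_inverse mult_ac)
    ultimately show ?thesis by simp
  qed
  then show ?thesis unfolding En_def by (simp add: sums_iff)
qed

lemma sqrt_op_eb:
  assumes Qh: "is_sqrt_op Qh Q" and Q: "Q (eb i) = q *\<^sub>R eb i" and q: "0 < q"
  shows "Qh (eb i) = sqrt q *\<^sub>R eb i"
proof -
  have lin: "linear Qh" using Qh unfolding is_sqrt_op_def by (auto intro: bounded_linear.linear)
  define w where "w = Qh (eb i) - sqrt q *\<^sub>R eb i"
  have "Qh w = Qh (Qh (eb i)) - sqrt q *\<^sub>R Qh (eb i)"
    unfolding w_def using lin by (simp add: linear_diff linear_scale)
  also have "Qh (Qh (eb i)) = q *\<^sub>R eb i" using Qh Q unfolding is_sqrt_op_def by simp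
  also have "q *\<^sub>R eb i - sqrt q *\<^sub>R Qh (eb i) = - sqrt q *\<^sub>R w"
    unfolding w_def using q by (simp add: scaleR_diff_right)
  finally have "inner (Qh w) w = - sqrt q * (norm w)\<^sup>2" by (simp add: power2_norm_eq_inner)
  moreover have "0 \<le> inner (Qh w) w" using Qh unfolding is_sqrt_op_def by simp
  ultimately have "(norm w)\<^sup>2 \<le> 0" using q by (simp add: mult_le_0_iff)
  then show ?thesis unfolding w_def by simp
qed

section \<open>The solution map\<close>


lemma grid_bounds:
  assumes "0 < \<tau>" "0 \<le> s"
  shows "0 \<le> grid \<tau> s" "grid \<tau> s \<le> s"
proof -
  have "0 \<le> \<lfloor>s / \<tau>\<rfloor>" using assms by simp
  then show "0 \<le> grid \<tau> s" unfolding grid_def using assms by simp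
  have "\<tau> * of_int \<lfloor>s / \<tau>\<rfloor> \<le> \<tau> * (s / \<tau>)" using assms by (intro mult_left_mono) auto
  then show "grid \<tau> s \<le> s" unfolding grid_def using assms by simp
qed

lemma grid_function_abs_integrable:
  fixes c :: "real \<Rightarrow> real"
  assumes \<tau>: "0 < \<tau>"
  shows "(\<lambda>s. c (grid \<tau> s)) absolutely_integrable_on {0..T}"
proof -
  have "(\<lambda>s. c (\<tau> * real_of_int \<lfloor>s / \<tau>\<rfloor>)) \<in> borel_measurable borel"
    by (rule measurable_compose[of "\<lambda>s. \<lfloor>s / \<tau>\<rfloor>" _ "count_space UNIV" "\<lambda>k. c (\<tau> * real_of_int k)"]) measurable
  then have m: "(\<lambda>s. c (grid \<tau> s)) \<in> borel_measurable (lebesgue_on {0..T})"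
    unfolding grid_def by (intro measurable_restrict_space1) (auto intro: measurable_completion)
  have "grid \<tau> ` {0..T} \<subseteq> (\<lambda>k. \<tau> * real_of_int k) ` {0..\<lfloor>T / \<tau>\<rfloor>}"
  proof
    fix g assume "g \<in> grid \<tau> ` {0..T}"
    then obtain s where s: "s \<in> {0..T}" "g = grid \<tau> s" by auto
    have "\<lfloor>s / \<tau>\<rfloor> \<in> {0..\<lfloor>T / \<tau>\<rfloor>}" using s \<tau> by (auto intro!: floor_mono divide_right_mono)
    then show "g \<in> (\<lambda>k. \<tau> * real_of_int k) ` {0..\<lfloor>T / \<tau>\<rfloor>}" unfolding s(2) grid_def by blast
  qed
  then have "finite (grid \<tau> ` {0..T})" by (rule finite_subset) simp
  then have fin: "finite ((\<lambda>x. \<bar>c x\<bar>) ` grid \<tau> ` {0..T})" by simp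
  define B where "B = Max (insert 0 ((\<lambda>x. \<bar>c x\<bar>) ` grid \<tau> ` {0..T}))"
  have "\<bar>c (grid \<tau> s)\<bar> \<le> B" if "s \<in> {0..T}" for s
    unfolding B_def by (rule Max_ge) (use fin that in auto)
  then show ?thesis
    by (intro measurable_bounded_by_integrable_imp_absolutely_integrable[OF m _ integrable_const_ivl[of B]]) auto
qed

text \<open>\<open>solves T n y w z\<close>: in the coordinates with respect to \<open>eb\<close>, the path \<open>z\<close> solves
  \<open>z t = y + \<integral>\<^sub>0\<^sup>t (An n (z s) + Pn n (F (z (grid \<tau> s)))) ds + w t\<close>. The scheme is the case
  \<open>w = \<epsilon> Qh W\<close> and the skeleton equation the case \<open>w = Qh \<integral>\<phi>\<close>.\<close>

locale skeleton =
  fixes F Qh :: "L2 \<Rightarrow> L2" and \<tau> L\<^sub>F :: real and r :: "nat \<Rightarrow> real"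
  assumes \<tau>: "0 < \<tau>" and L\<^sub>F: "0 < L\<^sub>F"
    and F_lip: "\<And>u v. norm (F u - F v) \<le> L\<^sub>F * norm (u - v)"
    and Qh_linear: "linear Qh"
    and Qh_eb: "\<And>i. 1 \<le> i \<Longrightarrow> Qh (eb i) = r i *\<^sub>R eb i"
    and r_pos: "\<And>i. 1 \<le> i \<Longrightarrow> 0 < r i"
begin

definition Fc :: "(real \<Rightarrow> L2) \<Rightarrow> nat \<Rightarrow> real \<Rightarrow> real" where
  "Fc z i s = inner (F (z (grid \<tau> s))) (eb i)"

definition solves :: "real \<Rightarrow> nat \<Rightarrow> L2 \<Rightarrow> (nat \<Rightarrow> real \<Rightarrow> real) \<Rightarrow> (real \<Rightarrow> L2) \<Rightarrow> bool" where
  "solves T n y w z \<longleftrightarrow> (\<forall>t\<in>{0..T}. z t \<in> Hn n) \<and> continuous_on {0..T} z \<and>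
     (\<forall>i\<in>{1..n}. \<forall>t\<in>{0..T}. ((\<lambda>s. - lam i * inner (z s) (eb i) + Fc z i s) has_integral
        (inner (z t) (eb i) - inner y (eb i) - w i t)) {0..t})"

lemma norm_Hn_le_sum:
  assumes "u \<in> Hn n" shows "norm u \<le> (\<Sum>i\<in>{1..n}. \<bar>inner u (eb i)\<bar>)"
proof -
  have "norm u = norm (\<Sum>i\<in>{1..n}. inner u (eb i) *\<^sub>R eb i)" using Hn_eq[OF assms] by simp
  also have "\<dots> \<le> (\<Sum>i\<in>{1..n}. norm (inner u (eb i) *\<^sub>R eb i))" by (rule norm_sum)
  also have "\<dots> = (\<Sum>i\<in>{1..n}. \<bar>inner u (eb i)\<bar>)"
    by (intro sum.cong refl) (simp add: norm_eq_sqrt_inner inner_eb)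
  finally show ?thesis .
qed

lemma abs_inner_eb_le: "1 \<le> i \<Longrightarrow> \<bar>inner u (eb i)\<bar> \<le> norm u"
  using Cauchy_Schwarz_ineq2[of u "eb i"] by (simp add: norm_eq_sqrt_inner[of "eb i"] inner_eb)

lemma Hn_diff: "u \<in> Hn n \<Longrightarrow> v \<in> Hn n \<Longrightarrow> u - v \<in> Hn n"
  unfolding Hn_def by (rule span_diff)

definition growth :: "nat \<Rightarrow> real" where
  "growth n = 2 * real n * ((\<Sum>i\<in>{1..n}. lam i) + L\<^sub>F)"

definition stab :: "real \<Rightarrow> nat \<Rightarrow> real" where
  "stab T n = 2 * real n * exp (growth n * T)"

text \<open>Taking the supremum with the weight \<open>exp (- growth n * t)\<close> replaces Gronwall's inequality.\<close>

lemma solves_stable: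
  assumes T: "0 < T" and n: "1 \<le> n" and z: "solves T n y w z" and z': "solves T n y w' z'"
    and e: "\<And>i t. i \<in> {1..n} \<Longrightarrow> t \<in> {0..T} \<Longrightarrow> \<bar>w i t - w' i t\<bar> \<le> e"
    and t: "t \<in> {0..T}"
  shows "norm (z t - z' t) \<le> stab T n * e"
proof -
  define \<Lambda> where "\<Lambda> = (\<Sum>i\<in>{1..n}. lam i) + L\<^sub>F"
  have lam0: "0 \<le> lam i" for i by (simp add: lam_def)
  have lam\<Lambda>: "lam i + L\<^sub>F \<le> \<Lambda>" if "i \<in> {1..n}" for i
    unfolding \<Lambda>_def using member_le_sum[of i "{1..n}" lam] that lam0 by auto
  have \<Lambda>: "0 < \<Lambda>" unfolding \<Lambda>_def using lam0 L\<^sub>F by (intro add_nonneg_pos sum_nonneg) auto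
  define \<kappa> where "\<kappa> = 2 * real n * \<Lambda>"
  have \<kappa>: "0 < \<kappa>" unfolding \<kappa>_def using n \<Lambda> by simp
  define D where "D t = norm (z t - z' t)" for t
  have zc: "continuous_on {0..T} z" "continuous_on {0..T} z'" and zH: "\<And>t. t \<in> {0..T} \<Longrightarrow> z t \<in> Hn n" "\<And>t. t \<in> {0..T} \<Longrightarrow> z' t \<in> Hn n"
    using z z' unfolding solves_def by auto
  have cont: "continuous_on {0..T} (\<lambda>t. exp (- \<kappa> * t) * D t)"
    unfolding D_def by (intro continuous_intros zc)
  have "{0..T} \<noteq> {}" using T by simp
  from continuous_attains_sup[OF compact_Icc this cont]
  have "\<exists>x\<in>{0..T}. \<forall>t\<in>{0..T}. exp (- \<kappa> * t) * D t \<le> exp (- \<kappa> * x) * D x" .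
  then obtain t1 where t1: "t1 \<in> {0..T}" "\<And>t. t \<in> {0..T} \<Longrightarrow> exp (- \<kappa> * t) * D t \<le> exp (- \<kappa> * t1) * D t1"
    by auto
  define m where "m = exp (- \<kappa> * t1) * D t1"
  have m0: "0 \<le> m" unfolding m_def D_def by simp
  have Dm: "D t \<le> m * exp (\<kappa> * t)" if "t \<in> {0..T}" for t
  proof -
    have "exp (\<kappa> * t) * (exp (- \<kappa> * t) * D t) \<le> exp (\<kappa> * t) * m"
      using t1(2)[OF that] unfolding m_def by (intro mult_left_mono) auto
    moreover have "exp (\<kappa> * t) * (exp (- \<kappa> * t) * D t) = D t" by (simp add: exp_minus)
    ultimately show ?thesis by (simp only: mult.commute[of m])
  qed
  have coord: "\<bar>inner (z t - z' t) (eb i)\<bar> \<le> \<Lambda> * m * exp (\<kappa> * t) / \<kappa> + e" if t: "t \<in> {0..T}" and i: "i \<in> {1..n}" for t i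
  proof -
    let ?d = "inner (z t - z' t) (eb i)"
    have I: "((\<lambda>s. (- lam i * inner (z s) (eb i) + Fc z i s) - (- lam i * inner (z' s) (eb i) + Fc z' i s)) has_integral
       ((inner (z t) (eb i) - inner y (eb i) - w i t) - (inner (z' t) (eb i) - inner y (eb i) - w' i t))) {0..t}"
      using z z' t i unfolding solves_def by (intro has_integral_diff) auto
    have E: "((\<lambda>s. \<Lambda> * m * exp (\<kappa> * s)) has_integral (\<Lambda> * m * (exp (\<kappa> * t) / \<kappa> - exp (\<kappa> * 0) / \<kappa>))) {0..t}"
      using t \<kappa> by (intro has_integral_mult_right fundamental_theorem_of_calculus)
        (auto intro!: derivative_eq_intros simp: has_real_derivative_iff_has_vector_derivative[symmetric])
    have bd: "\<bar>(- lam i * inner (z s) (eb i) + Fc z i s) - (- lam i * inner (z' s) (eb i) + Fc z' i s)\<bar> \<le> \<Lambda> * m * exp (\<kappa> * s)"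
      if s: "s \<in> {0..t}" for s
    proof -
      have sT: "s \<in> {0..T}" "0 \<le> s" using s t by auto
      have g: "grid \<tau> s \<in> {0..T}" "grid \<tau> s \<le> s" using grid_bounds[OF \<tau> sT(2)] sT by auto
      have "\<bar>inner (z s - z' s) (eb i)\<bar> \<le> D s" unfolding D_def using i by (intro abs_inner_eb_le) auto
      also have "\<dots> \<le> m * exp (\<kappa> * s)" by (rule Dm[OF sT(1)])
      finally have 1: "lam i * \<bar>inner (z s - z' s) (eb i)\<bar> \<le> lam i * (m * exp (\<kappa> * s))"
        using lam0 by (intro mult_left_mono) auto
      have "\<bar>Fc z i s - Fc z' i s\<bar> = \<bar>inner (F (z (grid \<tau> s)) - F (z' (grid \<tau> s))) (eb i)\<bar>"
        unfolding Fc_def by (simp add: inner_diff_left)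
      also have "\<dots> \<le> norm (F (z (grid \<tau> s)) - F (z' (grid \<tau> s)))" using i by (intro abs_inner_eb_le) auto
      also have "\<dots> \<le> L\<^sub>F * D (grid \<tau> s)" unfolding D_def by (rule F_lip)
      also have "\<dots> \<le> L\<^sub>F * (m * exp (\<kappa> * grid \<tau> s))" using Dm[OF g(1)] L\<^sub>F by (intro mult_left_mono) auto
      also have "\<dots> \<le> L\<^sub>F * (m * exp (\<kappa> * s))" using g(2) L\<^sub>F m0 \<kappa> by (intro mult_left_mono) auto
      finally have 2: "\<bar>Fc z i s - Fc z' i s\<bar> \<le> L\<^sub>F * (m * exp (\<kappa> * s))" .
      have "(- lam i * inner (z s) (eb i) + Fc z i s) - (- lam i * inner (z' s) (eb i) + Fc z' i s)
          = - (lam i * inner (z s - z' s) (eb i)) + (Fc z i s - Fc z' i s)"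
        by (simp add: inner_diff_left algebra_simps)
      then have "\<bar>(- lam i * inner (z s) (eb i) + Fc z i s) - (- lam i * inner (z' s) (eb i) + Fc z' i s)\<bar>
          \<le> lam i * \<bar>inner (z s - z' s) (eb i)\<bar> + \<bar>Fc z i s - Fc z' i s\<bar>"
        using lam0[of i] abs_triangle_ineq[of "- (lam i * inner (z s - z' s) (eb i))" "Fc z i s - Fc z' i s"]
        by (simp add: abs_mult)
      also have "\<dots> \<le> (lam i + L\<^sub>F) * (m * exp (\<kappa> * s))" using 1 2 by (simp add: distrib_right)
      also have "\<dots> \<le> \<Lambda> * (m * exp (\<kappa> * s))" using lam\<Lambda>[OF i] m0 by (intro mult_right_mono) auto
      finally show ?thesis by (simp add: mult.assoc)
    qed
    have "(inner (z t) (eb i) - inner y (eb i) - w i t) - (inner (z' t) (eb i) - inner y (eb i) - w' i t) \<le> \<Lambda> * m * (exp (\<kappa> * t) / \<kappa> - exp (\<kappa> * 0) / \<kappa>)"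
      by (rule has_integral_le[OF I E]) (use bd in \<open>auto simp: abs_le_iff\<close>)
    moreover have "- ((inner (z t) (eb i) - inner y (eb i) - w i t) - (inner (z' t) (eb i) - inner y (eb i) - w' i t)) \<le> \<Lambda> * m * (exp (\<kappa> * t) / \<kappa> - exp (\<kappa> * 0) / \<kappa>)"
    proof (rule has_integral_le[OF has_integral_neg[OF I] E])
      fix s assume "s \<in> {0..t}"
      from bd[OF this] show "- ((- lam i * inner (z s) (eb i) + Fc z i s) - (- lam i * inner (z' s) (eb i) + Fc z' i s)) \<le> \<Lambda> * m * exp (\<kappa> * s)"
        by linarith
    qed
    moreover have "\<Lambda> * m * (exp (\<kappa> * t) / \<kappa> - exp (\<kappa> * 0) / \<kappa>) \<le> \<Lambda> * m * exp (\<kappa> * t) / \<kappa>"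
      using \<Lambda> m0 \<kappa> by (simp add: right_diff_distrib)
    moreover have "\<bar>w i t - w' i t\<bar> \<le> e" by (rule e[OF i t])
    moreover have "?d = inner (z t) (eb i) - inner (z' t) (eb i)" by (simp add: inner_diff_left)
    ultimately show ?thesis by linarith
  qed
  have Dt: "D t \<le> m / 2 * exp (\<kappa> * t) + real n * e" if t: "t \<in> {0..T}" for t
  proof -
    have "D t \<le> (\<Sum>i\<in>{1..n}. \<bar>inner (z t - z' t) (eb i)\<bar>)"
      unfolding D_def using zH t by (intro norm_Hn_le_sum Hn_diff) auto
    also have "\<dots> \<le> (\<Sum>i\<in>{1..n}. \<Lambda> * m * exp (\<kappa> * t) / \<kappa> + e)" using coord t by (intro sum_mono) auto
    also have "\<dots> = real n * (\<Lambda> * m * exp (\<kappa> * t) / \<kappa>) + real n * e" by (simp add: distrib_left)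
    also have "real n * (\<Lambda> * m * exp (\<kappa> * t) / \<kappa>) = m / 2 * exp (\<kappa> * t)"
      unfolding \<kappa>_def using n \<Lambda> by (simp add: field_simps)
    finally show ?thesis .
  qed
  have e0: "0 \<le> e" using e[of 1 0] n T by fastforce
  have "m \<le> 2 * (real n * e)"
  proof -
    have "m = exp (- \<kappa> * t1) * D t1" by (simp add: m_def)
    also have "\<dots> \<le> exp (- \<kappa> * t1) * (m / 2 * exp (\<kappa> * t1) + real n * e)" using Dt[OF t1(1)] by (intro mult_left_mono) auto
    also have "\<dots> = m / 2 + exp (- \<kappa> * t1) * (real n * e)" by (simp add: distrib_left exp_minus)
    also have "exp (- \<kappa> * t1) * (real n * e) \<le> 1 * (real n * e)" using \<kappa> t1 e0 by (intro mult_right_mono) auto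
    finally show ?thesis by linarith
  qed
  have "D t \<le> m * exp (\<kappa> * t)" by (rule Dm[OF t])
  also have "\<dots> \<le> (2 * (real n * e)) * exp (\<kappa> * T)"
    using \<open>m \<le> 2 * (real n * e)\<close> t \<kappa> m0 e0 by (intro mult_mono) auto
  finally show ?thesis unfolding D_def stab_def growth_def \<kappa>_def \<Lambda>_def by (simp add: mult_ac)
qed

lemma forcing_abs_integrable:
  assumes "L2_on T \<psi>"
  shows "(\<lambda>s. Fc z i s + c * \<psi> s) absolutely_integrable_on {0..T}"
proof -
  have "(\<lambda>s. Fc z i s) absolutely_integrable_on {0..T}"
    unfolding Fc_def by (rule grid_function_abs_integrable[OF \<tau>, where c = "\<lambda>x. inner (F (z x)) (eb i)"])
  moreover have "(\<lambda>s. c * \<psi> s) absolutely_integrable_on {0..T}"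
    using L2_on_abs_integrable[OF assms] by (rule set_integrable_mult_right)
  ultimately show ?thesis by (rule set_integral_add(1))
qed

lemma solves_iff_mild:
  assumes L: "\<forall>i\<in>{1..n}. L2_on T (\<psi> i)"
  shows "solves T n y (\<lambda>i t. r i * integral {0..t} (\<psi> i)) z \<longleftrightarrow>
    (\<forall>t\<in>{0..T}. z t \<in> Hn n) \<and> continuous_on {0..T} z \<and>
    (\<forall>i\<in>{1..n}. \<forall>t\<in>{0..T}. ((\<lambda>s. exp (- lam i * (t - s)) * (Fc z i s + r i * \<psi> i s)) has_integral
        (inner (z t) (eb i) - exp (- lam i * t) * inner y (eb i))) {0..t})"
proof -
  have eq: "((\<lambda>s. - lam i * inner (z s) (eb i) + Fc z i s) has_integral (a - b - r i * integral {0..t} (\<psi> i))) {0..t}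
      \<longleftrightarrow> ((\<lambda>s. - lam i * inner (z s) (eb i) + (Fc z i s + r i * \<psi> i s)) has_integral (a - b)) {0..t}"
    if i: "i \<in> {1..n}" and t: "t \<in> {0..T}" for i t a b
  proof -
    have P: "((\<lambda>s. r i * \<psi> i s) has_integral (r i * integral {0..t} (\<psi> i))) {0..t}"
      using L2_on_integrable_sub(1)[OF bspec[OF L i], of 0 t] t by (intro has_integral_mult_right integrable_integral) auto
    show ?thesis
    proof
      assume "((\<lambda>s. - lam i * inner (z s) (eb i) + Fc z i s) has_integral (a - b - r i * integral {0..t} (\<psi> i))) {0..t}"
      from has_integral_add[OF this P]
      show "((\<lambda>s. - lam i * inner (z s) (eb i) + (Fc z i s + r i * \<psi> i s)) has_integral (a - b)) {0..t}"
        by (simp only: add.assoc diff_add_cancel)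
    next
      assume "((\<lambda>s. - lam i * inner (z s) (eb i) + (Fc z i s + r i * \<psi> i s)) has_integral (a - b)) {0..t}"
      from has_integral_diff[OF this P]
      show "((\<lambda>s. - lam i * inner (z s) (eb i) + Fc z i s) has_integral (a - b - r i * integral {0..t} (\<psi> i))) {0..t}"
        by simp
    qed
  qed
  have "(\<forall>t\<in>{0..T}. ((\<lambda>s. - lam i * inner (z s) (eb i) + Fc z i s) has_integral
        (inner (z t) (eb i) - inner y (eb i) - r i * integral {0..t} (\<psi> i))) {0..t}) \<longleftrightarrow>
      (\<forall>t\<in>{0..T}. ((\<lambda>s. exp (- lam i * (t - s)) * (Fc z i s + r i * \<psi> i s)) has_integral
        (inner (z t) (eb i) - exp (- lam i * t) * inner y (eb i))) {0..t})"
    if i: "i \<in> {1..n}" and zc: "continuous_on {0..T} z" for i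
  proof -
    have "continuous_on {0..T} (\<lambda>t. inner (z t) (eb i))" by (intro continuous_intros zc)
    from mild_iff_strong[OF forcing_abs_integrable[OF bspec[OF L i], of z i "r i"] this, of "lam i" "inner y (eb i)"]
    show ?thesis using eq[OF i] by (simp add: Ball_def)
  qed
  then show ?thesis unfolding solves_def by blast
qed

definition mild_step :: "nat \<Rightarrow> L2 \<Rightarrow> (nat \<Rightarrow> real \<Rightarrow> real) \<Rightarrow> (real \<Rightarrow> L2) \<Rightarrow> real \<Rightarrow> L2" where
  "mild_step n y \<psi> z t = (\<Sum>i\<in>{1..n}. (exp (- lam i * t) * (inner y (eb i) +
      integral {0..t} (\<lambda>s. exp (lam i * s) * (Fc z i s + r i * \<psi> i s)))) *\<^sub>R eb i)"

lemma solves_exists: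
  assumes T: "0 < T" and y: "y \<in> Hn n" and L: "\<And>i. i \<in> {1..n} \<Longrightarrow> L2_on T (\<psi> i)"
  obtains z where "solves T n y (\<lambda>i t. r i * integral {0..t} (\<psi> i)) z"
proof -
  define Z where "Z k = (mild_step n y \<psi> ^^ k) (\<lambda>_. y)" for k
  have Zs: "Z (Suc k) = mild_step n y \<psi> (Z k)" for k by (simp add: Z_def)
  have agree: "Z (Suc k) t = Z k t" if "t \<in> {0..T}" "t \<le> real k * \<tau>" for k t
    using that
  proof (induction k arbitrary: t)
    case 0
    then have "t = 0" by simp
    then show ?case using Hn_eq[OF y] by (simp add: Z_def mild_step_def)
  next
    case (Suc k)
    have "integral {0..t} (\<lambda>s. exp (lam i * s) * (Fc (Z (Suc k)) i s + r i * \<psi> i s))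
        = integral {0..t} (\<lambda>s. exp (lam i * s) * (Fc (Z k) i s + r i * \<psi> i s))" for i
    proof (rule integral_spike[of "{t}"])
      fix s assume s: "s \<in> {0..t} - {t}"
      then have "s / \<tau> < real (Suc k)" using Suc.prems \<tau> by (simp add: pos_divide_less_eq)
      then have "\<lfloor>s / \<tau>\<rfloor> < int (Suc k)" by (simp add: floor_less_iff)
      then have "real_of_int \<lfloor>s / \<tau>\<rfloor> \<le> real k" by linarith
      then have "grid \<tau> s \<le> real k * \<tau>" unfolding grid_def using \<tau> by (simp add: mult.commute)
      moreover have "grid \<tau> s \<in> {0..T}" using grid_bounds[OF \<tau>, of s] s Suc.prems by auto
      ultimately have "Z (Suc k) (grid \<tau> s) = Z k (grid \<tau> s)" by (intro Suc.IH)
      then show "exp (lam i * s) * (Fc (Z k) i s + r i * \<psi> i s) = exp (lam i * s) * (Fc (Z (Suc k)) i s + r i * \<psi> i s)"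
        unfolding Fc_def by simp
    qed simp
    then show ?case unfolding Zs[of "Suc k"] Zs[of k] mild_step_def by simp
  qed
  have LB: "\<forall>i\<in>{1..n}. L2_on T (\<psi> i)" using L by blast
  obtain K where K: "T / \<tau> < real K" using reals_Archimedean2 by blast
  define z where "z = Z K"
  have fixp: "z t = mild_step n y \<psi> z t" if t: "t \<in> {0..T}" for t
  proof -
    have "T \<le> real K * \<tau>" using K \<tau> by (simp add: pos_divide_less_eq)
    then show ?thesis using agree[OF t, of K] t unfolding z_def Zs by simp
  qed
  have ei: "(\<lambda>s. exp (lam i * s) * (Fc z i s + r i * \<psi> i s)) integrable_on {0..T}" if "i \<in> {1..n}" for i
    using abs_int_exp_mult[OF forcing_abs_integrable[OF L[OF that]]] by (auto simp: absolutely_integrable_on_def)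
  have zH: "z t \<in> Hn n" if "t \<in> {0..T}" for t
    unfolding fixp[OF that] mild_step_def by (rule sum_eb_in_Hn)
  have "continuous_on {0..T} (mild_step n y \<psi> z)"
    unfolding mild_step_def using ei by (intro continuous_intros indefinite_integral_continuous_1) auto
  then have zc: "continuous_on {0..T} z" by (rule continuous_on_eq) (use fixp in simp)
  have "((\<lambda>s. exp (- lam i * (t - s)) * (Fc z i s + r i * \<psi> i s)) has_integral
        (inner (z t) (eb i) - exp (- lam i * t) * inner y (eb i))) {0..t}" if i: "i \<in> {1..n}" and t: "t \<in> {0..T}" for i t
  proof -
    let ?J = "integral {0..t} (\<lambda>s. exp (lam i * s) * (Fc z i s + r i * \<psi> i s))"
    have "(\<lambda>s. exp (lam i * s) * (Fc z i s + r i * \<psi> i s)) integrable_on {0..t}"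
      using integrable_on_subinterval[OF ei[OF i], of 0 t] t by auto
    then have "((\<lambda>s. exp (- lam i * t) * (exp (lam i * s) * (Fc z i s + r i * \<psi> i s))) has_integral (exp (- lam i * t) * ?J)) {0..t}"
      by (intro has_integral_mult_right integrable_integral)
    moreover have "exp (- lam i * t) * (exp (lam i * s) * x) = exp (- lam i * (t - s)) * x" for s x
    proof -
      have "- lam i * (t - s) = - lam i * t + lam i * s" by (simp add: right_diff_distrib)
      then show ?thesis by (simp only: exp_add mult.assoc)
    qed
    moreover have "exp (- lam i * t) * ?J = inner (z t) (eb i) - exp (- lam i * t) * inner y (eb i)"
      unfolding fixp[OF t] mild_step_def inner_sum_eb[OF i] by (simp add: distrib_left)
    ultimately show ?thesis by (simp only:)
  qed
  then have "solves T n y (\<lambda>i t. r i * integral {0..t} (\<psi> i)) z"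
    unfolding solves_iff_mild[OF LB] using zH zc by blast
  then show thesis by (rule that)
qed

lemma Qh_sum_eb: "Qh (\<Sum>i\<in>{1..n}. c i *\<^sub>R eb i) = (\<Sum>i\<in>{1..n}. (r i * c i) *\<^sub>R eb i)"
  unfolding linear_sum[OF Qh_linear] by (intro sum.cong refl) (simp add: linear_scale[OF Qh_linear] Qh_eb mult.commute)

lemma inner_Pn: "i \<in> {1..n} \<Longrightarrow> inner (Pn n u) (eb i) = inner u (eb i)"
  unfolding Pn_def by (rule inner_sum_eb)

lemma inner_An: "u \<in> Hn n \<Longrightarrow> i \<in> {1..n} \<Longrightarrow> inner (An n u) (eb i) = - lam i * inner u (eb i)"
  by (simp only: An_eq inner_sum_eb)

lemma inner_En: "u \<in> Hn n \<Longrightarrow> i \<in> {1..n} \<Longrightarrow> inner (En n t u) (eb i) = exp (- lam i * t) * inner u (eb i)"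
  by (simp only: En_eq inner_sum_eb)

lemma inner_Qh: "u \<in> Hn n \<Longrightarrow> i \<in> {1..n} \<Longrightarrow> inner (Qh u) (eb i) = r i * inner u (eb i)"
  using arg_cong[OF Hn_eq, of u n Qh] by (simp only: Qh_sum_eb inner_sum_eb)

lemma has_integral_Hn_iff:
  assumes f: "\<And>s. s \<in> S \<Longrightarrow> f s \<in> Hn n" and v: "v \<in> Hn n"
  shows "(f has_integral v) S \<longleftrightarrow> (\<forall>i\<in>{1..n}. ((\<lambda>s. inner (f s) (eb i)) has_integral inner v (eb i)) S)"
proof
  assume I: "(f has_integral v) S"
  show "\<forall>i\<in>{1..n}. ((\<lambda>s. inner (f s) (eb i)) has_integral inner v (eb i)) S"
  proof
    fix i
    show "((\<lambda>s. inner (f s) (eb i)) has_integral inner v (eb i)) S"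
      using has_integral_linear[OF I bounded_linear_inner_left[of "eb i"]] by (simp add: o_def)
  qed
next
  assume "\<forall>i\<in>{1..n}. ((\<lambda>s. inner (f s) (eb i)) has_integral inner v (eb i)) S"
  then have "((\<lambda>s. \<Sum>i\<in>{1..n}. inner (f s) (eb i) *\<^sub>R eb i) has_integral (\<Sum>i\<in>{1..n}. inner v (eb i) *\<^sub>R eb i)) S"
    by (intro has_integral_sum) (auto intro: has_integral_linear[OF _ bounded_linear_scaleR_left, unfolded o_def])
  then have "((\<lambda>s. \<Sum>i\<in>{1..n}. inner (f s) (eb i) *\<^sub>R eb i) has_integral v) S"
    by (simp only: Hn_eq[OF v, symmetric])
  then show "(f has_integral v) S"
    by (rule has_integral_eq[rotated]) (rule Hn_eq[OF f, symmetric])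
qed

lemma euler_interpolation_solves:
  assumes Y: "euler_interpolation M Ft \<beta> F Qh \<tau> \<epsilon> n y Y" and y: "y \<in> Hn n"
  shows "AE \<omega> in M. \<forall>T. solves T n y (\<lambda>i t. r i * (\<epsilon> * \<beta> i t \<omega>)) (\<lambda>t. Y t \<omega>)"
proof -
  have H: "Y t \<omega> \<in> Hn n" if "0 \<le> t" "\<omega> \<in> space M" for t \<omega>
    using Y that unfolding euler_interpolation_def by auto
  have "AE \<omega> in M. continuous_on {0..} (\<lambda>t. Y t \<omega>) \<and>
        (\<forall>t\<ge>0. ((\<lambda>s. An n (Y s \<omega>) + Pn n (F (Y (grid \<tau> s) \<omega>)))
            has_integral (Y t \<omega> - y - \<epsilon> *\<^sub>R Pn n (Qh (Wn \<beta> n t \<omega>)))) {0..t})"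
    using Y unfolding euler_interpolation_def by auto
  then show ?thesis
    using AE_space
  proof eventually_elim
    case (elim \<omega>)
    show ?case unfolding solves_def
    proof (intro allI conjI ballI)
      fix T
      show "continuous_on {0..T} (\<lambda>t. Y t \<omega>)"
        using elim(1) by (auto intro: continuous_on_subset)
      show "Y t \<omega> \<in> Hn n" if "t \<in> {0..T}" for t using H elim(2) that by auto
      fix i t assume i: "i \<in> {1..n}" and t: "t \<in> {0..T}"
      have W: "Wn \<beta> n t \<omega> \<in> Hn n" unfolding Wn_def by (rule sum_eb_in_Hn)
      have "((\<lambda>s. An n (Y s \<omega>) + Pn n (F (Y (grid \<tau> s) \<omega>)))
            has_integral (Y t \<omega> - y - \<epsilon> *\<^sub>R Pn n (Qh (Wn \<beta> n t \<omega>)))) {0..t}" using elim(1) t by auto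
      from has_integral_linear[OF this bounded_linear_inner_left[of "eb i"]]
      have "((\<lambda>s. inner (An n (Y s \<omega>) + Pn n (F (Y (grid \<tau> s) \<omega>))) (eb i))
            has_integral inner (Y t \<omega> - y - \<epsilon> *\<^sub>R Pn n (Qh (Wn \<beta> n t \<omega>))) (eb i)) {0..t}" by (simp only: o_def)
      also have "inner (Y t \<omega> - y - \<epsilon> *\<^sub>R Pn n (Qh (Wn \<beta> n t \<omega>))) (eb i)
          = inner (Y t \<omega>) (eb i) - inner y (eb i) - r i * (\<epsilon> * \<beta> i t \<omega>)"
        using inner_Qh[OF W i] inner_sum_eb[OF i, of "\<lambda>i. \<beta> i t \<omega>"]
        by (simp add: inner_diff_left inner_Pn[OF i] Wn_def)
      finally show "((\<lambda>s. - lam i * inner (Y s \<omega>) (eb i) + Fc (\<lambda>t. Y t \<omega>) i s) has_integral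
          (inner (Y t \<omega>) (eb i) - inner y (eb i) - r i * (\<epsilon> * \<beta> i t \<omega>))) {0..t}"
        by (rule has_integral_eq[rotated]) (use H elim(2) i in \<open>simp add: inner_add_left inner_An inner_Pn Fc_def\<close>)
    qed
  qed
qed

lemma controlled_path_solves:
  assumes \<phi>: "\<phi> \<in> L2_control T n" and z: "is_controlled_path F Qh \<tau> T n y \<phi> z" and y: "y \<in> Hn n" and T: "0 < T"
    and zC: "\<And>t. t \<in> {0..T} \<Longrightarrow> z t \<in> Hn n" "continuous_on {0..T} z"
  obtains \<psi> where "\<forall>i\<in>{1..n}. L2_on T (\<psi> i)"
    "(\<Sum>i\<in>{1..n}. energy T (\<psi> i)) = (\<integral>t. (norm (\<phi> t))\<^sup>2 \<partial>lebesgue_on {0<..<T})"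
    "solves T n y (\<lambda>i t. r i * integral {0..t} (\<psi> i)) z"
proof -
  define \<psi> where "\<psi> i t = (if t \<in> {0<..<T} then inner (\<phi> t) (eb i) else 0)" for i t
  have \<phi>m: "\<phi> \<in> borel_measurable (lebesgue_on {0<..<T})" and \<phi>H: "\<And>t. t \<in> {0<..<T} \<Longrightarrow> \<phi> t \<in> Hn n"
    and \<phi>i: "integrable (lebesgue_on {0<..<T}) (\<lambda>t. (norm (\<phi> t))\<^sup>2)"
    using \<phi> unfolding L2_control_def by auto
  have im: "(\<lambda>t. inner (\<phi> t) (eb i)) \<in> borel_measurable (lebesgue_on {0<..<T})" for i
    by (rule measurable_compose[OF \<phi>m]) (intro borel_measurable_continuous_onI continuous_intros)
  have ii: "integrable (lebesgue_on {0<..<T}) (\<lambda>t. (inner (\<phi> t) (eb i))\<^sup>2)" if "1 \<le> i" for i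
  proof (rule Bochner_Integration.integrable_bound[OF \<phi>i])
    show "AE t in lebesgue_on {0<..<T}. norm ((inner (\<phi> t) (eb i))\<^sup>2) \<le> norm ((norm (\<phi> t))\<^sup>2)"
      using abs_inner_eb_le[OF that] by (intro AE_I2) (simp add: abs_le_square_iff[symmetric])
  qed (use im in \<open>auto intro!: borel_measurable_power\<close>)
  have Isq: "((\<lambda>t. (\<psi> i t)\<^sup>2) has_integral (\<integral>t. (inner (\<phi> t) (eb i))\<^sup>2 \<partial>lebesgue_on {0<..<T})) {0..T}" if "1 \<le> i" for i
  proof -
    have "((\<lambda>t. (inner (\<phi> t) (eb i))\<^sup>2) has_integral (\<integral>t. (inner (\<phi> t) (eb i))\<^sup>2 \<partial>lebesgue_on {0<..<T})) {0<..<T}"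
      by (rule has_integral_integral_lebesgue_on[OF ii[OF that]]) simp
    then have "((\<lambda>t. (\<psi> i t)\<^sup>2) has_integral (\<integral>t. (inner (\<phi> t) (eb i))\<^sup>2 \<partial>lebesgue_on {0<..<T})) {0<..<T}"
      by (rule has_integral_eq[rotated]) (simp add: \<psi>_def)
    then show ?thesis using has_integral_open_interval[of "\<lambda>t. (\<psi> i t)\<^sup>2" _ 0 T] by simp
  qed
  have L: "L2_on T (\<psi> i)" if "i \<in> {1..n}" for i
    unfolding L2_on_def
  proof
    show "(\<lambda>t. (\<psi> i t)\<^sup>2) integrable_on {0..T}" using Isq that by (auto intro: has_integral_integrable)
    have "(\<lambda>t. if t \<in> {0<..<T} then inner (\<phi> t) (eb i) else 0) \<in> borel_measurable lebesgue"
      using im[of i] by (rule borel_measurable_if_I) simp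
    then show "\<psi> i \<in> borel_measurable (lebesgue_on {0..T})"
      unfolding \<psi>_def[abs_def] by (rule measurable_restrict_space1)
  qed
  have LB: "\<forall>i\<in>{1..n}. L2_on T (\<psi> i)" using L by blast
  have En: "(\<Sum>i\<in>{1..n}. energy T (\<psi> i)) = (\<integral>t. (norm (\<phi> t))\<^sup>2 \<partial>lebesgue_on {0<..<T})"
  proof -
    have "(\<Sum>i\<in>{1..n}. energy T (\<psi> i)) = (\<Sum>i\<in>{1..n}. \<integral>t. (inner (\<phi> t) (eb i))\<^sup>2 \<partial>lebesgue_on {0<..<T})"
      using Isq by (intro sum.cong refl integral_unique) auto
    also have "\<dots> = (\<integral>t. (\<Sum>i\<in>{1..n}. (inner (\<phi> t) (eb i))\<^sup>2) \<partial>lebesgue_on {0<..<T})"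
      using ii by (intro Bochner_Integration.integral_sum[symmetric]) auto
    also have "\<dots> = (\<integral>t. (norm (\<phi> t))\<^sup>2 \<partial>lebesgue_on {0<..<T})"
    proof (rule Bochner_Integration.integral_cong[OF refl])
      fix t assume "t \<in> space (lebesgue_on {0<..<T})"
      then have "\<phi> t \<in> Hn n" using \<phi>H by simp
      then show "(\<Sum>i\<in>{1..n}. (inner (\<phi> t) (eb i))\<^sup>2) = (norm (\<phi> t))\<^sup>2"
        using norm_sum_eb[where c = "\<lambda>i. inner (\<phi> t) (eb i)" and n = n] Hn_eq[of "\<phi> t" n] by simp
    qed
    finally show ?thesis .
  qed
  have "((\<lambda>s. exp (- lam i * (t - s)) * (Fc z i s + r i * \<psi> i s)) has_integral
        (inner (z t) (eb i) - exp (- lam i * t) * inner y (eb i))) {0..t}" if i: "i \<in> {1..n}" and t: "t \<in> {0..T}" for i t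
  proof -
    have "((\<lambda>s. En n (t - s) (Pn n (F (z (grid \<tau> s))) + Pn n (Qh (\<phi> s)))) has_integral (z t - En n t y)) {0..t}"
      using z t unfolding is_controlled_path_def by auto
    from has_integral_linear[OF this bounded_linear_inner_left[of "eb i"]]
    have I: "((\<lambda>s. inner (En n (t - s) (Pn n (F (z (grid \<tau> s))) + Pn n (Qh (\<phi> s)))) (eb i)) has_integral
        inner (z t - En n t y) (eb i)) {0..t}" by (simp only: o_def)
    have "((\<lambda>s. exp (- lam i * (t - s)) * (Fc z i s + r i * \<psi> i s)) has_integral inner (z t - En n t y) (eb i)) {0..t}"
    proof (rule has_integral_spike_finite[OF _ _ I])
      fix s assume s: "s \<in> {0..t} - {0, t}"
      then have "s \<in> {0<..<T}" using t by auto
      then have "inner (Qh (\<phi> s)) (eb i) = r i * \<psi> i s" using inner_Qh[OF \<phi>H i] by (simp add: \<psi>_def)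
      moreover have "Pn n (F (z (grid \<tau> s))) + Pn n (Qh (\<phi> s)) \<in> Hn n"
        using Pn_in_Hn unfolding Hn_def by (intro span_add) auto
      ultimately show "exp (- lam i * (t - s)) * (Fc z i s + r i * \<psi> i s) = inner (En n (t - s) (Pn n (F (z (grid \<tau> s))) + Pn n (Qh (\<phi> s)))) (eb i)"
        using i by (simp add: inner_En inner_add_left inner_Pn Fc_def)
    qed simp
    then show ?thesis using y i by (simp add: inner_diff_left inner_En)
  qed
  then have "solves T n y (\<lambda>i t. r i * integral {0..t} (\<psi> i)) z"
    unfolding solves_iff_mild[OF LB] using zC by blast
  with LB En show thesis by (rule that)
qed

lemma solves_controlled_path:
  assumes L: "\<And>i. i \<in> {1..n} \<Longrightarrow> L2_on T (\<psi> i)"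
    and z: "solves T n y (\<lambda>i t. r i * integral {0..t} (\<psi> i)) z" and y: "y \<in> Hn n" and T: "0 < T"
    and zC: "restrict z {0..T} \<in> mspace (C_space T (Hn n))"
  obtains \<phi> where "\<phi> \<in> L2_control T n" "is_controlled_path F Qh \<tau> T n y \<phi> (restrict z {0..T})"
    "(\<integral>t. (norm (\<phi> t))\<^sup>2 \<partial>lebesgue_on {0<..<T}) = (\<Sum>i\<in>{1..n}. energy T (\<psi> i))"
proof -
  have LB: "\<forall>i\<in>{1..n}. L2_on T (\<psi> i)" using L by blast
  define \<phi> where "\<phi> t = (\<Sum>i\<in>{1..n}. \<psi> i t *\<^sub>R eb i)" for t
  have \<phi>H: "\<phi> t \<in> Hn n" for t unfolding \<phi>_def by (rule sum_eb_in_Hn)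
  have \<phi>c: "inner (\<phi> t) (eb i) = \<psi> i t" if "i \<in> {1..n}" for i t
    unfolding \<phi>_def by (rule inner_sum_eb[OF that])
  have nsq: "(norm (\<phi> t))\<^sup>2 = (\<Sum>i\<in>{1..n}. (\<psi> i t)\<^sup>2)" for t unfolding \<phi>_def by (rule norm_sum_eb)
  have \<psi>m: "\<psi> i \<in> borel_measurable (lebesgue_on {0<..<T})" if "i \<in> {1..n}" for i
  proof -
    have "\<psi> i \<in> borel_measurable (lebesgue_on {0..T})" using L[OF that] by (simp add: L2_on_def)
    then show ?thesis by (rule measurable_restrict_mono) auto
  qed
  have \<phi>m: "\<phi> \<in> borel_measurable (lebesgue_on {0<..<T})"
  proof -
    have "(\<lambda>t i. if i \<in> {1..n} then \<psi> i t else 0) \<in> borel_measurable (lebesgue_on {0<..<T})"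
    proof (rule measurable_coordinatewise_then_product)
      fix i show "(\<lambda>t. if i \<in> {1..n} then \<psi> i t else 0) \<in> borel_measurable (lebesgue_on {0<..<T})"
        using \<psi>m[of i] by (cases "i \<in> {1..n}") auto
    qed
    moreover have "(\<lambda>c :: nat \<Rightarrow> real. \<Sum>i\<in>{1..n}. c i *\<^sub>R eb i) \<in> borel_measurable borel"
      by (intro borel_measurable_continuous_onI continuous_intros continuous_on_product_coordinates)
    ultimately have "(\<lambda>t. \<Sum>i\<in>{1..n}. (if i \<in> {1..n} then \<psi> i t else 0) *\<^sub>R eb i) \<in> borel_measurable (lebesgue_on {0<..<T})"
      by (rule measurable_compose)
    also have "(\<lambda>t. \<Sum>i\<in>{1..n}. (if i \<in> {1..n} then \<psi> i t else 0) *\<^sub>R eb i) = \<phi>"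
      unfolding \<phi>_def by (intro ext sum.cong) auto
    finally show ?thesis .
  qed
  have \<psi>i: "integrable (lebesgue_on {0<..<T}) (\<lambda>t. (\<psi> i t)\<^sup>2)"
    and \<psi>I: "(\<integral>t. (\<psi> i t)\<^sup>2 \<partial>lebesgue_on {0<..<T}) = energy T (\<psi> i)" if i: "i \<in> {1..n}" for i
  proof -
    have "(\<lambda>t. (\<psi> i t)\<^sup>2) absolutely_integrable_on {0..T}"
      using L[OF i] by (intro nonnegative_absolutely_integrable_1) (auto simp: L2_on_def)
    then have "(\<lambda>t. (\<psi> i t)\<^sup>2) absolutely_integrable_on {0<..<T}" by (rule set_integrable_subset) auto
    then show 1: "integrable (lebesgue_on {0<..<T}) (\<lambda>t. (\<psi> i t)\<^sup>2)"
      by (simp add: integrable_restrict_space set_integrable_def)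
    show "(\<integral>t. (\<psi> i t)\<^sup>2 \<partial>lebesgue_on {0<..<T}) = energy T (\<psi> i)"
      using lebesgue_integral_eq_integral[OF 1] integral_open_interval_real[of 0 T "\<lambda>t. (\<psi> i t)\<^sup>2"] by simp
  qed
  have C: "\<phi> \<in> L2_control T n"
  proof -
    have "integrable (lebesgue_on {0<..<T}) (\<lambda>t. (norm (\<phi> t))\<^sup>2)" unfolding nsq using \<psi>i by auto
    then show ?thesis unfolding L2_control_def using \<phi>m \<phi>H by simp
  qed
  have E: "(\<integral>t. (norm (\<phi> t))\<^sup>2 \<partial>lebesgue_on {0<..<T}) = (\<Sum>i\<in>{1..n}. energy T (\<psi> i))"
    unfolding nsq using \<psi>i \<psi>I by (subst Bochner_Integration.integral_sum) auto
  have "((\<lambda>s. En n (t - s) (Pn n (F (restrict z {0..T} (grid \<tau> s))) + Pn n (Qh (\<phi> s)))) has_integral (restrict z {0..T} t - En n t y)) {0..t}"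
    if t: "t \<in> {0..T}" for t
  proof -
    have sumH: "Pn n u + Pn n v \<in> Hn n" for u v using Pn_in_Hn unfolding Hn_def by (intro span_add) auto
    have EnH: "En n s u \<in> Hn n" if "u \<in> Hn n" for s u unfolding En_eq[OF that] by (rule sum_eb_in_Hn)
    have "((\<lambda>s. En n (t - s) (Pn n (F (z (grid \<tau> s))) + Pn n (Qh (\<phi> s)))) has_integral (z t - En n t y)) {0..t}"
    proof (subst has_integral_Hn_iff)
      show "z t - En n t y \<in> Hn n" using z t y unfolding solves_def by (intro Hn_diff EnH) auto
      show "\<forall>i\<in>{1..n}. ((\<lambda>s. inner (En n (t - s) (Pn n (F (z (grid \<tau> s))) + Pn n (Qh (\<phi> s)))) (eb i)) has_integral inner (z t - En n t y) (eb i)) {0..t}"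
      proof
        fix i assume i: "i \<in> {1..n}"
        have "((\<lambda>s. exp (- lam i * (t - s)) * (Fc z i s + r i * \<psi> i s)) has_integral
          (inner (z t) (eb i) - exp (- lam i * t) * inner y (eb i))) {0..t}"
          using z t i unfolding solves_iff_mild[OF LB] by blast
        then show "((\<lambda>s. inner (En n (t - s) (Pn n (F (z (grid \<tau> s))) + Pn n (Qh (\<phi> s)))) (eb i)) has_integral inner (z t - En n t y) (eb i)) {0..t}"
          using i y inner_Qh[OF \<phi>H i] by (simp add: inner_diff_left inner_En sumH inner_add_left inner_Pn \<phi>c Fc_def)
      qed
    qed (intro EnH sumH)
    then have "((\<lambda>s. En n (t - s) (Pn n (F (restrict z {0..T} (grid \<tau> s))) + Pn n (Qh (\<phi> s)))) has_integral (z t - En n t y)) {0..t}"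
    proof (rule has_integral_eq[rotated])
      fix s assume "s \<in> {0..t}"
      then have "grid \<tau> s \<in> {0..T}" using grid_bounds[OF \<tau>, of s] t by auto
      then show "En n (t - s) (Pn n (F (z (grid \<tau> s))) + Pn n (Qh (\<phi> s)))
        = En n (t - s) (Pn n (F (restrict z {0..T} (grid \<tau> s))) + Pn n (Qh (\<phi> s)))" by simp
    qed
    then show ?thesis using t by simp
  qed
  then have "is_controlled_path F Qh \<tau> T n y \<phi> (restrict z {0..T})"
    unfolding is_controlled_path_def using zC by blast
  with C show thesis using E by (rule that)
qed

end

section \<open>Compactness of the level sets\<close>


lemma controls_sequentially_compact:
  fixes \<Phi> :: "nat \<Rightarrow> nat \<Rightarrow> real \<Rightarrow> real"
  assumes T: "0 < T" and C: "0 \<le> C"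
    and L: "\<And>k i. i \<in> {1..n} \<Longrightarrow> L2_on T (\<Phi> k i)"
    and E: "\<And>k. (\<Sum>i\<in>{1..n}. energy T (\<Phi> k i)) \<le> C + inverse (real (Suc k))"
  shows "\<exists>\<phi> (s :: nat \<Rightarrow> nat). strict_mono s \<and> (\<forall>i\<in>{1..n}. L2_on T (\<phi> i)) \<and> (\<Sum>i\<in>{1..n}. energy T (\<phi> i)) \<le> C \<and>
    (\<forall>e>0. \<exists>N. \<forall>k\<ge>N. \<forall>i\<in>{1..n}. \<forall>t\<in>{0..T}. \<bar>integral {0..t} (\<Phi> (s k) i) - integral {0..t} (\<phi> i)\<bar> \<le> e)"
proof -
  have Ei: "energy T (\<Phi> k i) \<le> C + 1" if "i \<in> {1..n}" for k i
  proof -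
    have "energy T (\<Phi> k i) \<le> (\<Sum>i\<in>{1..n}. energy T (\<Phi> k i))"
      using that energy_nonneg by (intro member_le_sum) auto
    also have "\<dots> \<le> C + inverse (real (Suc k))" by (rule E)
    also have "inverse (real (Suc k)) \<le> 1" by (simp add: inverse_le_1_iff)
    finally show ?thesis by simp
  qed
  text \<open>Coding the finite index as a second real coordinate lets Arzela-Ascoli treat all components at once.\<close>
  define S where "S = {0..T} \<times> real ` {1..n}"
  define G where "G k p = integral {0..fst p} (\<Phi> k (nat \<lfloor>snd p\<rfloor>))" for k and p :: "real \<times> real"
  have Sc: "compact S" unfolding S_def by (intro compact_Times compact_Icc finite_imp_compact) auto
  have Gp: "G k (t, real i) = integral {0..t} (\<Phi> k i)" for k t i unfolding G_def by simp
  have bdd: "norm (G k p) \<le> sqrt (T * (C + 1))" if p: "p \<in> S" for k p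
  proof -
    obtain t i where ti: "p = (t, real i)" "t \<in> {0..T}" "i \<in> {1..n}" using p unfolding S_def by auto
    have "norm (G k p) \<le> sqrt (T * energy T (\<Phi> k i))"
      unfolding ti(1) Gp using abs_integral_le_energy[OF L[OF ti(3)] ti(2)] by simp
    also have "\<dots> \<le> sqrt (T * (C + 1))" using Ei[OF ti(3)] T by (intro real_sqrt_le_mono mult_left_mono) auto
    finally show ?thesis .
  qed
  have mod: "\<bar>integral {0..x} (\<Phi> k i) - integral {0..y} (\<Phi> k i)\<bar> \<le> sqrt (\<bar>x - y\<bar> * (C + 1))"
    if "x \<in> {0..T}" "y \<in> {0..T}" and i: "i \<in> {1..n}" for x y k i
  proof (cases "x \<le> y")
    case True
    then show ?thesis using L2_on_primitive_diff[OF L[OF i] _ True _ Ei[OF i], of k] that by (simp add: abs_minus_commute)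
  next
    case False
    then have "y \<le> x" by simp
    then show ?thesis using L2_on_primitive_diff[OF L[OF i] _ \<open>y \<le> x\<close> _ Ei[OF i], of k] that by simp
  qed
  have equi: "\<exists>d. 0 < d \<and> (\<forall>k y. y \<in> S \<and> norm (p - y) < d \<longrightarrow> norm (G k p - G k y) < e)"
    if p: "p \<in> S" and e: "0 < e" for p e
  proof (intro exI[of _ "min 1 (e\<^sup>2 / (C + 1))"] conjI allI impI)
    show "0 < min 1 (e\<^sup>2 / (C + 1))" using e C by simp
    fix k y assume y: "y \<in> S \<and> norm (p - y) < min 1 (e\<^sup>2 / (C + 1))"
    obtain t i where ti: "p = (t, real i)" "t \<in> {0..T}" "i \<in> {1..n}" using p unfolding S_def by auto
    obtain u j where uj: "y = (u, real j)" "u \<in> {0..T}" "j \<in> {1..n}" using y unfolding S_def by auto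
    have "\<bar>real i - real j\<bar> \<le> norm (p - y)" "\<bar>t - u\<bar> \<le> norm (p - y)"
      using norm_snd_le[of "real i - real j" "t - u"] norm_fst_le[of "t - u" "real i - real j"] unfolding ti uj by simp_all
    then have "\<bar>real i - real j\<bar> < 1" and tu: "\<bar>t - u\<bar> < e\<^sup>2 / (C + 1)" using y by auto
    then have "i = j" by linarith
    have "norm (G k p - G k y) \<le> sqrt (\<bar>t - u\<bar> * (C + 1))"
      unfolding ti(1) uj(1) Gp \<open>i = j\<close> using mod[OF ti(2) uj(2,3), of k] by simp
    also have "\<dots> < sqrt (e\<^sup>2)"
      using tu C by (intro real_sqrt_less_mono) (simp add: pos_less_divide_eq)
    finally show "norm (G k p - G k y) < e" using e by simp
  qed
  have "\<exists>g (s :: nat \<Rightarrow> nat). strict_mono s \<and> (\<forall>e>0. \<exists>N. \<forall>k p. k \<ge> N \<and> p \<in> S \<longrightarrow> norm (G (s k) p - g p) < e)"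
    by (rule Arzela_Ascoli[of S G "sqrt (T * (C + 1))"], rule Sc, rule bdd, assumption, rule equi, assumption+, blast)
  then obtain g and s :: "nat \<Rightarrow> nat" where s: "strict_mono s"
    and g: "\<And>e. 0 < e \<Longrightarrow> \<exists>N. \<forall>k p. k \<ge> N \<and> p \<in> S \<longrightarrow> norm (G (s k) p - g p) < e" by blast
  define h where "h i t = g (t, real i)" for i t
  have conv: "\<exists>N. \<forall>k\<ge>N. \<forall>i\<in>{1..n}. \<forall>t\<in>{0..T}. \<bar>integral {0..t} (\<Phi> (s k) i) - h i t\<bar> \<le> e" if e: "0 < e" for e
  proof -
    obtain N where N: "\<And>k p. k \<ge> N \<Longrightarrow> p \<in> S \<Longrightarrow> norm (G (s k) p - g p) < e" using g[OF e] by blast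
    have "\<bar>integral {0..t} (\<Phi> (s k) i) - h i t\<bar> \<le> e" if "k \<ge> N" "i \<in> {1..n}" "t \<in> {0..T}" for k i t
      using N[OF that(1), of "(t, real i)"] that unfolding h_def Gp S_def by auto
    then show ?thesis by blast
  qed
  have "\<exists>\<psi>. L2_on T \<psi> \<and> (\<forall>t\<in>{0..T}. integral {0..t} \<psi> = h i t) \<and>
    (\<forall>\<eta>>0. \<exists>e>0. \<forall>\<phi>. L2_on T \<phi> \<longrightarrow> (\<forall>t\<in>{0..T}. \<bar>integral {0..t} \<phi> - h i t\<bar> \<le> e) \<longrightarrow> energy T \<psi> \<le> energy T \<phi> + \<eta>)"
    if i: "i \<in> {1..n}" for i
  proof (rule primitive_energy_lsc[of T "h i" "C + 1"])
    show "0 \<le> T" using T by simp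
    fix e :: real assume "0 < e"
    from conv[OF this] obtain N where "\<forall>t\<in>{0..T}. \<bar>integral {0..t} (\<Phi> (s N) i) - h i t\<bar> \<le> e" using i by blast
    then show "\<exists>\<psi>. L2_on T \<psi> \<and> (\<forall>t\<in>{0..T}. \<bar>integral {0..t} \<psi> - h i t\<bar> \<le> e) \<and> energy T \<psi> \<le> C + 1"
      using L[OF i] Ei[OF i] by blast
  qed blast
  then have "\<forall>i\<in>{1..n}. \<exists>\<psi>. L2_on T \<psi> \<and> (\<forall>t\<in>{0..T}. integral {0..t} \<psi> = h i t) \<and>
    (\<forall>\<eta>>0. \<exists>e>0. \<forall>\<phi>. L2_on T \<phi> \<longrightarrow> (\<forall>t\<in>{0..T}. \<bar>integral {0..t} \<phi> - h i t\<bar> \<le> e) \<longrightarrow> energy T \<psi> \<le> energy T \<phi> + \<eta>)"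
    by blast
  from bchoice[OF this] obtain \<phi> where \<phi>: "\<And>i. i \<in> {1..n} \<Longrightarrow> L2_on T (\<phi> i)"
    "\<And>i t. i \<in> {1..n} \<Longrightarrow> t \<in> {0..T} \<Longrightarrow> integral {0..t} (\<phi> i) = h i t"
    "\<And>i \<eta>. i \<in> {1..n} \<Longrightarrow> 0 < \<eta> \<Longrightarrow> \<exists>e>0. \<forall>\<phi>'. L2_on T \<phi>' \<longrightarrow> (\<forall>t\<in>{0..T}. \<bar>integral {0..t} \<phi>' - h i t\<bar> \<le> e) \<longrightarrow> energy T (\<phi> i) \<le> energy T \<phi>' + \<eta>"
    by blast
  have "(\<Sum>i\<in>{1..n}. energy T (\<phi> i)) \<le> C + \<eta>" if \<eta>: "0 < \<eta>" for \<eta>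
  proof -
    define \<eta>' where "\<eta>' = \<eta> / (real n + 1)"
    have \<eta>': "0 < \<eta>'" using \<eta> by (simp add: \<eta>'_def)
    have "\<exists>N. \<forall>k\<ge>N. energy T (\<phi> i) \<le> energy T (\<Phi> (s k) i) + \<eta>'" if i: "i \<in> {1..n}" for i
    proof -
      obtain e where e: "0 < e" "\<And>\<phi>'. L2_on T \<phi>' \<Longrightarrow> (\<forall>t\<in>{0..T}. \<bar>integral {0..t} \<phi>' - h i t\<bar> \<le> e) \<Longrightarrow> energy T (\<phi> i) \<le> energy T \<phi>' + \<eta>'"
        using \<phi>(3)[OF i \<eta>'] by blast
      obtain N where N: "\<forall>k\<ge>N. \<forall>i\<in>{1..n}. \<forall>t\<in>{0..T}. \<bar>integral {0..t} (\<Phi> (s k) i) - h i t\<bar> \<le> e"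
        using conv[OF e(1)] by blast
      have "energy T (\<phi> i) \<le> energy T (\<Phi> (s k) i) + \<eta>'" if "k \<ge> N" for k
        using N that i by (intro e(2) L) auto
      then show ?thesis by blast
    qed
    then have "\<forall>i\<in>{1..n}. \<exists>N. \<forall>k\<ge>N. energy T (\<phi> i) \<le> energy T (\<Phi> (s k) i) + \<eta>'" by blast
    from bchoice[OF this] obtain N where N: "\<forall>i\<in>{1..n}. \<forall>k\<ge>N i. energy T (\<phi> i) \<le> energy T (\<Phi> (s k) i) + \<eta>'" ..
    obtain m where m: "inverse (real (Suc m)) < \<eta>'" using reals_Archimedean[OF \<eta>'] by blast
    define k where "k = m + (\<Sum>i\<in>{1..n}. N i)"
    have Nk: "N i \<le> k" if "i \<in> {1..n}" for i
      unfolding k_def using member_le_sum[of i "{1..n}" N] that by simp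
    have "m \<le> k" unfolding k_def by simp
    then have "m \<le> s k" using seq_suble[OF s, of k] by simp
    then have "inverse (real (Suc (s k))) \<le> inverse (real (Suc m))" by (intro le_imp_inverse_le) auto
    then have ik: "inverse (real (Suc (s k))) < \<eta>'" using m by linarith
    have "(\<Sum>i\<in>{1..n}. energy T (\<phi> i)) \<le> (\<Sum>i\<in>{1..n}. energy T (\<Phi> (s k) i) + \<eta>')"
      using N Nk by (intro sum_mono) blast
    also have "\<dots> = (\<Sum>i\<in>{1..n}. energy T (\<Phi> (s k) i)) + real n * \<eta>'" by (simp add: sum.distrib)
    also have "\<dots> \<le> C + (real n + 1) * \<eta>'" using E[of "s k"] ik by (simp add: algebra_simps)
    also have "(real n + 1) * \<eta>' = \<eta>" unfolding \<eta>'_def by (simp add: add_nonneg_eq_0_iff)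
    finally show ?thesis .
  qed
  then have EC: "(\<Sum>i\<in>{1..n}. energy T (\<phi> i)) \<le> C" by (rule field_le_epsilon)
  have "\<exists>N. \<forall>k\<ge>N. \<forall>i\<in>{1..n}. \<forall>t\<in>{0..T}. \<bar>integral {0..t} (\<Phi> (s k) i) - integral {0..t} (\<phi> i)\<bar> \<le> e" if e: "0 < e" for e
    using conv[OF e] \<phi>(2) by simp
  then show ?thesis using s \<phi>(1) EC by blast
qed

lemma mspace_C_space:
  "z \<in> mspace (C_space T S) \<longleftrightarrow> z \<in> extensional {0..T} \<and> (\<forall>t\<in>{0..T}. z t \<in> S) \<and> continuous_on {0..T} z"
proof -
  have c: "compactin (top_of_set {0..T}) (topspace (top_of_set {0..T}))"
    by (simp add: compactin_subtopology)
  have t: "mtopology_of (submetric euclidean_metric S) = top_of_set S"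
    by (simp add: mtopology_of_submetric)
  show ?thesis
    unfolding C_space_def compactin_mspace_cfunspace[OF c] t
    by (auto simp: continuous_map_in_subtopology)
qed

lemma mdist_C_space_le: "0 \<le> e \<Longrightarrow> (\<And>t. t \<in> {0..T} \<Longrightarrow> norm (z t - w t) \<le> e) \<Longrightarrow> mdist (C_space T S) z w \<le> e"
  unfolding C_space_def by (rule mdist_cfunspace_le) (auto simp: dist_norm)

lemma C_dist_le: "0 \<le> e \<Longrightarrow> (\<And>t. t \<in> {0..T} \<Longrightarrow> norm (z t - w t) \<le> e) \<Longrightarrow> C_dist T z w \<le> e"
  unfolding C_dist_def by (rule mdist_C_space_le) auto

lemma norm_le_C_dist:
  assumes "continuous_on {0..T} z" "continuous_on {0..T} w" "t \<in> {0..T}"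
  shows "norm (z t - w t) \<le> C_dist T z w"
proof -
  have "restrict z {0..T} \<in> mspace (C_space T UNIV)" "restrict w {0..T} \<in> mspace (C_space T UNIV)"
    unfolding mspace_C_space using assms by (auto intro: continuous_on_eq[of _ z] continuous_on_eq[of _ w])
  then have "mdist (submetric euclidean_metric UNIV) (restrict z {0..T} t) (restrict w {0..T} t) \<le> C_dist T z w"
    unfolding C_dist_def C_space_def by (rule mdist_cfunspace_imp_mdist_le) (use assms in auto)
  then show ?thesis using assms(3) by (simp add: dist_norm)
qed

lemma C_set_dist_le: "w \<in> U \<Longrightarrow> C_set_dist T z U \<le> C_dist T z w"
  unfolding C_set_dist_def C_dist_def by (intro cINF_lower bdd_belowI2[of _ 0]) auto

lemma usual_filtration_AE_measurable:
  assumes F: "usual_filtration M Ft" and B: "B \<in> sets M" and A: "A \<subseteq> space M"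
    and AE: "AE \<omega> in M. \<omega> \<in> A \<longleftrightarrow> \<omega> \<in> B"
  shows "A \<in> sets M"
proof -
  obtain N where N: "{\<omega> \<in> space M. \<not> (\<omega> \<in> A \<longleftrightarrow> \<omega> \<in> B)} \<subseteq> N" "N \<in> null_sets M"
    using AE unfolding eventually_ae_filter by blast
  have null: "\<forall>N\<in>null_sets M. \<forall>B\<subseteq>N. B \<in> sets (Ft 0)"
    using F[unfolded usual_filtration_def, THEN conjunct2, THEN conjunct2, THEN conjunct1] .
  have sub: "C \<in> sets M" if "C \<subseteq> N" for C
    using null N(2) that usual_filtrationD(2)[OF F, of 0] by blast
  have "A - B \<in> sets M" "B - A \<in> sets M"
    using N(1) A sets.sets_into_space[OF B] by (intro sub; auto)+
  then have "(B - (B - A)) \<union> (A - B) \<in> sets M" using B by auto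
  moreover have "(B - (B - A)) \<union> (A - B) = A" by auto
  ultimately show ?thesis by simp
qed

context skeleton
begin

lemma restrict_in_level_set:
  assumes L: "\<And>i. i \<in> {1..n} \<Longrightarrow> L2_on T (\<psi> i)"
    and z: "solves T n y (\<lambda>i t. r i * integral {0..t} (\<psi> i)) z" and y: "y \<in> Hn n" and T: "0 < T"
    and E: "(\<Sum>i\<in>{1..n}. energy T (\<psi> i)) \<le> 2 * \<alpha>"
  shows "restrict z {0..T} \<in> level_set F Qh \<tau> T n y \<alpha>"
proof -
  have zC: "restrict z {0..T} \<in> mspace (C_space T (Hn n))"
    unfolding mspace_C_space using z unfolding solves_def by (auto intro: continuous_on_eq[of _ z])
  obtain \<phi> where \<phi>: "\<phi> \<in> L2_control T n" "is_controlled_path F Qh \<tau> T n y \<phi> (restrict z {0..T})"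
    "(\<integral>t. (norm (\<phi> t))\<^sup>2 \<partial>lebesgue_on {0<..<T}) = (\<Sum>i\<in>{1..n}. energy T (\<psi> i))"
    by (rule solves_controlled_path[OF L z y T zC])
  have "Inf {ereal (\<integral>t. (norm (\<phi> t))\<^sup>2 \<partial>lebesgue_on {0<..<T}) |\<phi>.
       \<phi> \<in> L2_control T n \<and> is_controlled_path F Qh \<tau> T n y \<phi> (restrict z {0..T})}
     \<le> ereal (\<integral>t. (norm (\<phi> t))\<^sup>2 \<partial>lebesgue_on {0<..<T})"
    using \<phi>(1,2) by (intro Inf_lower) blast
  also have "\<dots> \<le> ereal (2 * \<alpha>)" using E unfolding \<phi>(3) by simp
  finally have "rate_fun F Qh \<tau> T n y (restrict z {0..T}) \<le> ereal (1 / 2) * ereal (2 * \<alpha>)"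
    unfolding rate_fun_def by (rule ereal_mult_left_mono) simp
  then show ?thesis unfolding level_set_def using zC by simp
qed

lemma level_setD:
  assumes z: "z \<in> level_set F Qh \<tau> T n y \<alpha>" and y: "y \<in> Hn n" and T: "0 < T"
  shows "real_of_ereal (rate_fun F Qh \<tau> T n y z) \<le> \<alpha>"
    and "0 < \<eta> \<Longrightarrow> \<exists>\<psi>. (\<forall>i\<in>{1..n}. L2_on T (\<psi> i)) \<and>
      (\<Sum>i\<in>{1..n}. energy T (\<psi> i)) \<le> 2 * real_of_ereal (rate_fun F Qh \<tau> T n y z) + \<eta> \<and>
      solves T n y (\<lambda>i t. r i * integral {0..t} (\<psi> i)) z"
proof -
  let ?A = "{ereal (\<integral>t. (norm (\<phi> t))\<^sup>2 \<partial>lebesgue_on {0<..<T}) |\<phi>.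
       \<phi> \<in> L2_control T n \<and> is_controlled_path F Qh \<tau> T n y \<phi> z}"
  let ?I = "rate_fun F Qh \<tau> T n y z"
  have I: "?I = ereal (1 / 2) * Inf ?A" by (simp add: rate_fun_def)
  have "0 \<le> Inf ?A" by (rule Inf_greatest) (auto intro!: integral_nonneg_AE)
  moreover have le: "?I \<le> ereal \<alpha>" using z unfolding level_set_def by simp
  ultimately obtain a where a: "Inf ?A = ereal a" unfolding I by (cases "Inf ?A") auto
  then have Ia: "?I = ereal (a / 2)" unfolding I by simp
  then show "real_of_ereal ?I \<le> \<alpha>" using le by simp
  assume "0 < \<eta>"
  then have "Inf ?A < ereal (a + \<eta>)" unfolding a by simp
  then obtain \<phi> where \<phi>: "\<phi> \<in> L2_control T n" "is_controlled_path F Qh \<tau> T n y \<phi> z"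
    "ereal (\<integral>t. (norm (\<phi> t))\<^sup>2 \<partial>lebesgue_on {0<..<T}) < ereal (a + \<eta>)"
    unfolding Inf_less_iff by blast
  have "z \<in> mspace (C_space T (Hn n))" using z unfolding level_set_def by simp
  then have zC: "\<And>t. t \<in> {0..T} \<Longrightarrow> z t \<in> Hn n" "continuous_on {0..T} z"
    unfolding mspace_C_space by auto
  obtain \<psi> where \<psi>: "\<forall>i\<in>{1..n}. L2_on T (\<psi> i)"
    "(\<Sum>i\<in>{1..n}. energy T (\<psi> i)) = (\<integral>t. (norm (\<phi> t))\<^sup>2 \<partial>lebesgue_on {0<..<T})"
    "solves T n y (\<lambda>i t. r i * integral {0..t} (\<psi> i)) z"
    by (rule controlled_path_solves[OF \<phi>(1,2) y T zC])
  have "(\<Sum>i\<in>{1..n}. energy T (\<psi> i)) \<le> 2 * real_of_ereal ?I + \<eta>"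
    unfolding \<psi>(2) Ia using \<phi>(3) by simp
  then show "\<exists>\<psi>. (\<forall>i\<in>{1..n}. L2_on T (\<psi> i)) \<and>
      (\<Sum>i\<in>{1..n}. energy T (\<psi> i)) \<le> 2 * real_of_ereal ?I + \<eta> \<and>
      solves T n y (\<lambda>i t. r i * integral {0..t} (\<psi> i)) z" using \<psi>(1,3) by blast
qed

lemma solves_stable_driver:
  assumes T: "0 < T" and n: "1 \<le> n"
    and z: "solves T n y (\<lambda>i t. r i * w i t) z" and z': "solves T n y (\<lambda>i t. r i * w' i t) z'"
    and e: "\<And>i t. i \<in> {1..n} \<Longrightarrow> t \<in> {0..T} \<Longrightarrow> \<bar>w i t - w' i t\<bar> \<le> e"
    and t: "t \<in> {0..T}"
  shows "norm (z t - z' t) \<le> stab T n * ((\<Sum>i\<in>{1..n}. r i) * e)"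
proof (rule solves_stable[OF T n z z' _ t])
  fix i t assume i: "i \<in> {1..n}" and t: "t \<in> {0..T}"
  have "\<bar>r i * w i t - r i * w' i t\<bar> = r i * \<bar>w i t - w' i t\<bar>"
    using r_pos[of i] i by (simp add: abs_mult right_diff_distrib[symmetric])
  also have "\<dots> \<le> r i * e" using e[OF i t] r_pos[of i] i by (intro mult_left_mono) auto
  also have "\<dots> \<le> (\<Sum>i\<in>{1..n}. r i) * e"
  proof (rule mult_right_mono)
    show "r i \<le> (\<Sum>i\<in>{1..n}. r i)" using r_pos i by (intro member_le_sum) (auto intro: less_imp_le)
    show "0 \<le> e" using e[OF i t] by linarith
  qed
  finally show "\<bar>r i * w i t - r i * w' i t\<bar> \<le> (\<Sum>i\<in>{1..n}. r i) * e" .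
qed

lemma stab_pos: "1 \<le> n \<Longrightarrow> 0 < stab T n * (\<Sum>i\<in>{1..n}. r i)"
  unfolding stab_def using r_pos by (intro mult_pos_pos sum_pos) auto

lemma level_set_compact:
  assumes T: "0 < T" and n: "1 \<le> n" and y: "y \<in> Hn n" and \<alpha>: "0 \<le> \<alpha>"
  shows "compactin (mtopology_of (C_space T (Hn n))) (level_set F Qh \<tau> T n y \<alpha>)"
proof -
  interpret C: Metric_space "mspace (C_space T (Hn n))" "mdist (C_space T (Hn n))"
    by (rule Metric_space_mspace_mdist)
  let ?c = "stab T n * (\<Sum>i\<in>{1..n}. r i)"
  have c: "0 < ?c" using stab_pos[OF n] .
  have "compactin C.mtopology (level_set F Qh \<tau> T n y \<alpha>)"
    unfolding C.compactin_sequentially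
  proof (intro conjI allI impI)
    show "level_set F Qh \<tau> T n y \<alpha> \<subseteq> mspace (C_space T (Hn n))" unfolding level_set_def by auto
    fix \<sigma> :: "nat \<Rightarrow> real \<Rightarrow> L2" assume \<sigma>: "range \<sigma> \<subseteq> level_set F Qh \<tau> T n y \<alpha>"
    then have \<sigma>k: "\<sigma> k \<in> level_set F Qh \<tau> T n y \<alpha>" for k by auto
    have "\<forall>k. \<exists>\<psi>. (\<forall>i\<in>{1..n}. L2_on T (\<psi> i)) \<and> (\<Sum>i\<in>{1..n}. energy T (\<psi> i)) \<le> 2 * \<alpha> + inverse (real (Suc k)) \<and>
        solves T n y (\<lambda>i t. r i * integral {0..t} (\<psi> i)) (\<sigma> k)"
    proof
      fix k
      have "0 < inverse (real (Suc k))" by simp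
      from level_setD(2)[OF \<sigma>k[of k] y T this] obtain \<psi> where \<psi>: "\<forall>i\<in>{1..n}. L2_on T (\<psi> i)"
        "(\<Sum>i\<in>{1..n}. energy T (\<psi> i)) \<le> 2 * real_of_ereal (rate_fun F Qh \<tau> T n y (\<sigma> k)) + inverse (real (Suc k))"
        "solves T n y (\<lambda>i t. r i * integral {0..t} (\<psi> i)) (\<sigma> k)" by (elim exE conjE)
      then have "(\<Sum>i\<in>{1..n}. energy T (\<psi> i)) \<le> 2 * \<alpha> + inverse (real (Suc k))"
        using level_setD(1)[OF \<sigma>k[of k] y T] by linarith
      with \<psi> show "\<exists>\<psi>. (\<forall>i\<in>{1..n}. L2_on T (\<psi> i)) \<and> (\<Sum>i\<in>{1..n}. energy T (\<psi> i)) \<le> 2 * \<alpha> + inverse (real (Suc k)) \<and>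
        solves T n y (\<lambda>i t. r i * integral {0..t} (\<psi> i)) (\<sigma> k)" by (intro exI[of _ \<psi>] conjI)
    qed
    from choice[OF this] obtain \<Phi> where "\<forall>k. (\<forall>i\<in>{1..n}. L2_on T (\<Phi> k i)) \<and>
        (\<Sum>i\<in>{1..n}. energy T (\<Phi> k i)) \<le> 2 * \<alpha> + inverse (real (Suc k)) \<and>
        solves T n y (\<lambda>i t. r i * integral {0..t} (\<Phi> k i)) (\<sigma> k)" ..
    then have \<Phi>: "\<And>k i. i \<in> {1..n} \<Longrightarrow> L2_on T (\<Phi> k i)"
      "\<And>k. (\<Sum>i\<in>{1..n}. energy T (\<Phi> k i)) \<le> 2 * \<alpha> + inverse (real (Suc k))"
      "\<And>k. solves T n y (\<lambda>i t. r i * integral {0..t} (\<Phi> k i)) (\<sigma> k)" by blast+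
    have "0 \<le> 2 * \<alpha>" using \<alpha> by simp
    from controls_sequentially_compact[OF T this \<Phi>(1,2)]
    obtain \<phi> and s :: "nat \<Rightarrow> nat" where s: "strict_mono s" and \<phi>: "\<forall>i\<in>{1..n}. L2_on T (\<phi> i)" "(\<Sum>i\<in>{1..n}. energy T (\<phi> i)) \<le> 2 * \<alpha>"
      and conv: "\<forall>e>0. \<exists>N. \<forall>k\<ge>N. \<forall>i\<in>{1..n}. \<forall>t\<in>{0..T}. \<bar>integral {0..t} (\<Phi> (s k) i) - integral {0..t} (\<phi> i)\<bar> \<le> e"
      by blast
    obtain z where z: "solves T n y (\<lambda>i t. r i * integral {0..t} (\<phi> i)) z"
      by (rule solves_exists[OF T y, of \<phi>]) (use \<phi>(1) in blast)+
    have zl: "restrict z {0..T} \<in> level_set F Qh \<tau> T n y \<alpha>"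
      by (rule restrict_in_level_set[OF _ z y T \<phi>(2)]) (use \<phi>(1) in blast)
    have "limitin C.mtopology (\<sigma> \<circ> s) (restrict z {0..T}) sequentially"
      unfolding C.limit_metric_sequentially
    proof (intro conjI allI impI)
      show "restrict z {0..T} \<in> mspace (C_space T (Hn n))" using zl unfolding level_set_def by auto
      fix e :: real assume e: "0 < e"
      then have "0 < e / (2 * ?c)" using c by simp
      with conv obtain N where N: "\<And>k i t. k \<ge> N \<Longrightarrow> i \<in> {1..n} \<Longrightarrow> t \<in> {0..T} \<Longrightarrow>
          \<bar>integral {0..t} (\<Phi> (s k) i) - integral {0..t} (\<phi> i)\<bar> \<le> e / (2 * ?c)" by blast
      have "(\<sigma> \<circ> s) k \<in> mspace (C_space T (Hn n)) \<and> mdist (C_space T (Hn n)) ((\<sigma> \<circ> s) k) (restrict z {0..T}) < e" if k: "k \<ge> N" for k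
      proof
        show "(\<sigma> \<circ> s) k \<in> mspace (C_space T (Hn n))" using \<sigma>k[of "s k"] unfolding level_set_def by auto
        have "mdist (C_space T (Hn n)) (\<sigma> (s k)) (restrict z {0..T}) \<le> e / 2"
        proof (rule mdist_C_space_le)
          fix t assume t: "t \<in> {0..T}"
          have "norm (\<sigma> (s k) t - z t) \<le> stab T n * ((\<Sum>i\<in>{1..n}. r i) * (e / (2 * ?c)))"
            by (rule solves_stable_driver[OF T n \<Phi>(3) z N[OF k] t])
          also have "\<dots> = ?c * (e / (2 * ?c))" by (simp only: mult.assoc)
          also have "\<dots> = e / 2"
          proof -
            have "x * (e / (2 * x)) = e / 2" if "0 < x" for x using that by simp
            from this[OF c] show ?thesis .
          qed
          finally show "norm (\<sigma> (s k) t - restrict z {0..T} t) \<le> e / 2" using t by simp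
        qed (use e in simp)
        then show "mdist (C_space T (Hn n)) ((\<sigma> \<circ> s) k) (restrict z {0..T}) < e" using e by simp
      qed
      then show "\<exists>N. \<forall>k\<ge>N. (\<sigma> \<circ> s) k \<in> mspace (C_space T (Hn n)) \<and> mdist (C_space T (Hn n)) ((\<sigma> \<circ> s) k) (restrict z {0..T}) < e"
        by blast
    qed
    with s zl show "\<exists>l r. l \<in> level_set F Qh \<tau> T n y \<alpha> \<and> strict_mono r \<and> limitin C.mtopology (\<sigma> \<circ> r) l sequentially"
      by blast
  qed
  then show ?thesis unfolding mtopology_of_def .
qed

end

section \<open>The uniform large deviation bounds\<close>


context skeleton
begin

lemma euler_lower_bound:
  assumes prob: "prob_space M" and F: "usual_filtration M Ft" and W: "cylindrical_wiener M Ft \<beta>"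
    and Y: "\<And>\<epsilon> y. 0 < \<epsilon> \<Longrightarrow> y \<in> Hn n \<Longrightarrow> euler_interpolation M Ft \<beta> F Qh \<tau> \<epsilon> n y (Y \<epsilon> y)"
    and T: "0 < T" and n: "1 \<le> n" and \<alpha>: "0 \<le> \<alpha>" and \<delta>: "0 < \<delta>" and \<gamma>: "0 < \<gamma>"
  shows "\<exists>\<epsilon>\<^sub>0>0. \<forall>y\<in>Hn n. \<forall>z\<in>level_set F Qh \<tau> T n y \<alpha>. \<forall>\<epsilon>. 0 < \<epsilon> \<and> \<epsilon> \<le> \<epsilon>\<^sub>0 \<longrightarrow>
    exp (- (real_of_ereal (rate_fun F Qh \<tau> T n y z) + \<gamma>) / \<epsilon>\<^sup>2)
      \<le> measure M {\<omega> \<in> space M. C_dist T (\<lambda>t. Y \<epsilon> y t \<omega>) z < \<delta>}"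
proof -
  interpret prob_space M by (rule prob)
  let ?c = "stab T n * (\<Sum>i\<in>{1..n}. r i)"
  have c: "0 < ?c" using stab_pos[OF n] .
  define \<delta>' where "\<delta>' = \<delta> / (2 * ?c)"
  have \<delta>': "0 < \<delta>'" using \<delta> c unfolding \<delta>'_def by simp
  have c\<delta>': "stab T n * ((\<Sum>i\<in>{1..n}. r i) * \<delta>') = \<delta> / 2"
  proof -
    have "x * (\<delta> / (2 * x)) = \<delta> / 2" if "0 < x" for x using that by simp
    from this[OF c] show ?thesis unfolding \<delta>'_def by (simp only: mult.assoc)
  qed
  have \<alpha>': "0 \<le> \<alpha> + \<gamma> / 2" and \<gamma>': "0 < \<gamma> / 2" using \<alpha> \<gamma> by auto
  obtain \<epsilon>\<^sub>0 where \<epsilon>\<^sub>0: "0 < \<epsilon>\<^sub>0" and low: "\<forall>\<epsilon> \<phi>. 0 < \<epsilon> \<and> \<epsilon> \<le> \<epsilon>\<^sub>0 \<and> (\<forall>i\<in>{1..n}. L2_on T (\<phi> i)) \<and>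
    (\<Sum>i\<in>{1..n}. energy T (\<phi> i)) \<le> 2 * (\<alpha> + \<gamma> / 2) \<longrightarrow>
    (\<exists>G\<in>events. exp (- ((\<Sum>i\<in>{1..n}. energy T (\<phi> i)) / 2 + \<gamma> / 2) / \<epsilon>\<^sup>2) \<le> prob G \<and>
     (AE \<omega> in M. \<omega> \<in> G \<longrightarrow> (\<forall>i\<in>{1..n}. \<forall>t\<in>{0..T}. \<bar>\<epsilon> * \<beta> i t \<omega> - integral {0..t} (\<phi> i)\<bar> < \<delta>')))"
    using wiener_lower_bound[OF F W n T \<alpha>' \<delta>' \<gamma>'] by (elim exE conjE)
  show ?thesis
  proof (intro exI[of _ \<epsilon>\<^sub>0] conjI ballI allI impI)
    fix y z \<epsilon> assume y: "y \<in> Hn n" and z: "z \<in> level_set F Qh \<tau> T n y \<alpha>" and e: "0 < \<epsilon> \<and> \<epsilon> \<le> \<epsilon>\<^sub>0"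
    define \<rho> where "\<rho> = real_of_ereal (rate_fun F Qh \<tau> T n y z)"
    have \<rho>: "\<rho> \<le> \<alpha>" unfolding \<rho>_def by (rule level_setD(1)[OF z y T])
    obtain \<phi> where \<phi>: "\<forall>i\<in>{1..n}. L2_on T (\<phi> i)" "(\<Sum>i\<in>{1..n}. energy T (\<phi> i)) \<le> 2 * \<rho> + \<gamma>"
      "solves T n y (\<lambda>i t. r i * integral {0..t} (\<phi> i)) z"
      using level_setD(2)[OF z y T \<gamma>] unfolding \<rho>_def by (elim exE conjE)
    have "(\<Sum>i\<in>{1..n}. energy T (\<phi> i)) \<le> 2 * (\<alpha> + \<gamma> / 2)" using \<phi>(2) \<rho> by simp
    with low e \<phi>(1) have "\<exists>G\<in>events. exp (- ((\<Sum>i\<in>{1..n}. energy T (\<phi> i)) / 2 + \<gamma> / 2) / \<epsilon>\<^sup>2) \<le> prob G \<and>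
       (AE \<omega> in M. \<omega> \<in> G \<longrightarrow> (\<forall>i\<in>{1..n}. \<forall>t\<in>{0..T}. \<bar>\<epsilon> * \<beta> i t \<omega> - integral {0..t} (\<phi> i)\<bar> < \<delta>'))" by simp
    then
    obtain G where G: "G \<in> events" "exp (- ((\<Sum>i\<in>{1..n}. energy T (\<phi> i)) / 2 + \<gamma> / 2) / \<epsilon>\<^sup>2) \<le> prob G"
      "AE \<omega> in M. \<omega> \<in> G \<longrightarrow> (\<forall>i\<in>{1..n}. \<forall>t\<in>{0..T}. \<bar>\<epsilon> * \<beta> i t \<omega> - integral {0..t} (\<phi> i)\<bar> < \<delta>')" by blast
    have Ye: "euler_interpolation M Ft \<beta> F Qh \<tau> \<epsilon> n y (Y \<epsilon> y)" using Y e y by simp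
    have Ysol: "AE \<omega> in M. solves T n y (\<lambda>i t. r i * (\<epsilon> * \<beta> i t \<omega>)) (\<lambda>t. Y \<epsilon> y t \<omega>)"
      using euler_interpolation_solves[OF Ye y] by eventually_elim simp
    have zc: "continuous_on {0..T} z" using \<phi>(3) unfolding solves_def by simp
    let ?A = "{\<omega> \<in> space M. C_dist T (\<lambda>t. Y \<epsilon> y t \<omega>) z < \<delta>}"
    define u where "u l j = 0 + (T - 0) * (real j / 2 ^ l)" for l j :: nat
    define B where "B = {\<omega> \<in> space M. \<exists>k::nat. \<forall>l. \<forall>j\<in>{..2^l}. norm (Y \<epsilon> y (u l j) \<omega> - z (u l j)) \<le> \<delta> - inverse (real (Suc k))}"
    have u0: "u l j \<in> {0..T}" if "j \<le> 2 ^ l" for l j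
    proof -
      have "real j \<le> 2 ^ l" using that of_nat_le_iff[of j "2 ^ l", where 'a = real] by simp
      then have "0 \<le> T * (real j / 2 ^ l)" "T * (real j / 2 ^ l) \<le> T * 1"
        using T by (intro mult_nonneg_nonneg mult_left_mono; simp)+
      then show ?thesis unfolding u_def by simp
    qed
    have Ym: "(\<lambda>\<omega>. norm (Y \<epsilon> y t \<omega> - z t)) \<in> borel_measurable M" if "0 \<le> t" for t
    proof -
      have "Y \<epsilon> y t \<in> borel_measurable (Ft t)" using Ye that unfolding euler_interpolation_def by simp
      moreover have "(\<lambda>v. norm (v - z t)) \<in> borel_measurable borel"
        by (intro borel_measurable_continuous_onI continuous_intros)
      ultimately have "(\<lambda>\<omega>. norm (Y \<epsilon> y t \<omega> - z t)) \<in> borel_measurable (Ft t)" by (rule measurable_compose)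
      then show ?thesis by (rule usual_filtration_measurable(2)[OF F that])
    qed
    have "{\<omega> \<in> space M. norm (Y \<epsilon> y (u l j) \<omega> - z (u l j)) \<le> \<delta> - inverse (real (Suc k))} \<in> events" if "j \<in> {..2^l}" for l j k
      using Ym[of "u l j"] u0[of j l] that by (intro borel_measurable_le) auto
    then have B: "B \<in> events" unfolding B_def
      by (intro sets.sets_Collect_countable_Ex sets.sets_Collect_countable_All sets.sets_Collect_finite_All) auto
    have "AE \<omega> in M. \<omega> \<in> ?A \<longleftrightarrow> \<omega> \<in> B"
      using Ysol AE_space
    proof eventually_elim
      case (elim \<omega>)
      have Yc: "continuous_on {0..T} (\<lambda>t. Y \<epsilon> y t \<omega>)" using elim(1) unfolding solves_def by simp
      show "\<omega> \<in> ?A \<longleftrightarrow> \<omega> \<in> B"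
      proof
        assume "\<omega> \<in> ?A"
        then have "0 < \<delta> - C_dist T (\<lambda>t. Y \<epsilon> y t \<omega>) z" by simp
        then obtain k where k: "inverse (real (Suc k)) < \<delta> - C_dist T (\<lambda>t. Y \<epsilon> y t \<omega>) z" using reals_Archimedean by blast
        have "norm (Y \<epsilon> y (u l j) \<omega> - z (u l j)) \<le> \<delta> - inverse (real (Suc k))" if "j \<in> {..2^l}" for l j
          using norm_le_C_dist[OF Yc zc u0[of j l]] that k by simp
        then show "\<omega> \<in> B" unfolding B_def using elim(2) by blast
      next
        assume "\<omega> \<in> B"
        then obtain k where k: "\<And>l j. j \<le> 2 ^ l \<Longrightarrow> norm (Y \<epsilon> y (u l j) \<omega> - z (u l j)) \<le> \<delta> - inverse (real (Suc k))"
          unfolding B_def by blast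
        have le: "\<forall>t\<in>{0..T}. norm (Y \<epsilon> y t \<omega> - z t) \<le> \<delta> - inverse (real (Suc k))"
          using k T unfolding u_def by (intro le_if_le_on_dyadics continuous_intros Yc zc) auto
        have "0 \<le> norm (Y \<epsilon> y 0 \<omega> - z 0)" by simp
        also have "\<dots> \<le> \<delta> - inverse (real (Suc k))" using le T by simp
        finally have "C_dist T (\<lambda>t. Y \<epsilon> y t \<omega>) z \<le> \<delta> - inverse (real (Suc k))"
          using le by (intro C_dist_le) auto
        also have "\<dots> < \<delta>" by simp
        finally show "\<omega> \<in> ?A" using elim(2) by simp
      qed
    qed
    then have A: "?A \<in> events" by (intro usual_filtration_AE_measurable[OF F B]) auto
    have "AE \<omega> in M. \<omega> \<in> G \<longrightarrow> \<omega> \<in> ?A"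
      using G(3) Ysol AE_space
    proof eventually_elim
      case (elim \<omega>)
      show ?case
      proof
        assume w: "\<omega> \<in> G"
        have "norm (Y \<epsilon> y t \<omega> - z t) \<le> stab T n * ((\<Sum>i\<in>{1..n}. r i) * \<delta>')" if t: "t \<in> {0..T}" for t
          by (rule solves_stable_driver[OF T n elim(2) \<phi>(3) _ t]) (use elim(1) w in \<open>auto intro: less_imp_le\<close>)
        then have "C_dist T (\<lambda>t. Y \<epsilon> y t \<omega>) z \<le> \<delta> / 2" unfolding c\<delta>' using \<delta> by (intro C_dist_le) auto
        then show "\<omega> \<in> ?A" using \<delta> elim(3) by simp
      qed
    qed
    then have "prob G \<le> prob ?A" using A by (rule finite_measure_mono_AE)
    moreover have "exp (- (\<rho> + \<gamma>) / \<epsilon>\<^sup>2) \<le> exp (- ((\<Sum>i\<in>{1..n}. energy T (\<phi> i)) / 2 + \<gamma> / 2) / \<epsilon>\<^sup>2)"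
    proof -
      have "(\<Sum>i\<in>{1..n}. energy T (\<phi> i)) / 2 + \<gamma> / 2 \<le> \<rho> + \<gamma>" using \<phi>(2) by simp
      then have "- (\<rho> + \<gamma>) / \<epsilon>\<^sup>2 \<le> - ((\<Sum>i\<in>{1..n}. energy T (\<phi> i)) / 2 + \<gamma> / 2) / \<epsilon>\<^sup>2"
        by (intro divide_right_mono) auto
      then show ?thesis by (simp only: exp_le_cancel_iff)
    qed
    ultimately show "exp (- (real_of_ereal (rate_fun F Qh \<tau> T n y z) + \<gamma>) / \<epsilon>\<^sup>2) \<le> prob ?A"
      using G(2) unfolding \<rho>_def by linarith
  qed (rule \<epsilon>\<^sub>0)
qed

lemma euler_upper_bound:
  assumes prob: "prob_space M" and F: "usual_filtration M Ft" and W: "cylindrical_wiener M Ft \<beta>"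
    and Y: "\<And>\<epsilon> y. 0 < \<epsilon> \<Longrightarrow> y \<in> Hn n \<Longrightarrow> euler_interpolation M Ft \<beta> F Qh \<tau> \<epsilon> n y (Y \<epsilon> y)"
    and T: "0 < T" and n: "1 \<le> n" and \<alpha>: "0 \<le> \<alpha>" and \<delta>: "0 < \<delta>" and \<gamma>: "0 < \<gamma>"
  shows "\<exists>\<epsilon>\<^sub>0>0. \<forall>y\<in>Hn n. \<forall>\<epsilon>. 0 < \<epsilon> \<and> \<epsilon> \<le> \<epsilon>\<^sub>0 \<longrightarrow>
    measure M {\<omega> \<in> space M. \<delta> \<le> C_set_dist T (\<lambda>t. Y \<epsilon> y t \<omega>) (level_set F Qh \<tau> T n y \<alpha>)}
      \<le> exp (- (\<alpha> - \<gamma>) / \<epsilon>\<^sup>2)"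
proof -
  interpret prob_space M by (rule prob)
  let ?c = "stab T n * (\<Sum>i\<in>{1..n}. r i)"
  have c: "0 < ?c" using stab_pos[OF n] .
  define \<delta>' where "\<delta>' = \<delta> / (2 * ?c)"
  have \<delta>': "0 < \<delta>'" using \<delta> c unfolding \<delta>'_def by simp
  have c\<delta>': "stab T n * ((\<Sum>i\<in>{1..n}. r i) * \<delta>') = \<delta> / 2"
  proof -
    have "x * (\<delta> / (2 * x)) = \<delta> / 2" if "0 < x" for x using that by simp
    from this[OF c] show ?thesis unfolding \<delta>'_def by (simp only: mult.assoc)
  qed
  obtain \<epsilon>\<^sub>0 where \<epsilon>\<^sub>0: "0 < \<epsilon>\<^sub>0" and up: "\<forall>\<epsilon>. 0 < \<epsilon> \<and> \<epsilon> \<le> \<epsilon>\<^sub>0 \<longrightarrow>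
    (\<exists>G\<in>events. prob G \<le> exp (- (\<alpha> - \<gamma>) / \<epsilon>\<^sup>2) \<and>
     (AE \<omega> in M. \<omega> \<notin> G \<longrightarrow> (\<exists>\<phi>. (\<forall>i\<in>{1..n}. L2_on T (\<phi> i)) \<and> (\<Sum>i\<in>{1..n}. energy T (\<phi> i)) \<le> 2 * \<alpha> \<and>
        (\<forall>i\<in>{1..n}. \<forall>t\<in>{0..T}. \<bar>\<epsilon> * \<beta> i t \<omega> - integral {0..t} (\<phi> i)\<bar> < \<delta>'))))"
    using wiener_upper_bound[OF F W n T \<alpha> \<delta>' \<gamma>] by (elim exE conjE)
  show ?thesis
  proof (intro exI[of _ \<epsilon>\<^sub>0] conjI ballI allI impI)
    fix y \<epsilon> assume y: "y \<in> Hn n" and e: "0 < \<epsilon> \<and> \<epsilon> \<le> \<epsilon>\<^sub>0"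
    obtain G where G: "G \<in> events" "prob G \<le> exp (- (\<alpha> - \<gamma>) / \<epsilon>\<^sup>2)"
      "AE \<omega> in M. \<omega> \<notin> G \<longrightarrow> (\<exists>\<phi>. (\<forall>i\<in>{1..n}. L2_on T (\<phi> i)) \<and> (\<Sum>i\<in>{1..n}. energy T (\<phi> i)) \<le> 2 * \<alpha> \<and>
        (\<forall>i\<in>{1..n}. \<forall>t\<in>{0..T}. \<bar>\<epsilon> * \<beta> i t \<omega> - integral {0..t} (\<phi> i)\<bar> < \<delta>'))"
      using mp[OF spec[OF up] e] by blast
    have Ye: "euler_interpolation M Ft \<beta> F Qh \<tau> \<epsilon> n y (Y \<epsilon> y)" using Y e y by simp
    have Ysol: "AE \<omega> in M. solves T n y (\<lambda>i t. r i * (\<epsilon> * \<beta> i t \<omega>)) (\<lambda>t. Y \<epsilon> y t \<omega>)"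
      using euler_interpolation_solves[OF Ye y] by eventually_elim simp
    let ?A = "{\<omega> \<in> space M. \<delta> \<le> C_set_dist T (\<lambda>t. Y \<epsilon> y t \<omega>) (level_set F Qh \<tau> T n y \<alpha>)}"
    have "AE \<omega> in M. \<omega> \<in> ?A \<longrightarrow> \<omega> \<in> G"
      using G(3) Ysol
    proof eventually_elim
      case (elim \<omega>)
      show ?case
      proof (intro impI, rule ccontr)
        assume w: "\<omega> \<in> ?A" "\<omega> \<notin> G"
        obtain \<phi> where \<phi>: "\<forall>i\<in>{1..n}. L2_on T (\<phi> i)" "(\<Sum>i\<in>{1..n}. energy T (\<phi> i)) \<le> 2 * \<alpha>"
          "\<forall>i\<in>{1..n}. \<forall>t\<in>{0..T}. \<bar>\<epsilon> * \<beta> i t \<omega> - integral {0..t} (\<phi> i)\<bar> < \<delta>'"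
          using elim(1) w(2) by blast
        obtain z where z: "solves T n y (\<lambda>i t. r i * integral {0..t} (\<phi> i)) z"
          by (rule solves_exists[OF T y, of \<phi>]) (use \<phi>(1) in blast)+
        have zl: "restrict z {0..T} \<in> level_set F Qh \<tau> T n y \<alpha>"
          by (rule restrict_in_level_set[OF _ z y T \<phi>(2)]) (use \<phi>(1) in blast)
        have "norm (Y \<epsilon> y t \<omega> - z t) \<le> stab T n * ((\<Sum>i\<in>{1..n}. r i) * \<delta>')" if t: "t \<in> {0..T}" for t
          by (rule solves_stable_driver[OF T n elim(2) z _ t]) (use \<phi>(3) in \<open>auto intro: less_imp_le\<close>)
        then have "C_dist T (\<lambda>t. Y \<epsilon> y t \<omega>) (restrict z {0..T}) \<le> \<delta> / 2"
          unfolding c\<delta>' using \<delta> by (intro C_dist_le) auto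
        then have "C_set_dist T (\<lambda>t. Y \<epsilon> y t \<omega>) (level_set F Qh \<tau> T n y \<alpha>) \<le> \<delta> / 2"
          using C_set_dist_le[OF zl, of T "\<lambda>t. Y \<epsilon> y t \<omega>"] by linarith
        then show False using w(1) \<delta> by simp
      qed
    qed
    then have "prob ?A \<le> prob G"
      using G(1) by (rule finite_measure_mono_AE)
    then show "prob ?A \<le> exp (- (\<alpha> - \<gamma>) / \<epsilon>\<^sup>2)" using G(2) by linarith
  qed (rule \<epsilon>\<^sub>0)
qed

end

theorem theorem4p1:
  fixes M :: "'a measure" and Ft :: "real \<Rightarrow> 'a measure" and \<beta> :: "nat \<Rightarrow> real \<Rightarrow> 'a \<Rightarrow> real"
    and Q Qh :: "L2 \<Rightarrow> L2" and q :: "nat \<Rightarrow> real"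
    and F :: "L2 \<Rightarrow> L2" and F' :: "L2 \<Rightarrow> L2 \<Rightarrow> L2" and L\<^sub>F L \<tau> :: real
    and Y :: "real \<Rightarrow> nat \<Rightarrow> L2 \<Rightarrow> real \<Rightarrow> 'a \<Rightarrow> L2"
  assumes prob: "prob_space M"
    and filt: "usual_filtration M Ft"
    and wiener: "cylindrical_wiener M Ft \<beta>"
    and Q: "bounded_linear Q" "self_adjoint Q" "\<And>u. u \<noteq> 0 \<Longrightarrow> 0 < inner (Q u) u"
    and Q_eig: "\<And>i. 1 \<le> i \<Longrightarrow> Q (eb i) = q i *\<^sub>R eb i" "\<And>i. 1 \<le> i \<Longrightarrow> 0 < q i"
    and Qh: "is_sqrt_op Qh Q"
    and dom: "dom_lap \<subseteq> range Qh"
    and HS: "range Qh \<subseteq> dom_neg_A_pow (1 / 2)" "hilbert_schmidt (\<lambda>u. neg_A_pow (1 / 2) (Qh u))"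
    and bdd: "bounded_linear (\<lambda>u. inv Qh (neg_A_inv u))"
    and F_diff: "\<And>u. (F has_derivative F' u) (at u)"
    and const_pos: "0 < L\<^sub>F" "0 < L"
    and F_lip: "\<And>u v. norm (F u - F v) \<le> L\<^sub>F * norm (u - v)"
    and F_growth: "\<And>u. u \<in> Hdot 1 \<Longrightarrow>
          F u \<in> Hdot 1 \<and> Hdot_norm 1 (F u) \<le> L * (1 + Hdot_norm 1 u)"
    and F'_growth: "\<And>u v. u \<in> Hdot 2 \<Longrightarrow> v \<in> Hdot 2 \<Longrightarrow>
          F' u v \<in> Hdot 2 \<and> Hdot_norm 2 (F' u v) \<le> L * (1 + (Hdot_norm 2 u)\<^sup>2) * Hdot_norm 2 v"
    and \<tau>: "0 < \<tau>"
    and Y: "\<And>\<epsilon> n y. 0 < \<epsilon> \<Longrightarrow> 1 \<le> n \<Longrightarrow> y \<in> Hn n \<Longrightarrow>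
          euler_interpolation M Ft \<beta> F Qh \<tau> \<epsilon> n y (Y \<epsilon> n y)"
  shows
    "(\<forall>T>0. \<forall>n\<ge>1. \<forall>y\<in>Hn n. \<forall>\<alpha>\<ge>0.
        compactin (mtopology_of (C_space T (Hn n))) (level_set F Qh \<tau> T n y \<alpha>))
   \<and> (\<forall>T>0. \<forall>n\<ge>1. \<forall>\<alpha>\<ge>0. \<forall>\<delta>>0. \<forall>\<gamma>>0. \<forall>K>0. \<exists>\<epsilon>\<^sub>0>0.
        \<forall>y\<in>Hn n. norm y \<le> K \<longrightarrow> (\<forall>z\<in>level_set F Qh \<tau> T n y \<alpha>. \<forall>\<epsilon>. 0 < \<epsilon> \<and> \<epsilon> \<le> \<epsilon>\<^sub>0 \<longrightarrow>
          exp (- (real_of_ereal (rate_fun F Qh \<tau> T n y z) + \<gamma>) / \<epsilon>\<^sup>2)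
            \<le> measure M {\<omega> \<in> space M. C_dist T (\<lambda>t. Y \<epsilon> n y t \<omega>) z < \<delta>}))
   \<and> (\<forall>T>0. \<forall>n\<ge>1. \<forall>\<alpha>\<ge>0. \<forall>\<delta>>0. \<forall>\<gamma>>0. \<forall>K>0. \<exists>\<epsilon>\<^sub>0>0.
        \<forall>y\<in>Hn n. norm y \<le> K \<longrightarrow> (\<forall>\<epsilon>. 0 < \<epsilon> \<and> \<epsilon> \<le> \<epsilon>\<^sub>0 \<longrightarrow>
          measure M {\<omega> \<in> space M. \<delta> \<le> C_set_dist T (\<lambda>t. Y \<epsilon> n y t \<omega>) (level_set F Qh \<tau> T n y \<alpha>)}
            \<le> exp (- (\<alpha> - \<gamma>) / \<epsilon>\<^sup>2)))"
proof -
  have Qh_eb: "Qh (eb i) = sqrt (q i) *\<^sub>R eb i" if "1 \<le> i" for i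
    by (rule sqrt_op_eb[OF Qh Q_eig(1)[OF that] Q_eig(2)[OF that]])
  have Qh_linear: "linear Qh"
    using Qh unfolding is_sqrt_op_def by (auto intro: bounded_linear.linear)
  interpret skeleton F Qh \<tau> L\<^sub>F "\<lambda>i. sqrt (q i)"
    by (rule skeleton.intro) (use \<tau> const_pos(1) F_lip Qh_linear Qh_eb Q_eig(2) in simp_all)
  show ?thesis
  proof (intro conjI allI impI ballI)
    show "compactin (mtopology_of (C_space T (Hn n))) (level_set F Qh \<tau> T n y \<alpha>)"
      if "0 < T" "1 \<le> n" "y \<in> Hn n" "0 \<le> \<alpha>" for T n y \<alpha>
      using that by (rule level_set_compact)
  next
    fix T \<alpha> \<delta> \<gamma> K :: real and n :: nat
    assume a: "0 < T" "1 \<le> n" "0 \<le> \<alpha>" "0 < \<delta>" "0 < \<gamma>"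
    note Yn = Y[OF _ a(2)]
    from euler_lower_bound[OF prob filt wiener Yn a]
    show "\<exists>\<epsilon>\<^sub>0>0. \<forall>y\<in>Hn n. norm y \<le> K \<longrightarrow> (\<forall>z\<in>level_set F Qh \<tau> T n y \<alpha>. \<forall>\<epsilon>. 0 < \<epsilon> \<and> \<epsilon> \<le> \<epsilon>\<^sub>0 \<longrightarrow>
          exp (- (real_of_ereal (rate_fun F Qh \<tau> T n y z) + \<gamma>) / \<epsilon>\<^sup>2)
            \<le> measure M {\<omega> \<in> space M. C_dist T (\<lambda>t. Y \<epsilon> n y t \<omega>) z < \<delta>})"
      by blast
  next
    fix T \<alpha> \<delta> \<gamma> K :: real and n :: nat
    assume a: "0 < T" "1 \<le> n" "0 \<le> \<alpha>" "0 < \<delta>" "0 < \<gamma>"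
    note Yn = Y[OF _ a(2)]
    from euler_upper_bound[OF prob filt wiener Yn a]
    show "\<exists>\<epsilon>\<^sub>0>0. \<forall>y\<in>Hn n. norm y \<le> K \<longrightarrow> (\<forall>\<epsilon>. 0 < \<epsilon> \<and> \<epsilon> \<le> \<epsilon>\<^sub>0 \<longrightarrow>
          measure M {\<omega> \<in> space M. \<delta> \<le> C_set_dist T (\<lambda>t. Y \<epsilon> n y t \<omega>) (level_set F Qh \<tau> T n y \<alpha>)}
            \<le> exp (- (\<alpha> - \<gamma>) / \<epsilon>\<^sup>2))"
      by blast
  qed
qed

end
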